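(* There exist linear maps $T_K:\mathcal{F}\to\mathcal{F}$, one for each $K\in\mathcal{K}^G$, such that each $T_K$ is a projection ($T_K^2=T_K$), $T_K(\mathcal{F})\subseteq V_K$, $T_K(\mathcal{F})\perp T_L(\mathcal{F})$ with respect to $\langle\cdot,\cdot\rangle$ for all $K\neq L$ in $\mathcal{K}^G$, and \[\mathcal{F}=\bigoplus_{K\in\mathcal{K}^G}T_K(\mathcal{F}).\]
   Context: Fix an algebraic closure $\overline{\mathbb{Q}}$ of $\mathbb{Q}$. Let $Y$ be the set of places of $\overline{\mathbb{Q}}$; for a number field $K$ and a place $v$ of $K$ let $Y(K,v)=\{y\in Y: y\mid v\}$. $Y$ carries the (Allcock–Vaaler) totally disconnected locally compact Hausdorff topology in which the sets $Y(K,v)$ are compact open and form a basis, and the Borel measure $\lambda$ with $\lambda(Y(K,v))=[K_v:\mathbb{Q}_v]/[K:\mathbb{Q}]$. For $y\in Y$ let $\|\cdot\|_y$ be the absolute value at $y$ extending the usual $p$-adic or archimedean absolute value of $\mathbb{Q}$. For $\alpha\in\overline{\mathbb{Q}}^\times$ put $f_\alpha(y)=\log\|\alpha\|_y$; it depends only on the class of $\alpha$ modulo roots of unity, and $\mathcal{F}=\{f_\alpha:\alpha\in\overline{\mathbb{Q}}^\times\}$ (the algebraic numbers modulo torsion, written additively) is a $\mathbb{Q}$-vector space of locally constant compactly supported functions on $Y$, with inner product $\langle f,g\rangle=\int_Y fg\,d\lambda$. For a number field $K$, $V_K$ is the $\mathbb{Q}$-span of $\{f_\alpha:\alpha\in K^\times\}$.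 $\mathcal{K}^G$ denotes the set of finite Galois extensions of $\mathbb{Q}$ inside $\overline{\mathbb{Q}}$. *)

theory Defs
  imports
    "HOL-Analysis.Analysis"
    "HOL-Library.Function_Algebras"
    "HOL-Algebra.QuotRing"
    "HOL-Algebra.Embedded_Algebras"
begin

section \<open>Number fields inside a fixed algebraic closure of the rationals\<close>

text \<open>The fixed algebraic closure of the rationals is the field of algebraic complex numbers. Every
  subfield of the complex numbers of finite degree over the rationals lies in it.\<close>

definition Qbar :: "complex set" where
  "Qbar = {z. algebraic z}"

definition complex_field :: "complex ring" where
  "complex_field = \<lparr>carrier = UNIV, mult = (*), one = 1, zero = 0, add = (+)\<rparr>"

definition number_field :: "complex set \<Rightarrow> bool" where
  "number_field K \<longleftrightarrow> subfield K complex_field \<and> ring.finite_dimension complex_field \<rat> K"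

definition degree_over_Q :: "complex set \<Rightarrow> nat" where
  "degree_over_Q K = ring.dim complex_field \<rat> K"

definition field_auts :: "complex set \<Rightarrow> (complex \<Rightarrow> complex) set" where
  "field_auts K = ring_iso (complex_field\<lparr>carrier := K\<rparr>) (complex_field\<lparr>carrier := K\<rparr>)"

definition galois_fields :: "complex set set" where
  "galois_fields = {K. number_field K \<and> {x \<in> K. \<forall>\<sigma>\<in>field_auts K. \<sigma> x = x} = \<rat>}"


section \<open>Places\<close>

text \<open>Absolute values on a subfield \<open>K\<close> of the complex numbers are given by functions on all complex
  numbers, of which only the values on \<open>K\<close> matter: functions agreeing on \<open>K\<close> are equivalent.\<close>

definition nontrivial_abs_values :: "complex set \<Rightarrow> (complex \<Rightarrow> real) set" where
  "nontrivial_abs_values K = {w.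
     (\<forall>x\<in>K. 0 \<le> w x \<and> (w x = 0 \<longleftrightarrow> x = 0)) \<and>
     (\<forall>x\<in>K. \<forall>y\<in>K. w (x * y) = w x * w y) \<and>
     (\<forall>x\<in>K. \<forall>y\<in>K. w (x + y) \<le> w x + w y) \<and>
     (\<exists>x\<in>K. x \<noteq> 0 \<and> w x \<noteq> 1)}"

definition abs_value_equiv :: "complex set \<Rightarrow> ((complex \<Rightarrow> real) \<times> (complex \<Rightarrow> real)) set" where
  "abs_value_equiv K = {(w, w'). w \<in> nontrivial_abs_values K \<and> w' \<in> nontrivial_abs_values K \<and>
     (\<exists>s>0. \<forall>x\<in>K. w' x = w x powr s)}"

definition places :: "complex set \<Rightarrow> (complex \<Rightarrow> real) set set" where
  "places K = nontrivial_abs_values K // abs_value_equiv K"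

lemma norm_nontrivial_abs_value: "cmod \<in> nontrivial_abs_values Qbar"
proof -
  have "algebraic (2 :: complex)"
    by (rule algebraicI[of "[:-2, 1:]"]) (auto simp: coeff_pCons split: nat.splits)
  then have "\<exists>x\<in>Qbar. x \<noteq> 0 \<and> cmod x \<noteq> 1"
    by (intro bexI[of _ 2]) (auto simp: Qbar_def)
  then show ?thesis
    by (auto simp: nontrivial_abs_values_def norm_mult norm_triangle_ineq)
qed

text \<open>The set \<open>Y\<close> of places of the algebraic closure is the universe of the following type.\<close>

typedef place = "places Qbar"
  by (rule exI[of _ "abs_value_equiv Qbar `` {cmod}"])
     (simp add: places_def quotientI norm_nontrivial_abs_value)

text \<open>\<open>Y_over K v\<close> is the set \<open>Y(K,v)\<close> of all \<open>y\<close> with \<open>y | v\<close>. The elements of \<open>y\<close>, being absolute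
  values on the algebraic closure, are also absolute values on \<open>K\<close>; lying over \<open>v\<close> means that, read
  in this way, they belong to the class \<open>v\<close>.\<close>

definition Y_over :: "complex set \<Rightarrow> (complex \<Rightarrow> real) set \<Rightarrow> place set" where
  "Y_over K v = {y. Rep_place y \<subseteq> v}"

definition padic_abs :: "nat \<Rightarrow> rat \<Rightarrow> real" where
  "padic_abs p q = (if q = 0 then 0 else
     real p powi (int (multiplicity (int p) (snd (quotient_of q)))
                - int (multiplicity (int p) (fst (quotient_of q)))))"

definition extends_usual_abs :: "(complex \<Rightarrow> real) \<Rightarrow> bool" where
  "extends_usual_abs w \<longleftrightarrow>
     (\<forall>q. w (of_rat q) = real_of_rat \<bar>q\<bar>) \<or>
     (\<exists>p. Factorial_Ring.prime p \<and> (\<forall>q. w (of_rat q) = padic_abs p q))"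

text \<open>On the algebraic closure this is the unique representative of \<open>y\<close> that extends one of the usual
  absolute values; only its (irrelevant) values at transcendental numbers depend on the choice.\<close>

definition place_abs :: "place \<Rightarrow> complex \<Rightarrow> real" where
  "place_abs y = (SOME w. w \<in> Rep_place y \<and> extends_usual_abs w)"


section \<open>Completions and local degrees\<close>

definition cauchy_ring :: "complex set \<Rightarrow> (complex \<Rightarrow> real) \<Rightarrow> (nat \<Rightarrow> complex) ring" where
  "cauchy_ring K w = \<lparr>
     carrier = {X. range X \<subseteq> K \<and> (\<forall>e>0. \<exists>N. \<forall>m\<ge>N. \<forall>n\<ge>N. w (X m - X n) < e)},
     mult = (\<lambda>X Z n. X n * Z n), one = (\<lambda>n. 1), zero = (\<lambda>n. 0), add = (\<lambda>X Z n. X n + Z n)\<rparr>"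

definition null_seqs :: "complex set \<Rightarrow> (complex \<Rightarrow> real) \<Rightarrow> (nat \<Rightarrow> complex) set" where
  "null_seqs K w = {X \<in> carrier (cauchy_ring K w). (\<lambda>n. w (X n)) \<longlonglongrightarrow> 0}"

definition completion :: "complex set \<Rightarrow> (complex \<Rightarrow> real) \<Rightarrow> (nat \<Rightarrow> complex) set ring" where
  "completion K w = cauchy_ring K w Quot null_seqs K w"

text \<open>The completion of the rationals, embedded in the completion of \<open>K\<close> as the set of limits of
  Cauchy sequences of rational numbers.\<close>

definition rat_completion_in :: "complex set \<Rightarrow> (complex \<Rightarrow> real) \<Rightarrow> (nat \<Rightarrow> complex) set set" where
  "rat_completion_in K w =
     (\<lambda>X. null_seqs K w +>\<^bsub>cauchy_ring K w\<^esub> X) ` carrier (cauchy_ring \<rat> w)"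

definition local_degree :: "complex set \<Rightarrow> (complex \<Rightarrow> real) set \<Rightarrow> nat" where
  "local_degree K v = (let w = (SOME w. w \<in> v) in
     ring.dim (completion K w) (rat_completion_in K w) (carrier (completion K w)))"


section \<open>The space of places\<close>

instantiation place :: topological_space
begin

definition open_place :: "place set \<Rightarrow> bool" where
  "open_place = generate_topology {Y_over K v | K v. number_field K \<and> v \<in> places K}"

instance
  by standard (auto simp: open_place_def intro: generate_topology.intros)

end

text \<open>There are countably many sets \<open>Y_over K v\<close> and they form a basis, so the prescribed finite values
  characterise the Allcock-Vaaler measure among all Borel measures on the space of places.\<close>

definition allcock_vaaler_measure :: "place measure \<Rightarrow> bool" where
  "allcock_vaaler_measure lam \<longleftrightarrow> sets lam = sets borel \<and>
     (\<forall>K v. number_field K \<longrightarrow> v \<in> places K \<longrightarrow>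
        emeasure lam (Y_over K v) = ennreal (real (local_degree K v) / real (degree_over_Q K)))"


section \<open>Algebraic numbers modulo torsion as functions on the space of places\<close>

text \<open>\<open>log_abs\<close> is the map from \<open>\<alpha>\<close> to \<open>f\<^sub>\<alpha>\<close>, \<open>alg_space\<close> is the space of all \<open>f\<^sub>\<alpha>\<close>, and
  \<open>field_space K\<close> is \<open>V\<^sub>K\<close>.\<close>

definition log_abs :: "complex \<Rightarrow> place \<Rightarrow> real" where
  "log_abs \<alpha> = (\<lambda>y. ln (place_abs y \<alpha>))"

definition alg_space :: "(place \<Rightarrow> real) set" where
  "alg_space = log_abs ` (Qbar - {0})"

definition ratscale :: "rat \<Rightarrow> (place \<Rightarrow> real) \<Rightarrow> place \<Rightarrow> real" where
  "ratscale q f = (\<lambda>y. of_rat q * f y)"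

interpretation ratfun: vector_space ratscale
  by unfold_locales (auto simp: ratscale_def fun_eq_iff algebra_simps of_rat_add of_rat_mult)

definition field_space :: "complex set \<Rightarrow> (place \<Rightarrow> real) set" where
  "field_space K = ratfun.span (log_abs ` (K - {0}))"

definition place_inner :: "place measure \<Rightarrow> (place \<Rightarrow> real) \<Rightarrow> (place \<Rightarrow> real) \<Rightarrow> real" where
  "place_inner lam f g = integral\<^sup>L lam (\<lambda>y. f y * g y)"

definition rat_linear_on ::
  "(place \<Rightarrow> real) set \<Rightarrow> ((place \<Rightarrow> real) \<Rightarrow> (place \<Rightarrow> real)) \<Rightarrow> bool" where
  "rat_linear_on V T \<longleftrightarrow> (\<forall>f\<in>V. \<forall>g\<in>V. T (f + g) = T f + T g) \<and>
     (\<forall>q. \<forall>f\<in>V. T (ratscale q f) = ratscale q (T f))"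

definition internal_direct_sum ::
  "(place \<Rightarrow> real) set \<Rightarrow> 'i set \<Rightarrow> ('i \<Rightarrow> (place \<Rightarrow> real) set) \<Rightarrow> bool" where
  "internal_direct_sum V I W \<longleftrightarrow>
     ratfun.subspace V \<and> (\<forall>i\<in>I. ratfun.subspace (W i) \<and> W i \<subseteq> V) \<and>
     (\<forall>f\<in>V. \<exists>!g. (\<forall>i\<in>I. g i \<in> W i) \<and> (\<forall>i. i \<notin> I \<longrightarrow> g i = 0) \<and>
        finite {i. g i \<noteq> 0} \<and> f = (\<Sum>i\<in>{i. g i \<noteq> 0}. g i))"

end

theory Submission
  imports
    Defs
    "HOL-Computational_Algebra.Fundamental_Theorem_Algebra"
    "HOL-Real_Asymp.Real_Asymp"
begin

text \<open>The absolute Galois group \<open>G\<close> acts on the space of places and satisfies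
  \<open>f\<^bsub>\<sigma> \<alpha>\<^esub> = f\<^sub>\<alpha> \<circ> \<sigma>\<close>. For Galois \<open>K\<close> let \<open>P\<^sub>K f\<close> be the average of \<open>f\<close> over its (finite)
  orbit under \<open>Gal(K)\<close>; it is a projection onto \<open>V\<^sub>K\<close>, and \<open>P\<^sub>K P\<^sub>L = P\<^bsub>K \<inter> L\<^esub>\<close>.
  Put \<open>T\<^sub>K = P\<^sub>K - \<Sum> T\<^sub>L\<close>, the sum being over the finitely many Galois \<open>L \<subset> K\<close>. By induction
  \<open>P\<^sub>M T\<^sub>K\<close> is \<open>T\<^sub>K\<close> if \<open>K \<subseteq> M\<close> and \<open>0\<close> otherwise, so the \<open>T\<^sub>K\<close> are pairwise orthogonal
  idempotents, and \<open>\<Sum> T\<^sub>L = P\<^sub>M\<close> over \<open>L \<subseteq> M\<close> is the identity on \<open>V\<^sub>M\<close>.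

  If \<open>K\<close> is not contained in \<open>L\<close>, then an \<open>h\<close> in the image of \<open>T\<^sub>K\<close> has \<open>P\<^sub>L h = 0\<close> while every \<open>k\<close> in
  the image of \<open>T\<^sub>L\<close> is \<open>Gal(L)\<close>-invariant, so \<open>\<langle>h, k\<rangle> = \<langle>P\<^sub>L h, k\<rangle> = 0\<close> because the measure is
  \<open>G\<close>-invariant on functions factoring through the places of one number field \<open>M\<close>. This invariance
  is that of local degrees, together with the countability of the places of \<open>M\<close>: by Ostrowski's
  theorem it suffices that an absolute value of the rationals has finitely many extensions to \<open>M\<close>,
  which follows by counting slopes of Newton polygons.\<close>

text \<open>The group is infinite and averages are taken over orbits, whose size varies with the
  function, so linearity of the averages is a first obstacle. The orbits of f, g and f + g are
  quotients of the joint orbit of a pair of algebraic numbers, with fibres of equal size, and all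
  three averages can be computed on that joint orbit. The relation for composed averages rests on
  normality: Gal(L)-invariance survives averaging over the normal subgroup Gal(K), and invariance
  under both groups is invariance under their product. The sum subtracted from the average is
  Moebius inversion on the poset of Galois fields, with intersections as meets. The measure is
  prescribed only on the sets Y(K,v). A product of two functions depends on y only through the place
  of one field M below y, so invariance is compared on the places of M, where a measure on a
  countable set is determined by its points. Bounding the number of extensions by Newton slopes
  treats archimedean and p-adic absolute values alike and uses only the ordinary triangle
  inequality.\<close>

hide_const (open) up_ring.coeff up_ring.monom

section \<open>Number fields as finite-dimensional subalgebras\<close>

interpretation qv: vector_space "\<lambda>(q::rat) (x::complex). of_rat q * x"
  by unfold_locales (auto simp: algebra_simps of_rat_add of_rat_mult)

text \<open>Negation comes from -1 being rational, and inverses of algebraic elements come for free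
  (\<open>rsa_inverse\<close>), so a subfield of \<open>Qbar\<close> is recognised by sums and
  products alone.\<close>

definition rat_subalgebra :: "complex set \<Rightarrow> bool" where
  "rat_subalgebra A \<longleftrightarrow> \<rat> \<subseteq> A \<and> (\<forall>x\<in>A. \<forall>y\<in>A. x + y \<in> A \<and> x * y \<in> A)"

context
  fixes A assumes A: "rat_subalgebra A"
begin

lemma rsa_rat: "x \<in> \<rat> \<Longrightarrow> x \<in> A" using A by (auto simp: rat_subalgebra_def)
lemma rsa_0: "0 \<in> A" by (simp add: rsa_rat)
lemma rsa_1: "1 \<in> A" by (simp add: rsa_rat)
lemma rsa_add: "x \<in> A \<Longrightarrow> y \<in> A \<Longrightarrow> x + y \<in> A" using A by (auto simp: rat_subalgebra_def)
lemma rsa_mult: "x \<in> A \<Longrightarrow> y \<in> A \<Longrightarrow> x * y \<in> A" using A by (auto simp: rat_subalgebra_def)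
lemma rsa_uminus: "x \<in> A \<Longrightarrow> - x \<in> A" using rsa_mult[of "-1" x] by (simp add: rsa_rat)
lemma rsa_diff: "x \<in> A \<Longrightarrow> y \<in> A \<Longrightarrow> x - y \<in> A" using rsa_add[of x "-y"] by (simp add: rsa_uminus)
lemma rsa_power: "x \<in> A \<Longrightarrow> x ^ n \<in> A" by (induction n) (auto simp: rsa_1 rsa_mult)
lemma rsa_sum: "(\<And>i. i \<in> I \<Longrightarrow> f i \<in> A) \<Longrightarrow> sum f I \<in> A"
  by (induction I rule: infinite_finite_induct) (auto simp: rsa_0 rsa_add)
lemma rsa_prod: "(\<And>i. i \<in> I \<Longrightarrow> f i \<in> A) \<Longrightarrow> prod f I \<in> A"
  by (induction I rule: infinite_finite_induct) (auto simp: rsa_1 rsa_mult)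
lemma rsa_poly: "(\<And>i. coeff p i \<in> A) \<Longrightarrow> x \<in> A \<Longrightarrow> poly p x \<in> A"
  by (simp add: poly_altdef rsa_sum rsa_mult rsa_power)
lemma rsa_coeff_mult: "(\<And>i. coeff p i \<in> A) \<Longrightarrow> (\<And>i. coeff q i \<in> A) \<Longrightarrow> coeff (p * q) i \<in> A"
  by (simp add: coeff_mult rsa_sum rsa_mult)

lemma rsa_span: "B \<subseteq> A \<Longrightarrow> qv.span B \<subseteq> A"
  by (rule qv.span_minimal) (auto simp: qv.subspace_def rsa_0 rsa_add rsa_mult rsa_rat)

text \<open>A relation c + x q(x) = 0 with c nonzero exhibits the inverse of x as - q(x) / c, a
  polynomial expression in x.\<close>

lemma rsa_inverse:
  assumes "x \<in> A" "algebraic x" shows "inverse x \<in> A"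
proof (cases "x = 0")
  case False
  then obtain p where p: "coeff p 0 \<noteq> 0" "poly (map_poly of_int p) x = 0"
    using algebraicE'_nonzero[OF assms(2)] by metis
  obtain c q where pq: "p = pCons c q" by (cases p)
  have c: "c \<noteq> 0" using p pq by simp
  have *: "of_int c + x * poly (map_poly of_int q) x = 0"
    using p(2) by (simp add: pq map_poly_pCons)
  then have "x * (poly (map_poly of_int q) x * (- inverse (of_int c))) = 1"
    using c by (simp add: field_simps add_eq_0_iff)
  then have "inverse x = poly (map_poly of_int q) x * (- inverse (of_int c))"
    by (rule inverse_unique)
  moreover have "poly (map_poly of_int q) x \<in> A"
    by (rule rsa_poly) (auto simp: coeff_map_poly rsa_rat assms)
  ultimately show ?thesis by (auto intro!: rsa_uminus rsa_mult simp: rsa_rat)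
qed (simp add: rsa_0)

end

text \<open>The \<open>card B + 1\<close> powers with exponents up to \<open>card B\<close> are too
  many to be independent. The degree bound is recorded because it later bounds the number of Newton
  slopes uniformly in the element.\<close>

lemma algebraic_if_powers_in_span:
  assumes "finite B" "\<And>k. (x::complex) ^ k \<in> qv.span B"
  obtains p where "p \<noteq> 0" "\<And>i. coeff p i \<in> \<rat>" "degree p \<le> card B" "poly p x = 0"
proof (cases "inj_on (\<lambda>k. x ^ k) {..card B}")
  \<comment> \<open>Coinciding powers make the set of powers too small for the dimension count, but
    a coincidence is itself a polynomial relation.\<close>
  case False
  then obtain i j where ij: "i < j" "j \<le> card B" "x ^ i = x ^ j"
    by (auto simp: inj_on_def) (metis linorder_neqE_nat)
  have "coeff (monom (1::complex) j - monom 1 i) j \<noteq> 0" using ij by simp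
  then have "monom (1::complex) j - monom 1 i \<noteq> 0" by (metis coeff_0)
  then show ?thesis
    using ij by (intro that[of "monom 1 j - monom 1 i"])
      (auto simp: poly_monom intro!: degree_diff_le degree_monom_le[THEN order_trans])
next
  case True
  let ?S = "(\<lambda>k. x ^ k) ` {..card B}"
  have "card ?S = Suc (card B)" using True by (simp add: card_image)
  then have "qv.dependent ?S"
    using qv.independent_span_bound[OF assms(1), of ?S] assms(2) by fastforce
  then obtain u v where u: "v \<in> ?S" "u v \<noteq> (0::rat)" "(\<Sum>v\<in>?S. of_rat (u v) * v) = 0"
    using qv.dependent_finite[of ?S] by auto
  define p where "p = (\<Sum>k\<le>card B. monom (of_rat (u (x ^ k)) :: complex) k)"
  have cp: "coeff p i = (if i \<le> card B then of_rat (u (x ^ i)) else 0)" for i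
    by (auto simp: p_def coeff_sum)
  obtain i where "i \<le> card B" "v = x ^ i" using u by auto
  then have "p \<noteq> 0" using cp[of i] u by auto
  moreover have "poly p x = 0"
    using u(3) by (simp add: p_def poly_sum poly_monom sum.reindex[OF True])
  moreover have "degree p \<le> card B" by (rule degree_le) (simp add: cp)
  ultimately show ?thesis by (intro that[of p]) (auto simp: cp)
qed

lemma finite_rsa_poly:
  assumes "rat_subalgebra A" "finite B" "A \<subseteq> qv.span B" "x \<in> A"
  obtains p where "p \<noteq> 0" "\<And>i. coeff p i \<in> \<rat>" "degree p \<le> card B" "poly p x = 0"
  using algebraic_if_powers_in_span[OF assms(2)] rsa_power[OF assms(1,4)] assms(3) by blast

lemma finite_rsa_algebraic:
  assumes "rat_subalgebra A" "finite B" "A \<subseteq> qv.span B"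
  shows "A \<subseteq> Qbar"
  using finite_rsa_poly[OF assms] by (metis Qbar_def algebraicI' mem_Collect_eq subsetI)

text \<open>Polynomial values only: when everything is algebraic, this ring is already the generated
  field, by \<open>rsa_inverse\<close>.\<close>

definition adjoin :: "complex set \<Rightarrow> complex \<Rightarrow> complex set" where
  "adjoin A a = {poly f a | f. \<forall>i. coeff f i \<in> A}"

lemma adjoinI: "(\<And>i. coeff f i \<in> A) \<Longrightarrow> poly f a \<in> adjoin A a"
  by (auto simp: adjoin_def)

context
  fixes A and a :: complex assumes A: "rat_subalgebra A"
begin

lemma rsa_adjoin: "rat_subalgebra (adjoin A a)"
proof -
  have "q \<in> adjoin A a" if "q \<in> \<rat>" for q
    using adjoinI[of "[:q:]" A a] that by (auto simp: coeff_pCons rsa_rat[OF A] split: nat.splits)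
  moreover have "poly f a + poly g a \<in> adjoin A a" "poly f a * poly g a \<in> adjoin A a"
    if "\<And>i. coeff f i \<in> A" "\<And>i. coeff g i \<in> A" for f g
    using adjoinI[of "f + g" A a] adjoinI[of "f * g" A a] that
    by (auto simp: rsa_add[OF A] rsa_coeff_mult[OF A])
  ultimately show ?thesis
    unfolding rat_subalgebra_def by (force simp: adjoin_def)
qed

lemma adjoin_superset: "A \<subseteq> adjoin A a"
proof
  fix x assume "x \<in> A"
  then show "x \<in> adjoin A a"
    using adjoinI[of "[:x:]" A a] by (auto simp: coeff_pCons rsa_0[OF A] split: nat.splits)
qed

lemma adjoin_self: "a \<in> adjoin A a"
  using adjoinI[of "[:0,1:]" A a]
  by (auto simp: coeff_pCons rsa_0[OF A] rsa_1[OF A] split: nat.splits)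

end

lemma span_times_span:
  assumes "v \<in> qv.span B" "w \<in> qv.span P"
  shows "v * w \<in> qv.span ((\<lambda>(b, p). b * p) ` (B \<times> P))"
proof -
  let ?S = "qv.span ((\<lambda>(b, p). b * p) ` (B \<times> P))"
  have 1: "b * w \<in> ?S" if "b \<in> B" for b
    using assms(2)
  proof (induction rule: qv.span_induct_alt)
    case (step c x y)
    have "b * x \<in> ?S" using step that by (intro qv.span_base) auto
    then have "of_rat c * (b * x) + b * y \<in> ?S" using step by (intro qv.span_add qv.span_scale)
    then show ?case by (simp add: algebra_simps)
  qed (simp add: qv.span_zero)
  show ?thesis using assms(1)
  proof (induction rule: qv.span_induct_alt)
    case (step c x y)
    then have "of_rat c * (x * w) + y * w \<in> ?S" using 1[of x] by (intro qv.span_add qv.span_scale)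
    then show ?case by (simp add: algebra_simps)
  qed (simp add: qv.span_zero)
qed

text \<open>A relation of degree n rewrites \<open>a ^ n\<close> through lower powers, so the span
  of the lower powers is stable under multiplication by a and contains all powers.\<close>

lemma power_in_span_lower_powers:
  assumes "algebraic (a::complex)"
  obtains n where "\<And>k. a ^ k \<in> qv.span ((\<lambda>i. a ^ i) ` {..<n})"
proof -
  obtain p where p: "\<And>i. coeff p i \<in> \<rat>" "p \<noteq> 0" "poly p a = 0"
    using assms unfolding algebraic_altdef by blast
  define n where "n = degree p"
  let ?S = "qv.span ((\<lambda>i. a ^ i) ` {..<n})"
  have lc: "coeff p n \<noteq> 0" using p by (simp add: n_def)
  have "(\<Sum>i\<le>n. coeff p i * a ^ i) = 0"
    using p(3) by (simp add: poly_altdef n_def)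
  then have "coeff p n * a ^ n = - (\<Sum>i<n. coeff p i * a ^ i)"
    by (simp add: lessThan_Suc_atMost[symmetric] add_eq_0_iff)
  then have "a ^ n = - (\<Sum>i<n. coeff p i * a ^ i) / coeff p n"
    using lc by (simp add: field_simps)
  also have "\<dots> = (\<Sum>i<n. (- coeff p i / coeff p n) * a ^ i)"
    by (simp add: sum_negf[symmetric] sum_divide_distrib del: sum_negf)
  also have "\<dots> \<in> ?S"
  proof (rule qv.span_sum)
    fix i assume i: "i \<in> {..<n}"
    have "- coeff p i / coeff p n \<in> \<rat>" using p(1) by simp
    then obtain q where "- coeff p i / coeff p n = of_rat q" using Rats_cases by blast
    then show "(- coeff p i / coeff p n) * a ^ i \<in> ?S"
      using i by (simp add: qv.span_scale qv.span_base)
  qed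
  finally have n: "a ^ n \<in> ?S" .
  have mult: "x * a \<in> ?S" if "x \<in> ?S" for x
    using that
  proof (induction rule: qv.span_induct_alt)
    case (step c x y)
    then obtain i where i: "i < n" "x = a ^ i" by auto
    have "a ^ Suc i \<in> ?S"
    proof (cases "Suc i = n")
      case False
      then have "Suc i \<in> {..<n}" using i by simp
      then show ?thesis by (intro qv.span_base imageI)
    qed (use n in simp)
    then have "of_rat c * (x * a) + y * a \<in> ?S"
      using step i by (intro qv.span_add qv.span_scale) (auto simp: mult.commute)
    then show ?case by (simp add: algebra_simps)
  qed (simp add: qv.span_zero)
  \<comment> \<open>For n = 0 the span would be zero and miss \<open>a ^ 0\<close>; but a nonzero
    constant polynomial has no root.\<close>
  have n0: "n > 0"
  proof (rule ccontr)
    assume "\<not> n > 0"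
    then obtain c where "p = [:c:]" by (metis degree_eq_zeroE n_def gr0I)
    then show False using p by auto
  qed
  have "a ^ k \<in> ?S" for k
  proof (induction k)
    case 0 show ?case using n0 by (intro qv.span_base) (auto intro: image_eqI[of _ _ 0])
  next
    case (Suc k)
    then show ?case using mult[of "a ^ k"] by (simp only: power_Suc2)
  qed
  then show ?thesis by (rule that)
qed

lemma adjoin_finite:
  assumes A: "rat_subalgebra A" "finite B" "A \<subseteq> qv.span B" and a: "algebraic a"
  obtains B' where "finite B'" "adjoin A a \<subseteq> qv.span B'"
proof -
  obtain n where n: "\<And>k. a ^ k \<in> qv.span ((\<lambda>i. a ^ i) ` {..<n})"
    using power_in_span_lower_powers[OF a] by blast
  let ?B' = "(\<lambda>(b, p). b * p) ` (B \<times> (\<lambda>i. a ^ i) ` {..<n})"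
  have "adjoin A a \<subseteq> qv.span ?B'"
  proof
    fix x assume "x \<in> adjoin A a"
    then obtain f where f: "x = poly f a" "\<And>i. coeff f i \<in> A" by (auto simp: adjoin_def)
    show "x \<in> qv.span ?B'"
      unfolding f(1) poly_altdef
      by (intro qv.span_sum span_times_span n) (use f A in blast)
  qed
  then show ?thesis using assms by (intro that) auto
qed

lemma rsa_Rats: "rat_subalgebra \<rat>" by (auto simp: rat_subalgebra_def)

lemma Rats_span: "\<rat> \<subseteq> qv.span {1::complex}"
  by (auto elim!: Rats_cases simp: qv.span_singleton)

lemma finite_rsa_containing:
  assumes "finite S" "S \<subseteq> Qbar"
  obtains A B where "rat_subalgebra A" "finite B" "A \<subseteq> qv.span B" "S \<subseteq> A"
proof -
  have "\<exists>A B. rat_subalgebra A \<and> finite B \<and> A \<subseteq> qv.span B \<and> S \<subseteq> A"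
    using assms
  proof (induction S rule: finite_induct)
    case empty
    then show ?case using rsa_Rats Rats_span by blast
  next
    case (insert a S)
    then obtain A B where AB: "rat_subalgebra A" "finite B" "A \<subseteq> qv.span B" "S \<subseteq> A" by auto
    obtain B' where "finite B'" "adjoin A a \<subseteq> qv.span B'"
      using adjoin_finite[OF AB(1-3)] insert by (auto simp: Qbar_def)
    moreover have "insert a S \<subseteq> adjoin A a"
      using adjoin_self[OF AB(1), of a] adjoin_superset[OF AB(1), of a] AB(4) by auto
    ultimately show ?case using rsa_adjoin[OF AB(1)] by blast
  qed
  then show ?thesis using that by blast
qed

text \<open>Any two algebraic numbers lie in a common finite-dimensional subalgebra, all of whose
  elements are algebraic.\<close>

lemma rsa_Qbar: "rat_subalgebra Qbar"
  unfolding rat_subalgebra_def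
proof (intro conjI ballI)
  fix x y assume xy: "x \<in> Qbar" "y \<in> Qbar"
  obtain A B where A: "rat_subalgebra A" "finite B" "A \<subseteq> qv.span B" "{x, y} \<subseteq> A"
    using finite_rsa_containing[of "{x, y}"] xy by auto
  show "x + y \<in> Qbar" "x * y \<in> Qbar"
    using finite_rsa_algebraic[OF A(1-3)] A rsa_add[OF A(1)] rsa_mult[OF A(1)] by auto
qed (auto simp: Qbar_def rat_imp_algebraic)

lemma Qbar_inverse: "x \<in> Qbar \<Longrightarrow> inverse x \<in> Qbar"
  by (auto simp: Qbar_def)

section \<open>Translation between \<open>complex_field\<close> as an algebraic structure and
  subalgebras of the complex numbers\<close>

lemma field_complex_field: "field complex_field"
proof -
  have "cring complex_field"
  proof (rule cringI)
    show "abelian_group complex_field"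
    proof (rule abelian_groupI)
      fix x
      show "\<exists>y\<in>carrier complex_field. y \<oplus>\<^bsub>complex_field\<^esub> x = \<zero>\<^bsub>complex_field\<^esub>"
        by (rule bexI[of _ "- x"]) (auto simp: complex_field_def)
    qed (auto simp: complex_field_def)
    show "comm_monoid complex_field"
      by (rule comm_monoidI) (auto simp: complex_field_def)
  qed (auto simp: complex_field_def distrib_right)
  then show ?thesis
  proof (rule cring.cring_fieldI2)
    fix a assume "a \<noteq> \<zero>\<^bsub>complex_field\<^esub>"
    then show "\<exists>b\<in>carrier complex_field. a \<otimes>\<^bsub>complex_field\<^esub> b = \<one>\<^bsub>complex_field\<^esub>"
      by (intro bexI[of _ "inverse a"]) (auto simp: complex_field_def)
  qed (auto simp: complex_field_def)
qed

lemmas ring_complex_field = field.is_ring[OF field_complex_field]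

lemma complex_field_minus: "\<ominus>\<^bsub>complex_field\<^esub> x = - x"
  by (rule abelian_group.minus_equality[OF ring.is_abelian_group[OF ring_complex_field]])
     (auto simp: complex_field_def)

lemma complex_field_inv: "x \<noteq> 0 \<Longrightarrow> inv\<^bsub>complex_field\<^esub> x = inverse x"
  by (rule comm_monoid.comm_inv_char[OF cring.axioms(2)[OF domain.axioms(1)[OF field.axioms(1)[OF field_complex_field]]]])
     (auto simp: complex_field_def)

lemma subfieldD:
  assumes "subfield K complex_field"
  shows "rat_subalgebra K"
proof -
  interpret field complex_field by (rule field_complex_field)
  note K = subfieldE(1)[OF assms]
  have c: "1 \<in> K" "\<And>x y. x \<in> K \<Longrightarrow> y \<in> K \<Longrightarrow> x + y \<in> K" "\<And>x y. x \<in> K \<Longrightarrow> y \<in> K \<Longrightarrow> x * y \<in> K"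
    "0 \<in> K" "\<And>x. x \<in> K \<Longrightarrow> - x \<in> K"
    using subringE[OF K] unfolding complex_field_minus by (auto simp: complex_field_def)
  have i: "inverse x \<in> K" if "x \<in> K" for x
    using subfield_m_inv(1)[OF assms, of x] that c complex_field_inv[of x]
    by (cases "x = 0") (auto simp: complex_field_def)
  have n: "of_nat n \<in> K" for n by (induction n) (auto simp: c)
  have "of_int z \<in> K" for z by (cases z rule: int_cases2) (auto simp: n c)
  then have "of_rat q \<in> K" for q
    by (cases q) (auto simp: of_rat_rat divide_inverse intro!: c i)
  then have "\<rat> \<subseteq> K" by (auto simp: Rats_def)
  then show ?thesis using c by (auto simp: rat_subalgebra_def)
qed

lemma subfieldI_rsa:
  assumes "rat_subalgebra K" "K \<subseteq> Qbar"
  shows "subfield K complex_field"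
proof -
  interpret field complex_field by (rule field_complex_field)
  show ?thesis
  proof (rule subfieldI')
    show "subring K complex_field"
    proof (rule subringI)
      show "\<ominus>\<^bsub>complex_field\<^esub> h \<in> K" if "h \<in> K" for h
        using that unfolding complex_field_minus by (rule rsa_uminus[OF assms(1)])
    qed (auto simp: complex_field_def rsa_1[OF assms(1)] rsa_add[OF assms(1)] rsa_mult[OF assms(1)])
  next
    fix k assume "k \<in> K - {\<zero>\<^bsub>complex_field\<^esub>}"
    then show "inv\<^bsub>complex_field\<^esub> k \<in> K"
      using rsa_inverse[OF assms(1), of k] assms(2) complex_field_inv[of k]
      by (auto simp: complex_field_def Qbar_def)
  qed
qed

text \<open>One step of the inductive dimension predicate adds a line, which for rational scalars is
  the insertion of one vector into a spanning set. This is the bridge between algebraic dimension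
  and linear spans.\<close>

lemma line_extension_rat:
  "ring.line_extension complex_field \<rat> v (qv.span B) = qv.span (insert v B)"
proof -
  have "ring.line_extension complex_field \<rat> v (qv.span B) = {of_rat k * v + e | k e. e \<in> qv.span B}"
    unfolding ring.line_extension_def[OF ring_complex_field]
    by (auto simp: set_add_def set_mult_def r_coset_def complex_field_def Rats_def)
  also have "\<dots> = qv.span (insert v B)"
    proof (intro equalityI subsetI)
    fix x assume "x \<in> qv.span (insert v B)"
    then obtain k where "x - of_rat k * v \<in> qv.span B" unfolding qv.span_insert by blast
    then show "x \<in> {of_rat k * v + e | k e. e \<in> qv.span B}"
      by (intro CollectI exI[of _ k] exI[of _ "x - of_rat k * v"]) simp
  next
    fix x assume "x \<in> {of_rat k * v + e | k e. e \<in> qv.span B}"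
    then obtain k e where "x = of_rat k * v + e" "e \<in> qv.span B" by auto
    then have "x - of_rat k * v \<in> qv.span B" by simp
    then show "x \<in> qv.span (insert v B)" unfolding qv.span_insert by blast
  qed
  finally show ?thesis .
qed

lemma finite_dimension_rat_iff:
  "ring.finite_dimension complex_field \<rat> E \<longleftrightarrow> (\<exists>B. finite B \<and> E = qv.span B)"
proof -
  interpret field complex_field by (rule field_complex_field)
  have "\<exists>B. finite B \<and> E = qv.span B" if "dimension n \<rat> E" for n E
    using that
  proof (induction n "\<rat> :: complex set" E rule: dimension.induct)
    case (zero_dim)
    show ?case by (rule exI[of _ "{}"]) (simp add: complex_field_def)
  next
    case (Suc_dim v E n)
    then obtain B where "finite B" "E = qv.span B" by blast
    then show ?case by (intro exI[of _ "insert v B"]) (simp add: line_extension_rat)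
  qed
  moreover have "\<exists>n. dimension n \<rat> (qv.span B)" if "finite B" for B
    using that
  proof (induction rule: finite_induct)
    case empty
    then show ?case using zero_dim[of \<rat>] by (auto simp: complex_field_def)
  next
    case (insert x F)
    show ?case
    proof (cases "x \<in> qv.span F")
      case True
      then show ?thesis using insert by (simp add: qv.span_redundant)
    next
      case False
      obtain n where "dimension n \<rat> (qv.span F)" using insert by blast
      moreover have "x \<in> carrier complex_field" by (simp add: complex_field_def)
      ultimately show ?thesis using Suc_dim[OF _ False, of n \<rat>] unfolding line_extension_rat by blast
    qed
  qed
  ultimately show ?thesis unfolding finite_dimension_def by blast
qed

text \<open>Containment in a finite span suffices, because a maximal independent subset of K is then
  finite and spans K. This form passes at once to subalgebras and is the working description of
  number fields from here on.\<close>

lemma number_field_iff: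
  "number_field K \<longleftrightarrow> rat_subalgebra K \<and> (\<exists>B. finite B \<and> K \<subseteq> qv.span B)"
proof safe
  assume K: "number_field K"
  then show "rat_subalgebra K" by (simp add: number_field_def subfieldD)
  show "\<exists>B. finite B \<and> K \<subseteq> qv.span B"
    using K unfolding number_field_def finite_dimension_rat_iff by auto
next
  fix B assume K: "rat_subalgebra K" "finite B" "K \<subseteq> qv.span B"
  obtain C where C: "C \<subseteq> K" "qv.independent C" "K \<subseteq> qv.span C"
    using qv.maximal_independent_subset[of K] by blast
  then have "finite C"
    using qv.independent_span_bound[OF K(2) C(2)] K(3) by auto
  moreover have "K = qv.span C" using rsa_span[OF K(1) C(1)] C(3) by auto
  ultimately show "number_field K"
    unfolding number_field_def finite_dimension_rat_iff
    using subfieldI_rsa[OF K(1) finite_rsa_algebraic[OF K]] by blast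
qed

lemma number_field_subset: "number_field L \<Longrightarrow> rat_subalgebra K \<Longrightarrow> K \<subseteq> L \<Longrightarrow> number_field K"
  unfolding number_field_iff by blast

lemma number_field_rsa: "number_field K \<Longrightarrow> rat_subalgebra K"
  by (simp add: number_field_iff)

lemma number_field_Qbar: "number_field K \<Longrightarrow> K \<subseteq> Qbar"
  using finite_rsa_algebraic by (auto simp: number_field_iff)

section \<open>Automorphisms of the algebraic closure\<close>

definition rat_hom_on :: "complex set \<Rightarrow> (complex \<Rightarrow> complex) \<Rightarrow> bool" where
  "rat_hom_on A h \<longleftrightarrow> (\<forall>x\<in>A. \<forall>y\<in>A. h (x + y) = h x + h y \<and> h (x * y) = h x * h y) \<and>
     (\<forall>q\<in>\<rat>. h q = q)"

lemma coeff_linear: "rat_subalgebra A \<Longrightarrow> b \<in> A \<Longrightarrow> coeff [:- b, 1:] i \<in> A"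
  by (auto simp: coeff_pCons rsa_0 rsa_1 rsa_uminus split: nat.splits)

lemma coeff_prod_linear:
  assumes A: "rat_subalgebra A"
  shows "S \<subseteq> A \<Longrightarrow> coeff (\<Prod>b\<in>S. [:- b, 1:]) i \<in> A"
proof (induction S arbitrary: i rule: infinite_finite_induct)
  case (insert x F)
  then show ?case
    unfolding prod.insert[OF insert.hyps]
    by (intro rsa_coeff_mult[OF A] coeff_linear[OF A]) auto
qed (auto simp: rsa_0[OF A] rsa_1[OF A])

context
  fixes A h assumes A: "rat_subalgebra A" and h: "rat_hom_on A h"
begin

lemma hom_rat: "q \<in> \<rat> \<Longrightarrow> h q = q" using h by (auto simp: rat_hom_on_def)
lemma hom_0: "h 0 = 0" by (simp add: hom_rat)
lemma hom_1: "h 1 = 1" by (simp add: hom_rat)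
lemma hom_add: "x \<in> A \<Longrightarrow> y \<in> A \<Longrightarrow> h (x + y) = h x + h y" using h by (auto simp: rat_hom_on_def)
lemma hom_mult: "x \<in> A \<Longrightarrow> y \<in> A \<Longrightarrow> h (x * y) = h x * h y" using h by (auto simp: rat_hom_on_def)
lemma hom_uminus: "x \<in> A \<Longrightarrow> h (- x) = - h x"
  using hom_mult[of "-1" x] rsa_rat[OF A, of "-1"] by (simp add: hom_rat)
lemma hom_sum: "(\<And>i. i \<in> I \<Longrightarrow> f i \<in> A) \<Longrightarrow> h (sum f I) = (\<Sum>i\<in>I. h (f i))"
  by (induction I rule: infinite_finite_induct) (auto simp: hom_0 hom_add rsa_sum[OF A])
lemma hom_prod: "(\<And>i. i \<in> I \<Longrightarrow> f i \<in> A) \<Longrightarrow> h (prod f I) = (\<Prod>i\<in>I. h (f i))"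
  by (induction I rule: infinite_finite_induct) (auto simp: hom_1 hom_mult rsa_prod[OF A])

lemma map_poly_hom_mult:
  "(\<And>i. coeff p i \<in> A) \<Longrightarrow> (\<And>i. coeff q i \<in> A) \<Longrightarrow>
    map_poly h (p * q) = map_poly h p * map_poly h q"
  by (rule poly_eqI)
     (simp add: coeff_map_poly coeff_mult hom_0 hom_sum hom_mult rsa_mult[OF A])

lemma map_poly_hom_add:
  "(\<And>i. coeff p i \<in> A) \<Longrightarrow> (\<And>i. coeff q i \<in> A) \<Longrightarrow>
    map_poly h (p + q) = map_poly h p + map_poly h q"
  by (rule poly_eqI) (simp add: coeff_map_poly hom_0 hom_add)

lemma map_poly_hom_diff:
  assumes "\<And>i. coeff p i \<in> A" "\<And>i. coeff q i \<in> A"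
  shows "map_poly h (p - q) = map_poly h p - map_poly h q"
  using map_poly_hom_add[of "p - q" q] assms by (simp add: rsa_diff[OF A])

lemma map_poly_hom_rat: "(\<And>i. coeff p i \<in> \<rat>) \<Longrightarrow> map_poly h p = p"
  by (rule poly_eqI) (simp add: coeff_map_poly hom_0 hom_rat)

lemma hom_poly:
  assumes "\<And>i. coeff p i \<in> A" "x \<in> A"
  shows "h (poly p x) = poly (map_poly h p) (h x)"
  using assms(1)
proof (induction p)
  case (pCons a p)
  have "\<And>i. coeff p i \<in> A" "a \<in> A" using pCons.prems[of "Suc _"] pCons.prems[of 0] by auto
  then show ?case
    using pCons by (simp add: map_poly_pCons hom_0 hom_add hom_mult rsa_mult[OF A] assms(2) rsa_poly[OF A])
qed (simp add: hom_0)

lemma hom_rat_root: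
  "(\<And>i. coeff p i \<in> \<rat>) \<Longrightarrow> x \<in> A \<Longrightarrow> poly p x = 0 \<Longrightarrow> poly p (h x) = 0"
  using hom_poly[of p x] map_poly_hom_rat[of p] by (simp add: hom_0 rsa_rat[OF A])

lemma hom_Qbar: "x \<in> A \<Longrightarrow> x \<in> Qbar \<Longrightarrow> h x \<in> Qbar"
  unfolding Qbar_def algebraic_altdef using hom_rat_root by blast

lemma hom_inj_on:
  assumes "A \<subseteq> Qbar" shows "inj_on h A"
proof (rule inj_onI, rule ccontr)
  fix x y assume xy: "x \<in> A" "y \<in> A" "h x = h y" "x \<noteq> y"
  define z where "z = x - y"
  have z: "z \<in> A" "z \<noteq> 0" "h z = 0"
    using xy hom_add[of x "-y"] by (auto simp: z_def rsa_diff[OF A] rsa_uminus[OF A] hom_uminus)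
  then have "inverse z \<in> A" using rsa_inverse[OF A] assms by (auto simp: Qbar_def)
  then have "h z * h (inverse z) = 1" using z hom_mult[of z "inverse z"] by (simp add: hom_1)
  then show False using z by simp
qed

lemma map_poly_prod_linear:
  "S \<subseteq> A \<Longrightarrow> map_poly h (\<Prod>b\<in>S. [:- b, 1:]) = (\<Prod>b\<in>S. [:- h b, 1:])"
proof (induction S rule: infinite_finite_induct)
  case (insert x F)
  have "map_poly h ([:- x, 1:] * (\<Prod>b\<in>F. [:- b, 1:])) = map_poly h [:- x, 1:] * map_poly h (\<Prod>b\<in>F. [:- b, 1:])"
    using insert.prems
    by (intro map_poly_hom_mult coeff_prod_linear[OF A] coeff_linear[OF A]) auto
  then show ?case using insert
    by (simp add: map_poly_pCons hom_0 hom_1 hom_uminus del: mult_pCons_left)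
qed (auto simp: hom_1)

text \<open>A homomorphism that permutes S permutes the linear factors, hence fixes the symmetric
  functions of S. The polynomials with fixed coefficients in the Galois arguments below all arise in
  this way.\<close>

lemma hom_fixes_coeff_prod_linear:
  assumes "S \<subseteq> A" "h ` S = S" "inj_on h S"
  shows "h (coeff (\<Prod>b\<in>S. [:- b, 1:]) i) = coeff (\<Prod>b\<in>S. [:- b, 1:]) i"
proof -
  have "map_poly h (\<Prod>b\<in>S. [:- b, 1:]) = (\<Prod>b\<in>h ` S. [:- b, 1:])"
    using map_poly_prod_linear[OF assms(1)] by (simp add: prod.reindex[OF assms(3)])
  then show ?thesis
    using assms(2) coeff_map_poly[of h "\<Prod>b\<in>S. [:- b, 1:]" i] by (simp add: hom_0)
qed

end

lemma poly_prod_linear_eq_0_iff: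
  "finite S \<Longrightarrow> poly (\<Prod>b\<in>S. [:- b, 1:]) x = 0 \<longleftrightarrow> (x :: complex) \<in> S"
  by (auto simp: poly_prod)

lemma rat_hom_on_subset: "rat_hom_on A h \<Longrightarrow> B \<subseteq> A \<Longrightarrow> rat_hom_on B h"
  by (auto simp: rat_hom_on_def)

section \<open>Minimal polynomials and extension of homomorphisms\<close>

definition minimal_poly :: "complex set \<Rightarrow> complex \<Rightarrow> complex poly \<Rightarrow> bool" where
  "minimal_poly A a p \<longleftrightarrow> (\<forall>i. coeff p i \<in> A) \<and> lead_coeff p = 1 \<and> poly p a = 0 \<and>
     (\<forall>q. (\<forall>i. coeff q i \<in> A) \<longrightarrow> q \<noteq> 0 \<longrightarrow> poly q a = 0 \<longrightarrow> degree p \<le> degree q)"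

lemma minimal_poly_exists:
  assumes A: "rat_subalgebra A" "A \<subseteq> Qbar" and a: "a \<in> Qbar"
  obtains p where "minimal_poly A a p"
proof -
  let ?P = "\<lambda>q. (\<forall>i. coeff q i \<in> A) \<and> q \<noteq> 0 \<and> poly q a = 0"
  have "\<exists>q. ?P q" using a rsa_rat[OF A(1)] unfolding Qbar_def algebraic_altdef by blast
  then obtain q where q: "?P q" "\<And>r. ?P r \<Longrightarrow> degree q \<le> degree r"
    using ex_has_least_nat[of ?P _ degree] by blast
  let ?c = "inverse (lead_coeff q)"
  have "?c \<in> A" using rsa_inverse[OF A(1), of "lead_coeff q"] A q(1) by (auto simp: Qbar_def)
  moreover have "lead_coeff q \<noteq> 0" using q(1) by simp
  ultimately have "minimal_poly A a (Polynomial.smult ?c q)"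
    using q unfolding minimal_poly_def by (auto simp: rsa_mult[OF A(1)])
  then show ?thesis by (rule that)
qed

lemma minimal_poly_degree: "minimal_poly A a p \<Longrightarrow> degree p > 0"
proof (rule ccontr)
  assume p: "minimal_poly A a p" "\<not> degree p > 0"
  then obtain c where "p = [:c:]" by (auto elim: degree_eq_zeroE)
  then show False using p by (auto simp: minimal_poly_def)
qed

context
  fixes A h a p b
  assumes A: "rat_subalgebra A" "A \<subseteq> Qbar" and h: "rat_hom_on A h" and a: "a \<in> Qbar"
    and p: "minimal_poly A a p" and b: "poly (map_poly h p) b = 0"
begin

text \<open>Division by the monic p, one leading term at a time: minimality forces
  \<open>degree p \<le> degree f\<close> as long as f is nonzero, so the reduction ends at zero, and
  each step subtracts a multiple of p, whose image vanishes at b.\<close>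

lemma root_transfer:
  assumes "\<And>i. coeff f i \<in> A" "poly f a = 0"
  shows "poly (map_poly h f) b = 0"
  using assms
proof (induction "degree f" arbitrary: f rule: less_induct)
  case less
  show ?case
  proof (cases "f = 0")
    case False
    let ?m = "monom (lead_coeff f) (degree f - degree p)"
    have le: "degree p \<le> degree f" using p False less.prems unfolding minimal_poly_def by blast
    have pA: "\<And>i. coeff p i \<in> A" using p by (auto simp: minimal_poly_def)
    have mA: "\<And>i. coeff ?m i \<in> A" using less.prems(1) by (simp add: rsa_0[OF A(1)])
    define g where "g = f - ?m * p"
    have gA: "\<And>i. coeff g i \<in> A"
      unfolding g_def coeff_diff by (intro rsa_diff[OF A(1)] rsa_coeff_mult[OF A(1)] less.prems mA pA)
    have ga: "poly g a = 0" using p less.prems by (simp add: g_def minimal_poly_def)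
    have "poly (map_poly h g) b = 0"
    proof (cases "g = 0")
      case g: False
      have lm: "degree (?m * p) = degree f" "lead_coeff (?m * p) = lead_coeff f"
      proof -
        have p1: "lead_coeff p = 1" using p by (simp add: minimal_poly_def)
        have m: "degree ?m = degree f - degree p" "?m \<noteq> 0" using False by (auto simp: degree_monom_eq)
        moreover have "p \<noteq> 0" using p1 by auto
        ultimately show "degree (?m * p) = degree f" using le by (simp add: degree_mult_eq)
        show "lead_coeff (?m * p) = lead_coeff f" unfolding lead_coeff_mult using m p1 by simp
      qed
      have "degree g < degree f"
      proof (rule degree_less_if_less_eqI)
        show "degree g \<le> degree f" unfolding g_def by (rule degree_diff_le) (use lm in auto)
        show "coeff g (degree f) = 0" using lm by (simp add: g_def)
      qed (use g in auto)
      then show ?thesis using less.hyps gA ga by blast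
    qed simp
    moreover have "map_poly h f = map_poly h g + map_poly h ?m * map_poly h p"
      using map_poly_hom_add[OF A(1) h gA, of "?m * p"] map_poly_hom_mult[OF A(1) h mA pA]
        rsa_coeff_mult[OF A(1) mA pA] by (simp add: g_def)
    ultimately show ?thesis using b by simp
  qed simp
qed

text \<open>The value f(a) is sent to the value at b of the image of f. By
  \<open>root_transfer\<close> this does not depend on the polynomial chosen to represent an
  element, and the homomorphism laws are those of polynomial arithmetic.\<close>

lemma extend_to_adjoin:
  obtains h' where "rat_hom_on (adjoin A a) h'" "\<And>x. x \<in> A \<Longrightarrow> h' x = h x" "h' a = b"
proof -
  define h' where "h' x = poly (map_poly h (SOME f. (\<forall>i. coeff f i \<in> A) \<and> poly f a = x)) b" for x
  have h': "h' (poly f a) = poly (map_poly h f) b" if f: "\<And>i. coeff f i \<in> A" for f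
  proof -
    define g where "g = (SOME g. (\<forall>i. coeff g i \<in> A) \<and> poly g a = poly f a)"
    have g: "\<And>i. coeff g i \<in> A" "poly g a = poly f a"
      using someI[of "\<lambda>g. (\<forall>i. coeff g i \<in> A) \<and> poly g a = poly f a" f] f by (auto simp: g_def)
    have "poly (map_poly h (g - f)) b = 0"
      using g f by (intro root_transfer) (auto simp: rsa_diff[OF A(1)])
    then show ?thesis
      by (simp add: map_poly_hom_diff[OF A(1) h g(1) f] h'_def g_def[symmetric])
  qed
  have c: "h' x = h x" if "x \<in> A" for x
    using h'[of "[:x:]"] that hom_0[OF A(1) h] rsa_0[OF A(1)]
    by (simp add: coeff_pCons map_poly_pCons split: nat.splits)
  have "h' a = b"
    using h'[of "[:0,1:]"] hom_0[OF A(1) h] rsa_0[OF A(1)] hom_1[OF A(1) h] rsa_1[OF A(1)]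
    by (simp add: coeff_pCons map_poly_pCons split: nat.splits)
  moreover have "rat_hom_on (adjoin A a) h'"
    unfolding rat_hom_on_def
  proof (intro conjI ballI)
    fix x y assume "x \<in> adjoin A a" "y \<in> adjoin A a"
    then obtain f g where fg: "x = poly f a" "y = poly g a" "\<And>i. coeff f i \<in> A" "\<And>i. coeff g i \<in> A"
      by (auto simp: adjoin_def)
    show "h' (x + y) = h' x + h' y"
      using h'[of "f + g"] h'[of f] h'[of g] fg map_poly_hom_add[OF A(1) h fg(3,4)]
      by (simp add: rsa_add[OF A(1)])
    show "h' (x * y) = h' x * h' y"
      using h'[of "f * g"] h'[of f] h'[of g] fg map_poly_hom_mult[OF A(1) h fg(3,4)]
      by (simp add: rsa_coeff_mult[OF A(1)])
  next
    fix q :: complex assume "q \<in> \<rat>"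
    then show "h' q = q" using c[of q] rsa_rat[OF A(1)] hom_rat[OF A(1) h] by simp
  qed
  ultimately show ?thesis using c that by blast
qed

end

lemma complex_poly_root_exists: "degree (p :: complex poly) > 0 \<Longrightarrow> \<exists>z. poly p z = 0"
  using fundamental_theorem_of_algebra constant_degree[of p] by fastforce

text \<open>Zorn's lemma is applied to graphs instead of pairs of a domain and a map: the union of a
  chain of graphs is again one, and \<open>closed\<close> makes its domain closed under sums and
  products. A maximal graph is defined on all of \<open>Qbar\<close>, because the image of a minimal
  polynomial has a complex root, to which a further algebraic element could be sent.\<close>

lemma extend_to_Qbar:
  assumes A: "rat_subalgebra A" "A \<subseteq> Qbar" and h: "rat_hom_on A h"
  obtains h' where "rat_hom_on Qbar h'" "\<And>x. x \<in> A \<Longrightarrow> h' x = h x"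
proof -
  define closed where "closed R \<longleftrightarrow> (\<forall>x x' y y'. (x, x') \<in> R \<longrightarrow> (y, y') \<in> R \<longrightarrow>
    (x + y, x' + y') \<in> R \<and> (x * y, x' * y') \<in> R)" for R :: "(complex \<times> complex) set"
  define \<A> where "\<A> = {R. R \<subseteq> Qbar \<times> UNIV \<and> (\<lambda>x. (x, h x)) ` A \<subseteq> R \<and> single_valued R \<and> closed R}"
  have graph: "(\<lambda>x. (x, k x)) ` B \<in> \<A>"
    if "rat_subalgebra B" "B \<subseteq> Qbar" "A \<subseteq> B" "rat_hom_on B k" "\<And>x. x \<in> A \<Longrightarrow> k x = h x" for B k
  proof -
    have "closed ((\<lambda>x. (x, k x)) ` B)"
      using that(1,4) by (auto simp: closed_def rat_hom_on_def rat_subalgebra_def)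
    moreover have "(\<lambda>x. (x, h x)) ` A \<subseteq> (\<lambda>x. (x, k x)) ` B"
      using that(3,5) by (auto simp: image_iff)
    ultimately show ?thesis using that(2) by (auto simp: \<A>_def single_valued_def)
  qed
  have "\<exists>M\<in>\<A>. \<forall>X\<in>\<A>. M \<subseteq> X \<longrightarrow> X = M"
  proof (rule subset_Zorn_nonempty)
    show "\<A> \<noteq> {}" using graph[OF A order_refl h] by blast
    fix C assume C: "C \<noteq> {}" "subset.chain \<A> C"
    have ex: "\<exists>R\<in>C. u \<in> R \<and> v \<in> R" if "u \<in> \<Union>C" "v \<in> \<Union>C" for u v
      using that C(2) unfolding subset_chain_def by blast
    have CA: "\<And>R. R \<in> C \<Longrightarrow> R \<in> \<A>" using C(2) by (auto simp: subset_chain_def)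
    have "single_valued (\<Union>C)"
      unfolding single_valued_def
    proof (intro allI impI)
      fix x y z assume "(x, y) \<in> \<Union>C" "(x, z) \<in> \<Union>C"
      then obtain R where R: "R \<in> C" "(x, y) \<in> R" "(x, z) \<in> R" using ex by blast
      then have "single_valued R" using CA by (auto simp: \<A>_def)
      then show "y = z" using R by (auto simp: single_valued_def)
    qed
    moreover have "closed (\<Union>C)"
      unfolding closed_def
    proof (intro allI impI)
      fix x x' y y' assume "(x, x') \<in> \<Union>C" "(y, y') \<in> \<Union>C"
      then obtain R where R: "R \<in> C" "(x, x') \<in> R" "(y, y') \<in> R" using ex by blast
      then have "closed R" using CA by (auto simp: \<A>_def)
      then show "(x + y, x' + y') \<in> \<Union>C \<and> (x * y, x' * y') \<in> \<Union>C"
        using R unfolding closed_def by blast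
    qed
    moreover have "\<Union>C \<subseteq> Qbar \<times> UNIV" using CA by (auto simp: \<A>_def)
    moreover have "(\<lambda>x. (x, h x)) ` A \<subseteq> \<Union>C" using CA C(1) by (auto simp: \<A>_def)
    ultimately show "\<Union>C \<in> \<A>" by (auto simp: \<A>_def)
  qed
  then obtain M where M: "M \<in> \<A>" "\<And>X. X \<in> \<A> \<Longrightarrow> M \<subseteq> X \<Longrightarrow> X = M" by blast
  define B where "B = Domain M"
  define k where "k x = (THE y. (x, y) \<in> M)" for x
  have sv: "single_valued M" and cl: "closed M" and hM: "(\<lambda>x. (x, h x)) ` A \<subseteq> M"
    and MQ: "M \<subseteq> Qbar \<times> UNIV" using M(1) by (auto simp: \<A>_def)
  have k: "k x = y" if "(x, y) \<in> M" for x y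
    unfolding k_def using that sv by (auto simp: single_valued_def)
  have kM: "(x, k x) \<in> M" if "x \<in> B" for x using that k by (auto simp: B_def)
  have AB: "A \<subseteq> B" using hM by (auto simp: B_def)
  have kh: "k x = h x" if "x \<in> A" for x using hM that k by auto
  have B: "rat_subalgebra B"
    unfolding rat_subalgebra_def
  proof (intro conjI ballI)
    show "\<rat> \<subseteq> B" using AB rsa_rat[OF A(1)] by auto
    fix x y assume "x \<in> B" "y \<in> B"
    then have "(x + y, k x + k y) \<in> M" "(x * y, k x * k y) \<in> M"
      using kM cl unfolding closed_def by blast+
    then show "x + y \<in> B" "x * y \<in> B" unfolding B_def by blast+
  qed
  have BQ: "B \<subseteq> Qbar" using MQ by (auto simp: B_def)
  have kB: "rat_hom_on B k"
    unfolding rat_hom_on_def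
  proof (intro conjI ballI)
    fix x y assume "x \<in> B" "y \<in> B"
    then have "(x + y, k x + k y) \<in> M" "(x * y, k x * k y) \<in> M"
      using kM cl unfolding closed_def by blast+
    then show "k (x + y) = k x + k y" "k (x * y) = k x * k y" using k by blast+
  next
    fix q :: complex assume "q \<in> \<rat>"
    then show "k q = q" using kh[of q] rsa_rat[OF A(1)] hom_rat[OF A(1) h] by simp
  qed
  have "Qbar \<subseteq> B"
  proof
    fix a assume a: "a \<in> Qbar"
    obtain p where p: "minimal_poly B a p" using minimal_poly_exists[OF B BQ a] .
    \<comment> \<open>The leading coefficient 1 is preserved, so the image polynomial has positive
      degree and a root.\<close>
    have "coeff (map_poly k p) (degree p) \<noteq> 0"
      using p hom_0[OF B kB] hom_1[OF B kB] by (simp add: coeff_map_poly minimal_poly_def)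
    then have "degree (map_poly k p) > 0"
      using minimal_poly_degree[OF p] le_degree less_le_trans by blast
    then obtain b where "poly (map_poly k p) b = 0" using complex_poly_root_exists by blast
    then obtain k' where k': "rat_hom_on (adjoin B a) k'" "\<And>x. x \<in> B \<Longrightarrow> k' x = k x"
      using extend_to_adjoin[OF B BQ kB a p] by blast
    have "adjoin B a \<subseteq> Qbar"
      using a BQ rsa_poly[OF rsa_Qbar] by (auto simp: adjoin_def subset_iff)
    then have "(\<lambda>x. (x, k' x)) ` adjoin B a \<in> \<A>"
      using AB adjoin_superset[OF B, of a] k' kh
      by (intro graph rsa_adjoin[OF B]) auto
    moreover have "M \<subseteq> (\<lambda>x. (x, k' x)) ` adjoin B a"
    proof
      fix u assume u: "u \<in> M"
      then have "(fst u, snd u) \<in> M" by simp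
      then have "fst u \<in> B" "snd u = k (fst u)" using k[of "fst u" "snd u"] by (auto simp: B_def simp del: prod.collapse)
      then show "u \<in> (\<lambda>x. (x, k' x)) ` adjoin B a"
        using adjoin_superset[OF B, of a] k'(2) by (intro image_eqI[of _ _ "fst u"]) (auto simp: prod_eq_iff)
    qed
    ultimately have "(\<lambda>x. (x, k' x)) ` adjoin B a = M" by (rule M(2))
    then show "a \<in> B" using adjoin_self[OF B, of a] unfolding B_def by blast
  qed
  then have "B = Qbar" using BQ by auto
  then show ?thesis using that[of k] kB kh by simp
qed

text \<open>Being the identity at transcendental numbers makes the elements bijections of all
  complex numbers, so that composition and \<open>inv_into UNIV\<close> are the group
  operations.\<close>

definition abs_galois :: "(complex \<Rightarrow> complex) set" where
  "abs_galois = {\<sigma>. bij \<sigma> \<and> \<sigma> ` Qbar = Qbar \<and> rat_hom_on Qbar \<sigma> \<and> (\<forall>x. x \<notin> Qbar \<longrightarrow> \<sigma> x = x)}"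

text \<open>The roots of one rational polynomial vanishing at x serve for all homomorphisms
  simultaneously.\<close>

lemma finite_rat_conjugates:
  assumes "x \<in> Qbar"
  obtains S where "finite S" "\<And>A h. rat_subalgebra A \<Longrightarrow> rat_hom_on A h \<Longrightarrow> x \<in> A \<Longrightarrow> h x \<in> S"
    "S \<subseteq> Qbar" "x \<in> S" "\<And>A h y. rat_subalgebra A \<Longrightarrow> rat_hom_on A h \<Longrightarrow> y \<in> A \<Longrightarrow> y \<in> S \<Longrightarrow> h y \<in> S"
proof -
  obtain p where p: "\<And>i. coeff p i \<in> \<rat>" "p \<noteq> 0" "poly p x = 0"
    using assms unfolding Qbar_def algebraic_altdef by blast
  show ?thesis
  proof (rule that[of "{z. poly p z = 0}"])
    show "finite {z. poly p z = 0}" by (rule poly_roots_finite[OF p(2)])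
    show "{z. poly p z = 0} \<subseteq> Qbar" using p unfolding Qbar_def algebraic_altdef by blast
  qed (use p hom_rat_root in auto)
qed

lemma extend_to_abs_galois:
  assumes "rat_subalgebra A" "A \<subseteq> Qbar" "rat_hom_on A h"
  obtains \<sigma> where "\<sigma> \<in> abs_galois" "\<And>x. x \<in> A \<Longrightarrow> \<sigma> x = h x"
proof -
  obtain h' where h': "rat_hom_on Qbar h'" "\<And>x. x \<in> A \<Longrightarrow> h' x = h x"
    using extend_to_Qbar[OF assms] by blast
  define \<sigma> where "\<sigma> x = (if x \<in> Qbar then h' x else x)" for x
  have hom: "rat_hom_on Qbar \<sigma>"
    using h'(1) rsa_add[OF rsa_Qbar] rsa_mult[OF rsa_Qbar] rsa_rat[OF rsa_Qbar]
    by (auto simp: rat_hom_on_def \<sigma>_def)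
  have inj: "inj_on \<sigma> Qbar" by (rule hom_inj_on[OF rsa_Qbar hom order_refl])
  have "\<sigma> ` Qbar = Qbar"
  proof (intro equalityI subsetI)
    fix y assume y: "y \<in> Qbar"
    \<comment> \<open>Surjectivity is obtained on a finite stable set of algebraic numbers through
      y, on which the injective \<sigma> is a permutation.\<close>
    obtain S where S: "finite S" "y \<in> S" "S \<subseteq> Qbar" "\<And>y. y \<in> S \<Longrightarrow> \<sigma> y \<in> S"
    proof (rule finite_rat_conjugates[OF y])
      fix S assume "finite S" "y \<in> S" "S \<subseteq> Qbar"
        "\<And>A h z. rat_subalgebra A \<Longrightarrow> rat_hom_on A h \<Longrightarrow> z \<in> A \<Longrightarrow> z \<in> S \<Longrightarrow> h z \<in> S"
      then show thesis using rsa_Qbar hom by (intro that[of S]) auto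
    qed
    then have "\<sigma> ` S = S"
      by (intro endo_inj_surj inj_on_subset[OF inj]) auto
    then show "y \<in> \<sigma> ` Qbar" using S by blast
  qed (use hom_Qbar[OF rsa_Qbar hom] in auto)
  moreover have "bij \<sigma>"
  proof (rule bijI)
    show "inj \<sigma>"
      using inj hom_Qbar[OF rsa_Qbar hom] by (auto simp: inj_on_def \<sigma>_def)
    show "surj \<sigma>"
    proof (unfold surj_def, intro allI)
      show "\<exists>x. y = \<sigma> x" for y
        using \<open>\<sigma> ` Qbar = Qbar\<close> by (cases "y \<in> Qbar") (auto simp: \<sigma>_def)
    qed
  qed
  ultimately have "\<sigma> \<in> abs_galois" using hom by (auto simp: abs_galois_def \<sigma>_def)
  moreover have "\<sigma> x = h x" if "x \<in> A" for x using that assms(2) h'(2) by (auto simp: \<sigma>_def)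
  ultimately show ?thesis by (rule that)
qed

text \<open>In characteristic zero the derivative of the minimal polynomial is nonzero of smaller
  degree, so x is a simple root. Since x lies outside A, the polynomial is not linear and has
  another root b; sending x to b extends to an automorphism.\<close>

lemma moved_by_abs_galois:
  assumes A: "rat_subalgebra A" "A \<subseteq> Qbar" and x: "x \<in> Qbar" "x \<notin> A"
  obtains \<sigma> where "\<sigma> \<in> abs_galois" "\<And>a. a \<in> A \<Longrightarrow> \<sigma> a = a" "\<sigma> x \<noteq> x"
proof -
  have id: "rat_hom_on A (\<lambda>x. x)" by (simp add: rat_hom_on_def)
  obtain p where p: "minimal_poly A x p" using minimal_poly_exists[OF A x(1)] .
  have pA: "\<And>i. coeff p i \<in> A" and px: "poly p x = 0" using p by (auto simp: minimal_poly_def)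
  obtain q where q: "p = [:- x, 1:] * q" using px poly_eq_0_iff_dvd[of p x] by (auto elim: dvdE)
  have p0: "p \<noteq> 0" using minimal_poly_degree[OF p] by auto
  then have q0: "q \<noteq> 0" using q by auto
  have "pderiv p \<noteq> 0" using minimal_poly_degree[OF p] by (simp add: pderiv_eq_0_iff)
  moreover have "coeff (pderiv p) i \<in> A" for i
    using pA rsa_rat[OF A(1), of "of_nat (Suc i)"]
    by (auto simp: coeff_pderiv intro!: rsa_mult[OF A(1)] simp del: of_nat_Suc)
  moreover have "degree (pderiv p) < degree p"
    using minimal_poly_degree[OF p] by (simp add: degree_pderiv)
  ultimately have "poly (pderiv p) x \<noteq> 0" using p unfolding minimal_poly_def by (meson not_less)
  then have qx: "poly q x \<noteq> 0" by (simp add: q pderiv_mult pderiv_pCons del: mult_pCons_left)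
  have "degree q > 0"
  proof (rule ccontr)
    assume "\<not> degree q > 0"
    then obtain c where c: "q = [:c:]" by (auto elim: degree_eq_zeroE)
    have "c \<noteq> 0" using c q0 by simp
    moreover have "lead_coeff p = 1" using p by (simp add: minimal_poly_def)
    ultimately have "c = 1" using c by (simp add: q)
    then have "coeff p 0 = - x" using c by (simp add: q)
    then show False using pA[of 0] x(2) rsa_uminus[OF A(1), of "-x"] by simp
  qed
  then obtain b where b: "poly q b = 0" using complex_poly_root_exists by blast
  then have "poly (map_poly (\<lambda>x. x) p) b = 0" by (simp add: q map_poly_id')
  then obtain h where h: "rat_hom_on (adjoin A x) h" "\<And>y. y \<in> A \<Longrightarrow> h y = y" "h x = b"
    using extend_to_adjoin[OF A id x(1) p] by metis
  have "adjoin A x \<subseteq> Qbar"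
    using x A(2) rsa_poly[OF rsa_Qbar] by (auto simp: adjoin_def subset_iff)
  then obtain \<sigma> where "\<sigma> \<in> abs_galois" "\<And>y. y \<in> adjoin A x \<Longrightarrow> \<sigma> y = h y"
    using extend_to_abs_galois[OF rsa_adjoin[OF A(1)] _ h(1)] by metis
  moreover have "b \<noteq> x" using b qx by auto
  ultimately show ?thesis
    using that h adjoin_self[OF A(1), of x] adjoin_superset[OF A(1), of x] by (metis subsetD)
qed

section \<open>Galois fields\<close>

lemma abs_galoisD:
  assumes "\<sigma> \<in> abs_galois"
  shows "bij \<sigma>" "\<sigma> ` Qbar = Qbar" "rat_hom_on Qbar \<sigma>" "x \<in> Qbar \<Longrightarrow> \<sigma> x \<in> Qbar" "x \<notin> Qbar \<Longrightarrow> \<sigma> x = x"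
  using assms by (auto simp: abs_galois_def)

lemmas abs_galois_hom = abs_galoisD(3)

lemma abs_galois_mem_Qbar_iff: "\<sigma> \<in> abs_galois \<Longrightarrow> \<sigma> x \<in> Qbar \<longleftrightarrow> x \<in> Qbar"
  using abs_galoisD(4,5) by metis

lemma abs_galois_id: "id \<in> abs_galois"
  by (simp add: abs_galois_def rat_hom_on_def)

lemma abs_galois_comp: "\<sigma> \<in> abs_galois \<Longrightarrow> \<tau> \<in> abs_galois \<Longrightarrow> \<sigma> \<circ> \<tau> \<in> abs_galois"
proof -
  assume s: "\<sigma> \<in> abs_galois" and t: "\<tau> \<in> abs_galois"
  then have "(\<sigma> \<circ> \<tau>) ` Qbar = Qbar" unfolding image_comp[symmetric] by (simp add: abs_galoisD(2))
  moreover have "rat_hom_on Qbar (\<sigma> \<circ> \<tau>)"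
    using abs_galois_hom[OF s] abs_galois_hom[OF t] abs_galoisD(4)[OF t]
    by (simp add: rat_hom_on_def)
  ultimately show ?thesis
    using abs_galoisD(1,5)[OF s] abs_galoisD(1,5)[OF t] by (simp add: abs_galois_def bij_comp)
qed

lemma abs_galois_inv:
  assumes s: "\<sigma> \<in> abs_galois" shows "inv_into UNIV \<sigma> \<in> abs_galois"
proof -
  note b = abs_galoisD(1)[OF s]
  have i: "inv_into UNIV \<sigma> (\<sigma> x) = x" "\<sigma> (inv_into UNIV \<sigma> x) = x" for x
    using b by (simp_all add: bij_is_inj surj_f_inv_f bij_is_surj)
  have Q: "inv_into UNIV \<sigma> x \<in> Qbar \<longleftrightarrow> x \<in> Qbar" for x
    using abs_galois_mem_Qbar_iff[OF s, of "inv_into UNIV \<sigma> x"] i by simp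
  have "rat_hom_on Qbar (inv_into UNIV \<sigma>)"
    unfolding rat_hom_on_def
  proof (intro conjI ballI)
    fix x y assume "x \<in> Qbar" "y \<in> Qbar"
    then have "\<sigma> (inv_into UNIV \<sigma> x + inv_into UNIV \<sigma> y) = x + y" "\<sigma> (inv_into UNIV \<sigma> x * inv_into UNIV \<sigma> y) = x * y"
      using Q hom_add[OF rsa_Qbar abs_galois_hom[OF s]] hom_mult[OF rsa_Qbar abs_galois_hom[OF s]] i by auto
    then show "inv_into UNIV \<sigma> (x + y) = inv_into UNIV \<sigma> x + inv_into UNIV \<sigma> y" "inv_into UNIV \<sigma> (x * y) = inv_into UNIV \<sigma> x * inv_into UNIV \<sigma> y"
      using i by metis+
  next
    fix q :: complex assume "q \<in> \<rat>"
    then have "\<sigma> q = q" using hom_rat[OF rsa_Qbar abs_galois_hom[OF s]] by simp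
    then show "inv_into UNIV \<sigma> q = q" using i(1)[of q] by simp
  qed
  moreover have "inv_into UNIV \<sigma> x = x" if "x \<notin> Qbar" for x
    using abs_galoisD(5)[OF s that] i(1)[of x] by simp
  moreover have "inv_into UNIV \<sigma> ` Qbar = Qbar"
    using Q i(1) by (auto intro: image_eqI[of _ _ "\<sigma> _"] simp: abs_galois_mem_Qbar_iff[OF s])
  ultimately show ?thesis by (simp add: abs_galois_def bij_imp_bij_inv b)
qed

lemma abs_galois_inv_simps:
  assumes "\<sigma> \<in> abs_galois" shows "inv_into UNIV \<sigma> (\<sigma> x) = x" "\<sigma> (inv_into UNIV \<sigma> x) = x"
  using abs_galoisD(1)[OF assms] by (simp_all add: bij_is_inj surj_f_inv_f bij_is_surj)

lemma finite_abs_galois_orbit: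
  assumes "x \<in> Qbar" shows "finite ((\<lambda>\<sigma>. \<sigma> x) ` abs_galois)"
proof -
  obtain S where "finite S" "\<And>A h. rat_subalgebra A \<Longrightarrow> rat_hom_on A h \<Longrightarrow> x \<in> A \<Longrightarrow> h x \<in> S"
    using finite_rat_conjugates[OF assms] by metis
  then have "(\<lambda>\<sigma>. \<sigma> x) ` abs_galois \<subseteq> S"
    using rsa_Qbar abs_galois_hom assms by blast
  then show ?thesis using \<open>finite S\<close> finite_subset by blast
qed

lemma ring_hom_on_subfield_iff:
  "h \<in> ring_hom (complex_field\<lparr>carrier := K\<rparr>) (complex_field\<lparr>carrier := L\<rparr>) \<longleftrightarrow>
     h ` K \<subseteq> L \<and> (\<forall>x\<in>K. \<forall>y\<in>K. h (x + y) = h x + h y \<and> h (x * y) = h x * h y) \<and> h 1 = 1"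
  by (auto simp: ring_hom_def complex_field_def)

text \<open>A ring automorphism fixes 1, hence the integers and their quotients, so fixing the
  rationals is automatic.\<close>

lemma field_auts_iff:
  assumes K: "number_field K"
  shows "h \<in> field_auts K \<longleftrightarrow> rat_hom_on K h \<and> bij_betw h K K"
proof
  note A = number_field_rsa[OF K]
  assume h: "h \<in> field_auts K"
  then have b: "bij_betw h K K" by (auto simp: field_auts_def ring_iso_def complex_field_def)
  have hom: "\<And>x y. x \<in> K \<Longrightarrow> y \<in> K \<Longrightarrow> h (x + y) = h x + h y"
    "\<And>x y. x \<in> K \<Longrightarrow> y \<in> K \<Longrightarrow> h (x * y) = h x * h y" "h 1 = 1"
    using h by (auto simp: field_auts_def ring_iso_def ring_hom_on_subfield_iff)
  have h0: "h 0 = 0" using hom(1)[of 0 0] rsa_0[OF A] by simp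
  have n: "h (of_nat n) = of_nat n" for n
    by (induction n) (auto simp: h0 hom rsa_rat[OF A] rsa_1[OF A])
  have m: "h (- x) = - h x" if "x \<in> K" for x
    using hom(1)[of x "- x"] that h0 by (simp add: rsa_uminus[OF A] eq_neg_iff_add_eq_0 add.commute)
  have z: "h (of_int z) = of_int z" for z
    by (cases z rule: int_cases2) (auto simp: n m rsa_rat[OF A])
  have "h q = q" if "q \<in> \<rat>" for q
  proof -
    obtain r where r: "q = of_rat r" using \<open>q \<in> \<rat>\<close> by (auto simp: Rats_def)
    obtain a b where ab: "quotient_of r = (a, b)" by fastforce
    then have "b \<noteq> 0" "q * of_int b = of_int a"
      using quotient_of_denom_pos[OF ab] quotient_of_div[OF ab] r
      by (auto simp: of_rat_divide)
    moreover have "h (q * of_int b) = h q * of_int b"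
      using hom(2)[of q "of_int b"] that rsa_rat[OF A] z by simp
    ultimately have "h q * of_int b = q * of_int b" using z[of a] by simp
    then show ?thesis using \<open>b \<noteq> 0\<close> by simp
  qed
  then show "rat_hom_on K h \<and> bij_betw h K K" using hom b by (auto simp: rat_hom_on_def)
next
  assume "rat_hom_on K h \<and> bij_betw h K K"
  then show "h \<in> field_auts K"
    unfolding field_auts_def ring_iso_def
    by (auto simp: ring_hom_on_subfield_iff rat_hom_on_def complex_field_def ring_hom_def bij_betw_def)
qed

definition fix_group :: "complex set \<Rightarrow> (complex \<Rightarrow> complex) set" where
  "fix_group K = {\<sigma> \<in> abs_galois. \<forall>x\<in>K. \<sigma> x = x}"

lemma fix_group_fixed_field:
  assumes "number_field K" "x \<in> Qbar" "\<And>\<sigma>. \<sigma> \<in> fix_group K \<Longrightarrow> \<sigma> x = x"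
  shows "x \<in> K"
  using moved_by_abs_galois[OF number_field_rsa number_field_Qbar, of K x] assms
  by (auto simp: fix_group_def)

lemma Rats_number_field: "number_field \<rat>"
  using rsa_Rats Rats_span by (auto simp: number_field_iff intro!: exI[of _ "{1}"])

text \<open>The polynomial whose roots are the orbit of x under \<open>field_auts K\<close> has
  coefficients in the fixed field, that is, in the rationals. Every \<sigma> therefore sends x to
  another of its roots, and these lie in K.\<close>

lemma galois_fields_stable:
  assumes K: "K \<in> galois_fields" and s: "\<sigma> \<in> abs_galois" and x: "x \<in> K"
  shows "\<sigma> x \<in> K"
proof -
  have nf: "number_field K" and fixed: "\<And>x. x \<in> K \<Longrightarrow> (\<And>\<tau>. \<tau> \<in> field_auts K \<Longrightarrow> \<tau> x = x) \<Longrightarrow> x \<in> \<rat>"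
    using K by (auto simp: galois_fields_def)
  note A = number_field_rsa[OF nf] and Q = number_field_Qbar[OF nf]
  define S where "S = (\<lambda>\<tau>. \<tau> x) ` field_auts K"
  have SK: "S \<subseteq> K" using x by (auto simp: S_def field_auts_iff[OF nf] dest: bij_betw_apply)
  have "finite S"
  proof -
    obtain S' where "finite S'" "\<And>A h. rat_subalgebra A \<Longrightarrow> rat_hom_on A h \<Longrightarrow> x \<in> A \<Longrightarrow> h x \<in> S'"
      using finite_rat_conjugates[of x] x Q by (metis subsetD)
    then have "S \<subseteq> S'" using A x by (auto simp: S_def field_auts_iff[OF nf])
    then show ?thesis using \<open>finite S'\<close> finite_subset by blast
  qed
  have xS: "x \<in> S"
    unfolding S_def by (rule image_eqI[of _ _ id]) (auto simp: field_auts_iff[OF nf] rat_hom_on_def)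
  let ?P = "\<Prod>b\<in>S. [:- b, 1:]"
  have "coeff ?P i \<in> \<rat>" for i
  proof (rule fixed)
    show "coeff ?P i \<in> K" by (rule coeff_prod_linear[OF A SK])
    fix \<tau> assume t: "\<tau> \<in> field_auts K"
    then have th: "rat_hom_on K \<tau>" "bij_betw \<tau> K K" by (auto simp: field_auts_iff[OF nf])
    have "\<tau> \<circ> \<rho> \<in> field_auts K" if "\<rho> \<in> field_auts K" for \<rho>
      using th that bij_betwE[of \<rho> K K]
      by (auto simp: field_auts_iff[OF nf] rat_hom_on_def intro: bij_betw_trans)
    then have "\<tau> ` S \<subseteq> S" by (auto simp: S_def image_iff) (metis comp_apply)
    moreover have inj: "inj_on \<tau> S" using th(2) SK by (auto simp: bij_betw_def intro: inj_on_subset)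
    ultimately have "\<tau> ` S = S" using endo_inj_surj[OF \<open>finite S\<close>] by blast
    then show "\<tau> (coeff ?P i) = coeff ?P i" by (rule hom_fixes_coeff_prod_linear[OF A th(1) SK _ inj])
  qed
  then have "poly ?P (\<sigma> x) = 0"
    using hom_rat_root[OF rsa_Qbar abs_galois_hom[OF s], of ?P x] x Q xS
      poly_prod_linear_eq_0_iff[OF \<open>finite S\<close>, of x] by auto
  then show ?thesis using poly_prod_linear_eq_0_iff[OF \<open>finite S\<close>] SK by auto
qed

lemma abs_galois_stable_image:
  assumes "\<sigma> \<in> abs_galois" "\<And>\<sigma> x. \<sigma> \<in> abs_galois \<Longrightarrow> x \<in> K \<Longrightarrow> \<sigma> x \<in> K"
  shows "\<sigma> ` K = K"
proof (intro equalityI subsetI)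
  fix x assume "x \<in> K"
  then have "inv_into UNIV \<sigma> x \<in> K" using assms(2) abs_galois_inv[OF assms(1)] by blast
  then show "x \<in> \<sigma> ` K" using abs_galois_inv_simps(2)[OF assms(1), of x] by (metis imageI)
qed (use assms in auto)

text \<open>The definition by a fixed field becomes normality, the form in which Galois fields are
  used afterwards. Conversely, for a stable K every \<sigma> restricts to an automorphism of K, so
  an element fixed by all of \<open>field_auts K\<close> is fixed by all of
  \<open>abs_galois\<close> and is rational.\<close>

lemma galois_fields_iff:
  "K \<in> galois_fields \<longleftrightarrow> number_field K \<and> (\<forall>\<sigma>\<in>abs_galois. \<forall>x\<in>K. \<sigma> x \<in> K)"
proof
  assume "K \<in> galois_fields"
  then show "number_field K \<and> (\<forall>\<sigma>\<in>abs_galois. \<forall>x\<in>K. \<sigma> x \<in> K)"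
    using galois_fields_stable by (auto simp: galois_fields_def)
next
  assume K: "number_field K \<and> (\<forall>\<sigma>\<in>abs_galois. \<forall>x\<in>K. \<sigma> x \<in> K)"
  then have nf: "number_field K" and st: "\<And>\<sigma> x. \<sigma> \<in> abs_galois \<Longrightarrow> x \<in> K \<Longrightarrow> \<sigma> x \<in> K" by auto
  note Q = number_field_Qbar[OF nf]
  have aut: "\<sigma> \<in> field_auts K" if s: "\<sigma> \<in> abs_galois" for \<sigma>
  proof -
    have "\<sigma> ` K = K" by (rule abs_galois_stable_image[OF s]) (rule st)
    then show ?thesis
      using rat_hom_on_subset[OF abs_galois_hom[OF s] Q] bij_is_inj[OF abs_galoisD(1)[OF s]]
      by (auto simp: field_auts_iff[OF nf] bij_betw_def intro: inj_on_subset)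
  qed
  have "{x \<in> K. \<forall>\<sigma>\<in>field_auts K. \<sigma> x = x} = \<rat>"
  proof (intro equalityI subsetI)
    fix x assume x: "x \<in> {x \<in> K. \<forall>\<sigma>\<in>field_auts K. \<sigma> x = x}"
    show "x \<in> \<rat>"
      by (rule fix_group_fixed_field[OF Rats_number_field]) (use x Q aut in \<open>auto simp: fix_group_def\<close>)
  next
    fix x :: complex assume "x \<in> \<rat>"
    then show "x \<in> {x \<in> K. \<forall>\<sigma>\<in>field_auts K. \<sigma> x = x}"
      using rsa_rat[OF number_field_rsa[OF nf]] by (auto simp: field_auts_iff[OF nf] rat_hom_on_def)
  qed
  then show "K \<in> galois_fields" using nf by (simp add: galois_fields_def)
qed

lemma galois_fields_number_field: "K \<in> galois_fields \<Longrightarrow> number_field K"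
  by (simp add: galois_fields_iff)

lemma rsa_Int: "rat_subalgebra A \<Longrightarrow> rat_subalgebra B \<Longrightarrow> rat_subalgebra (A \<inter> B)"
  by (auto simp: rat_subalgebra_def)

lemma galois_fields_Int: "K \<in> galois_fields \<Longrightarrow> L \<in> galois_fields \<Longrightarrow> K \<inter> L \<in> galois_fields"
  using number_field_subset[of K "K \<inter> L"] rsa_Int[of K L] number_field_rsa
  by (auto simp: galois_fields_iff)

text \<open>The subalgebra generated by all conjugates of S is finite-dimensional, as these are
  finitely many algebraic numbers. It is Galois-stable because the elements of M that \<sigma> maps
  into M form a subalgebra containing the conjugates.\<close>

lemma galois_field_containing:
  assumes "finite S" "S \<subseteq> Qbar"
  obtains M where "M \<in> galois_fields" "S \<subseteq> M"
proof -
  define S' where "S' = (\<Union>x\<in>S. (\<lambda>\<sigma>. \<sigma> x) ` abs_galois)"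
  have "finite S'" using assms finite_abs_galois_orbit by (auto simp: S'_def)
  moreover have "S' \<subseteq> Qbar" using assms abs_galoisD(4) by (auto simp: S'_def)
  ultimately obtain A B where A: "rat_subalgebra A" "finite B" "A \<subseteq> qv.span B" "S' \<subseteq> A"
    using finite_rsa_containing by blast
  define M where "M = \<Inter>{A. rat_subalgebra A \<and> S' \<subseteq> A}"
  have M: "rat_subalgebra M" by (auto simp: M_def rat_subalgebra_def)
  have "M \<subseteq> A" using A by (auto simp: M_def)
  then have nf: "number_field M" using M A unfolding number_field_iff by blast
  have "S' \<subseteq> M" by (auto simp: M_def)
  have st: "\<sigma> x \<in> M" if s: "\<sigma> \<in> abs_galois" and x: "x \<in> M" for \<sigma> x
  proof -
    have "rat_subalgebra {x \<in> M. \<sigma> x \<in> M}"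
      using M number_field_Qbar[OF nf] abs_galois_hom[OF s]
      unfolding rat_subalgebra_def rat_hom_on_def by (auto simp: subset_iff)
    moreover have "S' \<subseteq> {x \<in> M. \<sigma> x \<in> M}"
    proof
      fix y assume y: "y \<in> S'"
      then obtain a \<tau> where "a \<in> S" "\<tau> \<in> abs_galois" "y = \<tau> a" by (auto simp: S'_def)
      moreover from this have "(\<sigma> \<circ> \<tau>) a \<in> (\<lambda>\<sigma>. \<sigma> a) ` abs_galois"
        using abs_galois_comp[OF s, of \<tau>] by (intro imageI)
      ultimately have "\<sigma> y \<in> S'" unfolding S'_def by auto
      then show "y \<in> {x \<in> M. \<sigma> x \<in> M}" using y \<open>S' \<subseteq> M\<close> by auto
    qed
    ultimately have "M \<subseteq> {x \<in> M. \<sigma> x \<in> M}" unfolding M_def by blast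
    then show ?thesis using x by auto
  qed
  have "S \<subseteq> S'"
  proof
    fix x assume "x \<in> S"
    moreover have "id x \<in> (\<lambda>\<sigma>. \<sigma> x) ` abs_galois" using abs_galois_id by (rule imageI)
    ultimately show "x \<in> S'" unfolding S'_def by auto
  qed
  then show ?thesis using that[of M] nf st \<open>S' \<subseteq> M\<close> by (auto simp: galois_fields_iff)
qed

section \<open>The groups Gal(K) inside the absolute Galois group, and finiteness of the Galois
  correspondence\<close>

lemma fix_group_id: "id \<in> fix_group K" by (simp add: fix_group_def abs_galois_id)

lemma fix_group_comp: "\<sigma> \<in> fix_group K \<Longrightarrow> \<tau> \<in> fix_group K \<Longrightarrow> \<sigma> \<circ> \<tau> \<in> fix_group K"
  by (simp add: fix_group_def abs_galois_comp)

lemma fix_group_inv: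
  assumes "\<sigma> \<in> fix_group K" shows "inv_into UNIV \<sigma> \<in> fix_group K"
proof -
  have s: "\<sigma> \<in> abs_galois" "\<And>x. x \<in> K \<Longrightarrow> \<sigma> x = x" using assms by (auto simp: fix_group_def)
  have "inv_into UNIV \<sigma> x = x" if "x \<in> K" for x
    using abs_galois_inv_simps(1)[OF s(1), of x] s(2)[OF that] by simp
  then show ?thesis by (simp add: fix_group_def abs_galois_inv s(1))
qed

text \<open>The inverse of \<sigma> maps K into K, where \<tau> does nothing; this is normality of
  Gal(K).\<close>

lemma fix_group_conjugate:
  assumes K: "K \<in> galois_fields" and s: "\<sigma> \<in> abs_galois" and t: "\<tau> \<in> fix_group K"
  shows "\<sigma> \<circ> \<tau> \<circ> inv_into UNIV \<sigma> \<in> fix_group K"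
proof -
  have "\<tau> (inv_into UNIV \<sigma> x) = inv_into UNIV \<sigma> x" if "x \<in> K" for x
    using t galois_fields_stable[OF K abs_galois_inv[OF s] that] by (auto simp: fix_group_def)
  then show ?thesis using s t abs_galois_inv_simps(2)[OF s]
    by (auto simp: fix_group_def intro!: abs_galois_comp abs_galois_inv)
qed

lemma fix_group_antimono: "K \<subseteq> L \<Longrightarrow> fix_group L \<subseteq> fix_group K"
  by (auto simp: fix_group_def)

lemma abs_galois_normalizes_fix_group:
  assumes "K \<in> galois_fields" "\<sigma> \<in> abs_galois" "\<tau> \<in> fix_group K"
  obtains \<tau>' where "\<tau>' \<in> fix_group K" "\<sigma> \<circ> \<tau> = \<tau>' \<circ> \<sigma>"
  using that[OF fix_group_conjugate[OF assms]]
  by (simp add: fun_eq_iff abs_galois_inv_simps[OF assms(2)])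

lemma fixed_prod_linear_coeff_mem:
  assumes K: "number_field K" and S: "S \<subseteq> Qbar" "finite S"
    and st: "\<And>\<sigma>. \<sigma> \<in> fix_group K \<Longrightarrow> \<sigma> ` S \<subseteq> S"
  shows "coeff (\<Prod>b\<in>S. [:- b, 1:]) i \<in> K"
proof (rule fix_group_fixed_field[OF K])
  show "coeff (\<Prod>b\<in>S. [:- b, 1:]) i \<in> Qbar" by (rule coeff_prod_linear[OF rsa_Qbar S(1)])
  fix \<sigma> assume s: "\<sigma> \<in> fix_group K"
  then have g: "\<sigma> \<in> abs_galois" by (simp add: fix_group_def)
  then have inj: "inj_on \<sigma> S" using bij_is_inj[OF abs_galoisD(1)] by (auto intro: inj_on_subset)
  then have "\<sigma> ` S = S" using endo_inj_surj[OF S(2) st[OF s]] by blast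
  then show "\<sigma> (coeff (\<Prod>b\<in>S. [:- b, 1:]) i) = coeff (\<Prod>b\<in>S. [:- b, 1:]) i"
    by (rule hom_fixes_coeff_prod_linear[OF rsa_Qbar abs_galois_hom[OF g] S(1) _ inj])
qed

text \<open>In terms of orbits, \<open>Gal(K \<inter> L) = Gal(K) Gal(L)\<close>: the polynomial whose roots are an orbit
  under the right-hand side has coefficients in \<open>K \<inter> L\<close>.\<close>

lemma fix_group_Int_orbit:
  assumes K: "K \<in> galois_fields" and L: "L \<in> galois_fields" and a: "\<alpha> \<in> Qbar"
    and s: "\<sigma> \<in> fix_group (K \<inter> L)"
  obtains \<kappa> \<rho> where "\<kappa> \<in> fix_group K" "\<rho> \<in> fix_group L" "\<sigma> \<alpha> = \<kappa> (\<rho> \<alpha>)"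
proof -
  define S where "S = {\<kappa> (\<rho> \<alpha>) | \<kappa> \<rho>. \<kappa> \<in> fix_group K \<and> \<rho> \<in> fix_group L}"
  have gal: "\<And>K \<sigma>. \<sigma> \<in> fix_group K \<Longrightarrow> \<sigma> \<in> abs_galois" by (simp add: fix_group_def)
  have "S \<subseteq> (\<lambda>\<sigma>. \<sigma> \<alpha>) ` abs_galois"
  proof
    fix x assume "x \<in> S"
    then obtain \<kappa> \<rho> where "\<kappa> \<in> fix_group K" "\<rho> \<in> fix_group L" "x = \<kappa> (\<rho> \<alpha>)"
      by (auto simp: S_def)
    then have "x = (\<kappa> \<circ> \<rho>) \<alpha>" "\<kappa> \<circ> \<rho> \<in> abs_galois" using gal abs_galois_comp by auto
    then show "x \<in> (\<lambda>\<sigma>. \<sigma> \<alpha>) ` abs_galois" by (rule image_eqI)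
  qed
  then have fin: "finite S" using finite_abs_galois_orbit[OF a] finite_subset by blast
  have SQ: "S \<subseteq> Qbar" using a gal abs_galoisD(4) unfolding S_def by blast
  have stK: "\<tau> ` S \<subseteq> S" if "\<tau> \<in> fix_group K" for \<tau>
  proof safe
    fix x assume "x \<in> S"
    then obtain \<kappa> \<rho> where "x = \<kappa> (\<rho> \<alpha>)" "\<kappa> \<in> fix_group K" "\<rho> \<in> fix_group L" by (auto simp: S_def)
    then show "\<tau> x \<in> S" using fix_group_comp[OF that, of \<kappa>] unfolding S_def
      by (intro CollectI exI[of _ "\<tau> \<circ> \<kappa>"] exI[of _ \<rho>]) auto
  qed
  \<comment> \<open>Normality of Gal(K) moves \<tau> past \<kappa> at the cost of changing \<kappa>;
    it is then absorbed by \<rho>.\<close>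
  have stL: "\<tau> ` S \<subseteq> S" if t: "\<tau> \<in> fix_group L" for \<tau>
  proof safe
    fix x assume "x \<in> S"
    then obtain \<kappa> \<rho> where x: "x = \<kappa> (\<rho> \<alpha>)" "\<kappa> \<in> fix_group K" "\<rho> \<in> fix_group L" by (auto simp: S_def)
    obtain \<kappa>' where k: "\<kappa>' \<in> fix_group K" "\<tau> \<circ> \<kappa> = \<kappa>' \<circ> \<tau>"
      using abs_galois_normalizes_fix_group[OF K gal[OF t] x(2)] .
    then have "\<tau> x = \<kappa>' ((\<tau> \<circ> \<rho>) \<alpha>)" using x by (metis comp_apply)
    then show "\<tau> x \<in> S" using k fix_group_comp[OF t x(3)] unfolding S_def by blast
  qed
  let ?P = "\<Prod>b\<in>S. [:- b, 1:]"
  have nf: "number_field K" "number_field L" "number_field (K \<inter> L)"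
    using K L galois_fields_Int galois_fields_number_field by auto
  have c: "coeff ?P i \<in> K \<inter> L" for i
    using fixed_prod_linear_coeff_mem[OF nf(1) SQ fin stK] fixed_prod_linear_coeff_mem[OF nf(2) SQ fin stL] by auto
  have "map_poly \<sigma> ?P = ?P"
    using c s hom_0[OF rsa_Qbar abs_galois_hom[OF gal[OF s]]] unfolding fix_group_def
    by (intro poly_eqI) (simp add: coeff_map_poly)
  moreover have "\<alpha> \<in> S" unfolding S_def using fix_group_id[of K] fix_group_id[of L]
    by (intro CollectI exI[of _ id]) auto
  then have "poly ?P \<alpha> = 0" using poly_prod_linear_eq_0_iff[OF fin] by blast
  ultimately have "poly ?P (\<sigma> \<alpha>) = 0"
    using hom_poly[OF rsa_Qbar abs_galois_hom[OF gal[OF s]], of ?P \<alpha>] a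
      coeff_prod_linear[OF rsa_Qbar SQ] hom_0[OF rsa_Qbar abs_galois_hom[OF gal[OF s]]] by simp
  then have "\<sigma> \<alpha> \<in> S" using poly_prod_linear_eq_0_iff[OF fin] by blast
  then show ?thesis using that unfolding S_def by blast
qed

text \<open>An automorphism is determined on K by its values on a finite rational basis, and each
  basis element has finitely many conjugates.\<close>

lemma finite_restrict_abs_galois:
  assumes K: "number_field K"
  shows "finite ((\<lambda>\<sigma>. restrict \<sigma> K) ` abs_galois)"
proof -
  obtain B0 where B0: "finite B0" "K \<subseteq> qv.span B0" using K by (auto simp: number_field_iff)
  obtain B where B: "B \<subseteq> K" "qv.independent B" "K \<subseteq> qv.span B"
    using qv.maximal_independent_subset[of K] by blast
  have "finite B" using qv.independent_span_bound[OF B0(1) B(2)] B(1) B0(2) by auto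
  have BQ: "B \<subseteq> Qbar" using B(1) number_field_Qbar[OF K] by auto
  let ?F = "(\<lambda>\<sigma>. restrict \<sigma> K) ` abs_galois"
  have "finite (PiE B (\<lambda>b. (\<lambda>\<sigma>. \<sigma> b) ` abs_galois))"
    using \<open>finite B\<close> BQ finite_abs_galois_orbit by (intro finite_PiE) auto
  moreover have "(\<lambda>f. restrict f B) ` ?F \<subseteq> PiE B (\<lambda>b. (\<lambda>\<sigma>. \<sigma> b) ` abs_galois)"
    using B(1) by auto
  moreover have "inj_on (\<lambda>f. restrict f B) ?F"
  proof (rule inj_onI, clarify)
    fix \<sigma> \<tau> assume st: "\<sigma> \<in> abs_galois" "\<tau> \<in> abs_galois"
      and eq: "restrict (restrict \<sigma> K) B = restrict (restrict \<tau> K) B"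
    have eqB: "\<sigma> b = \<tau> b" if "b \<in> B" for b
      using fun_cong[OF eq, of b] that B(1) by auto
    have "rat_subalgebra {x \<in> Qbar. \<sigma> x = \<tau> x}"
      using rsa_Qbar st[THEN abs_galois_hom] by (auto simp: rat_subalgebra_def rat_hom_on_def)
    then have "qv.span B \<subseteq> {x \<in> Qbar. \<sigma> x = \<tau> x}"
      using eqB BQ by (intro rsa_span) auto
    then show "restrict \<sigma> K = restrict \<tau> K" using B(3) by (intro restrict_ext) auto
  qed
  ultimately show ?thesis by (meson finite_imageD finite_subset)
qed

text \<open>L is recovered as the fixed field of the restrictions of Gal(L) to K, and these
  restrictions form a subset of a finite set.\<close>

lemma finite_galois_subfields:
  assumes K: "K \<in> galois_fields"
  shows "finite {L \<in> galois_fields. L \<subseteq> K}"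
proof -
  note nf = galois_fields_number_field[OF K]
  let ?r = "\<lambda>L. (\<lambda>\<sigma>. restrict \<sigma> K) ` fix_group L"
  have "finite (Pow ((\<lambda>\<sigma>. restrict \<sigma> K) ` abs_galois))"
    using finite_restrict_abs_galois[OF nf] by simp
  moreover have "?r ` {L \<in> galois_fields. L \<subseteq> K} \<subseteq> Pow ((\<lambda>\<sigma>. restrict \<sigma> K) ` abs_galois)"
    by (auto simp: fix_group_def)
  moreover have "inj_on ?r {L \<in> galois_fields. L \<subseteq> K}"
  proof (rule inj_on_inverseI)
    fix L assume "L \<in> {L \<in> galois_fields. L \<subseteq> K}"
    then have L: "number_field L" "L \<subseteq> K" by (auto simp: galois_fields_iff)
    have "{x \<in> K. \<forall>f\<in>?r L. f x = x} = L"
    proof (intro equalityI subsetI)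
      fix x assume x: "x \<in> {x \<in> K. \<forall>f\<in>?r L. f x = x}"
      show "x \<in> L"
        by (rule fix_group_fixed_field[OF L(1)]) (use x number_field_Qbar[OF nf] in auto)
    qed (use L in \<open>auto simp: fix_group_def\<close>)
    then show "(\<lambda>R. {x \<in> K. \<forall>f\<in>R. f x = x}) (?r L) = L" .
  qed
  ultimately show ?thesis by (meson finite_imageD finite_subset)
qed

section \<open>Normalised absolute values\<close>

text \<open>Estimates for N-th powers below lose a factor polynomial in N; exponential growth beats
  it, so the loss disappears on passing to roots.\<close>

lemma le_1_if_powers_polynomially_bounded:
  fixes t C e :: real
  assumes "\<And>N::nat. t ^ N \<le> C * real (N + 1) powr e"
  shows "t \<le> 1"
proof (rule ccontr)
  assume "\<not> t \<le> 1"
  then have t: "t > 1" by simp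
  then have "(\<lambda>N::nat. C * real (N + 1) powr e / t ^ N) \<longlonglongrightarrow> 0" by real_asymp
  then have "eventually (\<lambda>N. C * real (N + 1) powr e / t ^ N < 1) sequentially"
    by (rule order_tendstoD) simp
  then obtain N where "C * real (N + 1) powr e / t ^ N < 1" by (auto simp: eventually_sequentially)
  then show False using assms[of N] t by (simp add: divide_less_eq)
qed

lemma abs_value_restrict:
  assumes "w \<in> nontrivial_abs_values K" "L \<subseteq> K" "\<exists>x\<in>L. x \<noteq> 0 \<and> w x \<noteq> 1"
  shows "w \<in> nontrivial_abs_values L"
  using assms(2,3) assms(1)[unfolded nontrivial_abs_values_def] unfolding nontrivial_abs_values_def by blast

context
  fixes K w
  assumes K: "rat_subalgebra K" and w: "w \<in> nontrivial_abs_values K"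
begin

lemma av_nonneg: "x \<in> K \<Longrightarrow> w x \<ge> 0" using w by (auto simp: nontrivial_abs_values_def)
lemma av_eq_0_iff: "x \<in> K \<Longrightarrow> w x = 0 \<longleftrightarrow> x = 0" using w by (auto simp: nontrivial_abs_values_def)
lemma av_pos: "x \<in> K \<Longrightarrow> x \<noteq> 0 \<Longrightarrow> w x > 0" using av_nonneg av_eq_0_iff by fastforce
lemma av_mult: "x \<in> K \<Longrightarrow> y \<in> K \<Longrightarrow> w (x * y) = w x * w y" using w by (auto simp: nontrivial_abs_values_def)
lemma av_triangle: "x \<in> K \<Longrightarrow> y \<in> K \<Longrightarrow> w (x + y) \<le> w x + w y" using w by (auto simp: nontrivial_abs_values_def)
lemma av_0: "w 0 = 0" using av_eq_0_iff rsa_0[OF K] by auto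

lemma av_1: "w 1 = 1"
  using av_mult[of 1 1] av_pos[of 1] rsa_1[OF K] by simp

lemma av_power: "x \<in> K \<Longrightarrow> w (x ^ n) = w x ^ n"
  by (induction n) (auto simp: av_1 av_mult rsa_power[OF K])

lemma av_uminus: assumes "x \<in> K" shows "w (- x) = w x"
proof -
  have m: "-1 \<in> K" using rsa_rat[OF K] by simp
  have "w (-1) ^ 2 = 1" using av_power[OF m, of 2] av_1 by simp
  then have "w (-1) = 1" using av_nonneg[OF m] by (simp add: power2_eq_1_iff)
  then show ?thesis using av_mult[OF m assms] by simp
qed

lemma av_sum: "(\<And>i. i \<in> I \<Longrightarrow> f i \<in> K) \<Longrightarrow> w (sum f I) \<le> (\<Sum>i\<in>I. w (f i))"
proof (induction I rule: infinite_finite_induct)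
  case (insert x F)
  then have "w (f x + sum f F) \<le> w (f x) + w (sum f F)"
    by (intro av_triangle rsa_sum[OF K]) auto
  then show ?case using insert by force
qed (auto simp: av_0)

lemma av_of_nat: "w (of_nat n) \<le> n"
  using av_sum[of "{..<n}" "\<lambda>_. 1"] rsa_1[OF K] by (simp add: av_1)

lemma av_inverse: assumes "x \<in> K" "inverse x \<in> K" shows "w (inverse x) = inverse (w x)"
proof (cases "x = 0")
  case False
  then have "w x * w (inverse x) = 1" using av_mult[OF assms] av_1 by simp
  then show ?thesis by (rule inverse_unique[symmetric])
qed (simp add: av_0)

lemma av_of_int: "w (of_int z) = w (of_nat (nat \<bar>z\<bar>))"
  by (cases z rule: int_cases2) (auto simp: av_uminus rsa_rat[OF K])

lemma av_of_rat:
  assumes "quotient_of q = (a, b)"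
  shows "w (of_rat q) = w (of_int a) / w (of_int b)"
proof -
  have b: "b > 0" "q = of_int a / of_int b"
    using quotient_of_denom_pos[OF assms] quotient_of_div[OF assms] by auto
  then have "w (of_rat q * of_int b) = w (of_int a)" by (simp add: of_rat_divide)
  then have "w (of_rat q) * w (of_int b) = w (of_int a)" by (simp add: av_mult rsa_rat[OF K])
  moreover have "w (of_int b) > 0" using av_pos[of "of_int b"] b(1) rsa_rat[OF K] by simp
  ultimately show ?thesis by (simp add: field_simps)
qed

text \<open>For s > 1 the triangle inequality of a power is not automatic. It is recovered from the
  binomial expansion of \<open>(x + y) ^ N\<close>: the bound at integers controls the binomial
  coefficients, and the N + 1 terms cost only a polynomial factor.\<close>

lemma av_powr_nontrivial:
  assumes s: "s > 0" and n: "\<And>n. w (of_nat n) powr s \<le> real n"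
  shows "(\<lambda>x. w x powr s) \<in> nontrivial_abs_values K"
proof -
  define v where "v x = w x powr s" for x
  have vnn: "v x \<ge> 0" for x by (simp add: v_def)
  have vmult: "v (x * y) = v x * v y" if "x \<in> K" "y \<in> K" for x y
    using that by (simp add: v_def av_mult powr_mult av_nonneg)
  have v1: "v 1 = 1" by (simp add: v_def av_1)
  have vpow: "v (x ^ n) = v x ^ n" if "x \<in> K" for x n
    by (induction n) (auto simp: v1 vmult rsa_power[OF K] that)
  have tri: "v (x + y) \<le> v x + v y" if xy: "x \<in> K" "y \<in> K" for x y
  proof (cases "v x + v y = 0")
    case True
    then have "v x = 0" "v y = 0" using vnn[of x] vnn[of y] by linarith+
    then have "x = 0" "y = 0" using av_eq_0_iff xy by (auto simp: v_def)
    then show ?thesis by (simp add: v_def av_0)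
  next
    case False
    then have pos: "v x + v y > 0" using vnn[of x] vnn[of y] by linarith
    have "((v (x + y)) / (v x + v y)) ^ N \<le> 1 * real (N + 1) powr s" for N
    proof -
      define a where "a k = of_nat (N choose k) * x ^ k * y ^ (N - k)" for k
      have aK: "a k \<in> K" for k
        unfolding a_def by (intro rsa_mult[OF K] rsa_power[OF K] xy rsa_rat[OF K]) auto
      have va: "v (a k) \<le> of_nat (N choose k) * v x ^ k * v y ^ (N - k)" for k
        using n[of "N choose k"] unfolding a_def
        by (simp add: vmult vpow xy rsa_mult[OF K] rsa_power[OF K] rsa_rat[OF K] v_def[of "of_nat _"]
            mult_right_mono vnn)
      \<comment> \<open>Bounding the sum by N + 1 times its largest term allows the power s to be
        taken, since powers split over products.\<close>
      define m where "m = Max ((\<lambda>k. w (a k)) ` {..N})"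
      have "w (\<Sum>k\<le>N. a k) \<le> (\<Sum>k\<le>N. w (a k))" by (rule av_sum) (rule aK)
      also have "\<dots> \<le> (\<Sum>k\<le>N. m)" by (rule sum_mono) (auto simp: m_def)
      finally have "w ((x + y) ^ N) \<le> real (N + 1) * m"
        by (simp add: binomial_ring a_def)
      then have "v ((x + y) ^ N) \<le> (real (N + 1) * m) powr s"
        unfolding v_def using s av_nonneg xy rsa_power[OF K] rsa_add[OF K] by (intro powr_mono2) auto
      moreover have "m \<in> (\<lambda>k. w (a k)) ` {..N}" unfolding m_def by (rule Max_in) auto
      then obtain k where k: "k \<le> N" "m = w (a k)" by auto
      ultimately have "v ((x + y) ^ N) \<le> real (N + 1) powr s * v (a k)"
        using av_nonneg[OF aK] by (simp add: powr_mult v_def)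
      also have "\<dots> \<le> real (N + 1) powr s * (\<Sum>k\<le>N. of_nat (N choose k) * v x ^ k * v y ^ (N - k))"
      proof (rule mult_left_mono)
        have "v (a k) \<le> of_nat (N choose k) * v x ^ k * v y ^ (N - k)" by (rule va)
        also have "\<dots> \<le> (\<Sum>k\<le>N. of_nat (N choose k) * v x ^ k * v y ^ (N - k))"
          by (rule member_le_sum[of k]) (use k vnn in auto)
        finally show "v (a k) \<le> (\<Sum>k\<le>N. of_nat (N choose k) * v x ^ k * v y ^ (N - k))" .
      qed simp
      also have "(\<Sum>k\<le>N. of_nat (N choose k) * v x ^ k * v y ^ (N - k)) = (v x + v y) ^ N"
        by (simp only: binomial_ring)
      finally have "v (x + y) ^ N \<le> real (N + 1) powr s * (v x + v y) ^ N"
        by (simp add: vpow xy rsa_add[OF K])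
      then show ?thesis using pos by (simp add: power_divide divide_le_eq)
    qed
    then have "v (x + y) / (v x + v y) \<le> 1" by (rule le_1_if_powers_polynomially_bounded)
    then show ?thesis using pos by (simp add: divide_le_eq)
  qed
  have "\<exists>x\<in>K. x \<noteq> 0 \<and> v x \<noteq> 1"
  proof -
    obtain x where x: "x \<in> K" "x \<noteq> 0" "w x \<noteq> 1" using w by (auto simp: nontrivial_abs_values_def)
    then have "v x \<noteq> 1" using av_pos[of x] s by (simp add: v_def powr_eq_one_iff_gen)
    then show ?thesis using x by blast
  qed
  then have "v \<in> nontrivial_abs_values K"
    using vnn vmult tri av_eq_0_iff by (auto simp: nontrivial_abs_values_def v_def)
  then show ?thesis by (simp add: v_def[abs_def])
qed

text \<open>If w were 1 on all positive integers, it would be at most 1 on the rationals. The powers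
  of an algebraic x lie in one finite-dimensional span, so they would be bounded and
  \<open>w x \<le> 1\<close>; the same for the inverse of x makes w trivial.\<close>

lemma av_nontrivial_on_Rats:
  assumes KQ: "K \<subseteq> Qbar"
  shows "\<exists>n::nat. n > 0 \<and> w (of_nat n) \<noteq> 1"
proof (rule ccontr)
  assume "\<not> ?thesis"
  then have n: "w (of_nat n) = 1" if "n > 0" for n using that by blast
  have q: "w (of_rat q) \<le> 1" for q
  proof -
    obtain a b where ab: "quotient_of q = (a, b)" by fastforce
    have "b > 0" using quotient_of_denom_pos[OF ab] .
    then have b: "w (of_int b) = 1" unfolding av_of_int by (intro n) simp
    show ?thesis
    proof (cases "a = 0")
      case False
      then have "w (of_int a) = 1" unfolding av_of_int by (intro n) simp
      then show ?thesis using b by (simp add: av_of_rat[OF ab])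
    qed (simp add: av_of_rat[OF ab] av_0)
  qed
  have le: "w x \<le> 1" if x: "x \<in> K" for x
  proof -
    obtain N where N: "\<And>k. x ^ k \<in> qv.span ((\<lambda>i. x ^ i) ` {..<N})"
      using power_in_span_lower_powers[of x] x KQ by (auto simp: Qbar_def)
    let ?S = "(\<lambda>i. x ^ i) ` {..<N}"
    \<comment> \<open>Exponent 0 casts a constant bound in the form of a polynomial one.\<close>
    have "w x ^ k \<le> (\<Sum>v\<in>?S. w v) * real (k + 1) powr 0" for k
    proof -
      obtain u where u: "x ^ k = (\<Sum>v\<in>?S. of_rat (u v) * v)"
        using N[of k] qv.span_finite[of ?S] by auto
      have SK: "?S \<subseteq> K" using rsa_power[OF K x] by auto
      have "w x ^ k \<le> (\<Sum>v\<in>?S. w (of_rat (u v) * v))"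
        unfolding av_power[OF x, symmetric] u
        by (rule av_sum, rule rsa_mult[OF K]) (use SK rsa_rat[OF K] in auto)
      also have "\<dots> \<le> (\<Sum>v\<in>?S. 1 * w v)"
      proof (rule sum_mono)
        fix v assume "v \<in> ?S"
        then have "v \<in> K" using SK by auto
        then show "w (of_rat (u v) * v) \<le> 1 * w v"
          using q[of "u v"] av_nonneg[of v] by (simp add: av_mult rsa_rat[OF K] mult_left_le_one_le av_nonneg)
      qed
      finally show ?thesis by simp
    qed
    then show ?thesis by (rule le_1_if_powers_polynomially_bounded)
  qed
  obtain x where x: "x \<in> K" "x \<noteq> 0" "w x \<noteq> 1" using w by (auto simp: nontrivial_abs_values_def)
  have ix: "inverse x \<in> K" using rsa_inverse[OF K x(1)] x KQ by (auto simp: Qbar_def)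
  have "w x < 1" using le[OF x(1)] x(3) by simp
  then have "inverse (w x) > 1" using av_pos[OF x(1,2)] by (simp add: one_less_inverse)
  then show False using le[OF ix] av_inverse[OF x(1) ix] by simp
qed

text \<open>Expansion of N to base n with L digits: a digit has absolute value at most n by the
  triangle inequality, and a power of the base contributes at most \<open>M ^ L\<close>.\<close>

lemma av_digits:
  assumes n: "n \<ge> 2" and M: "M \<ge> 1" "w (of_nat n) \<le> M"
  shows "N < n ^ L \<Longrightarrow> w (of_nat N) \<le> real L * real n * M ^ L"
proof (induction L arbitrary: N)
  case (Suc L)
  have nat_K: "of_nat k \<in> K" for k using rsa_rat[OF K] by simp
  have "N div n < n ^ L" using Suc.prems n by (simp add: less_mult_imp_div_less mult.commute)
  then have IH: "w (of_nat (N div n)) \<le> real L * real n * M ^ L" by (rule Suc.IH)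
  have "of_nat N = of_nat n * of_nat (N div n) + (of_nat (N mod n) :: complex)"
    by (metis mult_div_mod_eq of_nat_add of_nat_mult)
  then have "w (of_nat N) \<le> w (of_nat n) * w (of_nat (N div n)) + w (of_nat (N mod n))"
    using av_triangle[of "of_nat n * of_nat (N div n)" "of_nat (N mod n)"] av_mult nat_K rsa_mult[OF K] by simp
  also have "\<dots> \<le> M * (real L * real n * M ^ L) + real n"
  proof (rule add_mono)
    show "w (of_nat n) * w (of_nat (N div n)) \<le> M * (real L * real n * M ^ L)"
      using M IH av_nonneg[OF nat_K] by (intro mult_mono) auto
    have "N mod n \<le> n" using n by simp
    then show "w (of_nat (N mod n)) \<le> real n" using av_of_nat[of "N mod n"] by linarith
  qed
  also have "\<dots> \<le> M * (real L * real n * M ^ L) + real n * M ^ Suc L"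
    using M(1) one_le_power[of M "Suc L"] mult_left_mono[of 1 "M ^ Suc L" "real n"] by simp
  finally show ?case by (simp add: algebra_simps)
qed (simp add: av_0)

text \<open>The digit estimate is applied to \<open>m ^ k\<close>, which has about
  \<open>k * log n m\<close> digits to base n; taking k-th roots removes the factor linear in
  k.\<close>

lemma av_ostrowski_bound:
  assumes n: "n \<ge> 2" and m: "m \<ge> 2" and M: "M \<ge> 1" "w (of_nat n) \<le> M"
  shows "w (of_nat m) \<le> M powr log n m"
proof -
  define c where "c = log n m"
  have c: "c > 0" using n m by (simp add: c_def)
  have mK: "of_nat m \<in> K" using rsa_rat[OF K] by simp
  have "(w (of_nat m) / M powr c) ^ k \<le> ((c + 1) * n * M) * real (k + 1) powr 1" for k
  proof -
    \<comment> \<open>The \<open>+ 1\<close> makes L exceed \<open>k * c\<close> strictly, so that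
      \<open>m ^ k < n ^ L\<close>, as the digit estimate requires.\<close>
    define L where "L = nat \<lfloor>real k * c\<rfloor> + 1"
    have L: "real L \<le> k * c + 1" "k * c < L" 
    proof -
      have "\<lfloor>real k * c\<rfloor> \<ge> 0" using c by simp
      then have "real L = of_int \<lfloor>real k * c\<rfloor> + 1" by (simp add: L_def)
      then show "real L \<le> k * c + 1" "k * c < L" using floor_correct[of "real k * c"] by linarith+
    qed
    have "real (m ^ k) = real n powr (k * c)"
      using n m by (simp add: c_def powr_mult_base powr_powr[symmetric] powr_realpow mult.commute[of "real k"])
    also have "\<dots> < real n powr L" using n L by (intro powr_less_mono) auto
    also have "\<dots> = real (n ^ L)" using n by (simp add: powr_realpow)
    finally have "m ^ k < n ^ L" by (simp only: of_nat_less_iff)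
    then have "w (of_nat (m ^ k)) \<le> real L * real n * M ^ L" by (rule av_digits[OF n M])
    also have "\<dots> \<le> (k * c + 1) * real n * M powr (k * c + 1)"
      using L M c powr_mono[OF L(1) M(1)] by (intro mult_mono) (auto simp: powr_realpow)
    also have "\<dots> = (k * c + 1) * real n * M * (M powr c) ^ k"
      using M by (simp add: powr_add powr_powr[symmetric] powr_realpow mult.commute[of "real k"])
    finally have "w (of_nat m) ^ k \<le> (k * c + 1) * real n * M * (M powr c) ^ k"
      using av_power[OF mK] by simp
    then have "(w (of_nat m) / M powr c) ^ k \<le> (k * c + 1) * real n * M"
      using M by (simp add: power_divide divide_le_eq)
    also have "\<dots> \<le> ((c + 1) * (k + 1)) * real n * M"
      using M c by (intro mult_right_mono) (auto simp: algebra_simps)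
    finally show ?thesis by (simp add: mult_ac)
  qed
  then have "w (of_nat m) / M powr c \<le> 1" by (rule le_1_if_powers_polynomially_bounded)
  then show ?thesis using M by (simp add: divide_le_eq c_def)
qed

text \<open>Archimedean case of Ostrowski's theorem: comparing two bases in both directions shows
  that the quotient of ln w(n) by ln n is the same for all n \<ge> 2. The exponent s is the
  reciprocal of this common value.\<close>

lemma av_archimedean:
  assumes n0: "w (of_nat n0) > 1"
  obtains s where "s > 0" "\<And>q. w (of_rat q) powr s = real_of_rat \<bar>q\<bar>"
proof -
  have n02: "n0 \<ge> 2"
  proof (rule ccontr)
    assume "\<not> n0 \<ge> 2"
    then have "n0 = 0 \<or> n0 = 1" by auto
    then show False using n0 by (auto simp: av_0 av_1)
  qed
  \<comment> \<open>A base n of absolute value at most 1 would allow M = 1 and so force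
    \<open>w (of_nat n0) \<le> 1\<close>.\<close>
  have gt: "w (of_nat n) > 1" if "n \<ge> 2" for n
  proof (rule ccontr)
    assume "\<not> w (of_nat n) > 1"
    then show False using av_ostrowski_bound[OF that n02, of 1] n0 by simp
  qed
  have le: "ln (w (of_nat m)) / ln m \<le> ln (w (of_nat n)) / ln n" if "n \<ge> 2" "m \<ge> 2" for m n
  proof -
    have "w (of_nat m) \<le> w (of_nat n) powr log n m"
      using av_ostrowski_bound[OF that, of "w (of_nat n)"] gt[OF that(1)] by simp
    then have "ln (w (of_nat m)) \<le> ln (w (of_nat n) powr log n m)"
      using gt[OF that(1)] gt[OF that(2)] by (subst ln_le_cancel_iff) auto
    also have "\<dots> = (ln m / ln n) * ln (w (of_nat n))" using gt[OF that(1)] by (simp add: ln_powr log_def)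
    finally show ?thesis using that by (simp add: field_simps)
  qed
  define t where "t = ln (w 2) / ln 2"
  have t: "t > 0" using gt[of 2] by (simp add: t_def)
  have wn: "w (of_nat n) powr (1 / t) = real n" for n
  proof -
    consider "n = 0" | "n = 1" | "n \<ge> 2" by linarith
    then show ?thesis
    proof cases
      case 3
      then have "ln (w (of_nat n)) / ln n = t" using le[of 2 n] le[of n 2] by (simp add: t_def)
      then have "ln (w (of_nat n)) = t * ln n" using 3 by (simp add: field_simps)
      then have "ln (w (of_nat n)) / t = ln n" using t by (simp add: field_simps)
      then show ?thesis using gt[OF 3] 3 by (simp add: powr_def)
    qed (auto simp: av_0 av_1)
  qed
  have "w (of_rat q) powr (1 / t) = real_of_rat \<bar>q\<bar>" for q
  proof -
    obtain a b where ab: "quotient_of q = (a, b)" by fastforce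
    have b: "b > 0" "q = of_int a / of_int b"
      using quotient_of_denom_pos[OF ab] quotient_of_div[OF ab] by auto
    have "w (of_rat q) powr (1 / t) = real (nat \<bar>a\<bar>) / real (nat \<bar>b\<bar>)"
      unfolding av_of_rat[OF ab] av_of_int
      by (subst powr_divide) (auto simp: wn av_nonneg rsa_rat[OF K] simp del: of_nat_nat)
    also have "\<dots> = real_of_rat \<bar>q\<bar>" using b by (cases "a \<ge> 0") (auto simp: of_rat_divide abs_divide of_rat_minus)
    finally show ?thesis .
  qed
  then show ?thesis using t by (intro that[of "1 / t"]) auto
qed

text \<open>Non-archimedean case of Ostrowski's theorem: p is the least positive integer of absolute
  value below 1, prime by minimality, and integers prime to p have absolute value 1. The exponent s
  solves \<open>w (of_nat p) powr s = 1 / p\<close>.\<close>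

lemma av_nonarchimedean:
  assumes KQ: "K \<subseteq> Qbar" and le: "\<And>n. w (of_nat n) \<le> 1"
  obtains s p where "s > 0" "Factorial_Ring.prime p" "\<And>q. w (of_rat q) powr s = padic_abs p q"
proof -
  have nat_K: "of_nat k \<in> K" for k using rsa_rat[OF K] by simp
  have int_K: "of_int k \<in> K" for k using rsa_rat[OF K] by simp
  obtain n0 where n0: "n0 > 0" "w (of_nat n0) \<noteq> 1" using av_nontrivial_on_Rats[OF KQ] by blast
  define P where "P n \<longleftrightarrow> n > 0 \<and> w (of_nat n) < 1" for n :: nat
  define p where "p = (LEAST n. P n)"
  have "P n0" using n0 le[of n0] by (simp add: P_def)
  then have pP: "P p" and pmin: "\<And>n. P n \<Longrightarrow> p \<le> n"
    unfolding p_def by (auto intro: LeastI Least_le)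
  then have p0: "p > 0" and wp1: "w (of_nat p) < 1" by (auto simp: P_def)
  have wp0: "w (of_nat p) > 0" using av_pos[OF nat_K] p0 by simp
  have p1: "p \<noteq> 1" using wp1 av_1 by auto
  have prime: "Factorial_Ring.prime p"
    unfolding prime_nat_iff
  proof (intro conjI allI impI)
    fix m assume "m dvd p"
    then obtain k where k: "p = m * k" by blast
    then have "w (of_nat m) * w (of_nat k) < 1" using wp1 nat_K by (simp add: av_mult)
    then have "w (of_nat m) < 1 \<or> w (of_nat k) < 1"
      using mult_mono[of 1 "w (of_nat m)" 1 "w (of_nat k)"] by linarith
    then have "P m \<or> P k" using k p0 by (auto simp: P_def)
    then have "p \<le> m \<or> p \<le> k" using pmin by blast
    then show "m = 1 \<or> m = p" using k p0 by auto
  qed (use p0 p1 in simp)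
  have coprime_1: "w (of_int m) = 1" if "\<not> int p dvd m" for m
  proof (rule ccontr)
    assume "w (of_int m) \<noteq> 1"
    then have m1: "w (of_int m) < 1" using le[of "nat \<bar>m\<bar>"] unfolding av_of_int by linarith
    have "coprime m (int p)" using prime_imp_coprime[of "int p" m] that prime by (simp add: coprime_commute)
    \<comment> \<open>High powers compensate for having only the ordinary triangle inequality: a
      Bezout relation between N-th powers bounds 1 by a sum that tends to 0.\<close>
    have "1 \<le> w (of_int m) ^ N + w (of_nat p) ^ N" for N
    proof -
      have "gcd (m ^ N) (int p ^ N) = 1" using \<open>coprime m (int p)\<close> by simp
      then obtain a b where ab: "a * m ^ N + b * int p ^ N = 1"
        using bezout_int[of "m ^ N" "int p ^ N"] by auto
      have "(of_int (a * m ^ N + b * int p ^ N) :: complex) = 1" unfolding ab by simp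
      then have eq: "of_int a * of_int m ^ N + of_int b * of_nat p ^ N = (1 :: complex)" by simp
      have "of_int a * of_int m ^ N \<in> K" "of_int b * of_nat p ^ N \<in> K"
        using int_K nat_K by (auto intro!: rsa_mult[OF K] rsa_power[OF K])
      then have "1 \<le> w (of_int a * of_int m ^ N) + w (of_int b * of_nat p ^ N)"
        using av_triangle[of "of_int a * of_int m ^ N" "of_int b * of_nat p ^ N"] av_1 by (simp only: eq)
      also have "\<dots> = w (of_int a) * w (of_int m) ^ N + w (of_int b) * w (of_nat p) ^ N"
        using int_K nat_K rsa_power[OF K] by (simp add: av_mult av_power)
      also have "\<dots> \<le> 1 * w (of_int m) ^ N + 1 * w (of_nat p) ^ N"
        using le av_nonneg int_K nat_K
        by (intro add_mono mult_right_mono) (auto simp only: av_of_int zero_le_power)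
      finally show ?thesis by simp
    qed
    moreover have "(\<lambda>N. w (of_int m) ^ N + w (of_nat p) ^ N) \<longlonglongrightarrow> 0 + 0"
      using m1 wp1 wp0 av_nonneg[OF int_K] by (intro tendsto_add LIMSEQ_power_zero) auto
    ultimately have "1 \<le> (0::real)" by (intro LIMSEQ_le_const[of _ 0]) auto
    then show False by simp
  qed
  have wint: "w (of_int a) = w (of_nat p) ^ multiplicity (int p) a" if a0: "a \<noteq> 0" for a
  proof -
    have "\<not> is_unit (int p)" using p1 by simp
    then obtain m where m: "a = int p ^ multiplicity (int p) a * m" "\<not> int p dvd m"
      using multiplicity_decompose'[OF a0 \<open>\<not> is_unit (int p)\<close>] by blast
    have "w (of_int a) = w (of_nat p ^ multiplicity (int p) a * of_int m)"
      by (subst m(1)) simp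
    also have "\<dots> = w (of_nat p) ^ multiplicity (int p) a"
      using coprime_1[OF m(2)] nat_K int_K rsa_power[OF K] by (simp add: av_mult av_power)
    finally show ?thesis .
  qed
  define s where "s = - ln p / ln (w (of_nat p))"
  have "p > 1" using p0 p1 by simp
  then have s: "s > 0" using wp0 wp1 by (simp add: s_def divide_pos_neg)
  have wps: "w (of_nat p) powr s = inverse (real p)"
    using wp0 wp1 p0 by (simp add: powr_def s_def exp_minus)
  have "w (of_rat q) powr s = padic_abs p q" for q
  proof (cases "q = 0")
    case False
    obtain a b where ab: "quotient_of q = (a, b)" by fastforce
    have b: "b > 0" "q = of_int a / of_int b"
      using quotient_of_denom_pos[OF ab] quotient_of_div[OF ab] by auto
    then have a: "a \<noteq> 0" using False by auto
    let ?i = "multiplicity (int p) a" and ?j = "multiplicity (int p) b"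
    have pw: "(w (of_nat p) ^ n) powr s = (w (of_nat p) powr s) ^ n" for n
      using wp0 by (simp add: powr_powr mult.commute flip: powr_realpow)
    have "w (of_rat q) = w (of_nat p) ^ ?i / w (of_nat p) ^ ?j"
      using a b(1) unfolding av_of_rat[OF ab] by (simp add: wint)
    then have "w (of_rat q) powr s = (w (of_nat p) powr s) ^ ?i / (w (of_nat p) powr s) ^ ?j"
      using wp0 by (simp add: powr_divide pw)
    also have "\<dots> = real p powi (int ?j - int ?i)"
      using p0 by (simp add: wps power_int_diff field_simps)
    finally show ?thesis using False by (simp add: padic_abs_def ab)
  qed (simp add: padic_abs_def av_0)
  then show ?thesis using s prime that by blast
qed

end

section \<open>Existence and uniqueness of the normalisation\<close>

lemma padic_abs_of_nat_le_1: "Factorial_Ring.prime p \<Longrightarrow> padic_abs p (of_nat n) \<le> 1"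
proof -
  assume "Factorial_Ring.prime p"
  then have p: "p > 1" by (rule prime_gt_1_nat)
  have "quotient_of (of_nat n) = (int n, 1)" using quotient_of_int[of "int n"] by (simp add: Rat.of_int_def)
  then show ?thesis using p
    by (simp add: padic_abs_def power_int_minus field_simps)
qed

lemma padic_abs_of_prime:
  assumes "Factorial_Ring.prime p" "Factorial_Ring.prime r"
  shows "padic_abs p (of_nat r) = (if p = r then 1 / p else 1)"
proof -
  have "quotient_of (of_nat r) = (int r, 1)" using quotient_of_int[of "int r"] by (simp add: Rat.of_int_def)
  moreover have "multiplicity (int p) (int r) = (if p = r then 1 else 0)"
    using assms by (auto simp: prime_multiplicity_other)
  ultimately show ?thesis using assms prime_gt_0_nat[of r]
    by (auto simp: padic_abs_def power_int_minus field_simps)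
qed

text \<open>The usual absolute values are at most n at a natural number n, which is the condition
  for the power of w to be an absolute value again.\<close>

lemma normalised_abs_value_exists:
  assumes K: "rat_subalgebra K" "K \<subseteq> Qbar" and w: "w \<in> nontrivial_abs_values K"
  obtains s where "s > 0" "(\<lambda>x. w x powr s) \<in> nontrivial_abs_values K"
    "extends_usual_abs (\<lambda>x. w x powr s)"
proof (cases "\<exists>n. w (of_nat n) > 1")
  case True
  then obtain n where "w (of_nat n) > 1" by blast
  then obtain s where s: "s > 0" "\<And>q. w (of_rat q) powr s = real_of_rat \<bar>q\<bar>"
    using av_archimedean[OF K(1) w] by metis
  have "w (of_nat n) powr s \<le> real n" for n using s(2)[of "of_nat n"] by simp
  then show ?thesis using that s av_powr_nontrivial[OF K(1) w s(1)] by (auto simp: extends_usual_abs_def)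
next
  case False
  then have le: "w (of_nat n) \<le> 1" for n by (simp add: not_less)
  obtain s p where s: "s > 0" "Factorial_Ring.prime p" "\<And>q. w (of_rat q) powr s = padic_abs p q"
    using av_nonarchimedean[OF K(1) w K(2) le] by metis
  have "w (of_nat n) powr s \<le> real n" for n
    using s(3)[of "of_nat n"] padic_abs_of_nat_le_1[OF s(2), of n] by (cases "n = 0") (auto simp: padic_abs_def)
  then show ?thesis using that s av_powr_nontrivial[OF K(1) w s(1)] by (auto simp: extends_usual_abs_def)
qed

text \<open>If w is archimedean, w' exceeds 1 at 2 and cannot be p-adic; if w is p-adic, w' is below
  1 at p and must be p-adic for the same p. Comparing values at 2 or at p leaves s = 1.\<close>

lemma extends_usual_abs_exponent:
  assumes w: "extends_usual_abs w" "extends_usual_abs w'" and s: "s > 0"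
    and eq: "\<And>q. w' (of_rat q) = w (of_rat q) powr s"
  shows "s = 1"
proof -
  consider (inf) "\<And>q. w (of_rat q) = real_of_rat \<bar>q\<bar>"
    | (p) p where "Factorial_Ring.prime p" "\<And>q. w (of_rat q) = padic_abs p q"
    using w(1) by (auto simp: extends_usual_abs_def)
  then show ?thesis
  proof cases
    case inf
    then have 2: "w' (of_rat 2) = 2 powr s" using eq[of 2] inf[of 2] by simp
    have "w' (of_rat 2) = 2"
    proof (rule ccontr)
      assume "w' (of_rat 2) \<noteq> 2"
      then have "\<not> (\<forall>q. w' (of_rat q) = real_of_rat \<bar>q\<bar>)" by (auto intro!: exI[of _ 2])
      then obtain p where p: "Factorial_Ring.prime p" "\<forall>q. w' (of_rat q) = padic_abs p q"
        using w(2) unfolding extends_usual_abs_def by blast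
      then have "w' (of_rat 2) = padic_abs p (of_nat 2)" using p(2)[rule_format, of "of_nat 2"] by simp
      then have "2 powr s \<le> 1" using padic_abs_of_nat_le_1[OF p(1), of 2] 2 by simp
      moreover have "1 < (2::real) powr s" using s by (intro gr_one_powr) auto
      ultimately show False by linarith
    qed
    then have "(2::real) powr s = 2 powr 1" using 2 by simp
    then show ?thesis by (subst (asm) powr_inj) auto
  next
    case p
    have p1: "p > 1" by (rule prime_gt_1_nat[OF p(1)])
    have wp: "w' (of_rat (of_nat p)) = (1 / p) powr s" unfolding eq p(2) padic_abs_of_prime[OF p(1) p(1)] by simp
    also have "\<dots> < 1" using p1 s gr_one_powr[of "real p" s] by (simp add: powr_divide)
    finally have lt: "w' (of_rat (of_nat p)) < 1" .
    have "w' (of_rat (of_nat p)) = real p" if "\<forall>q. w' (of_rat q) = real_of_rat \<bar>q\<bar>"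
      using that[rule_format, of "of_nat p"] by simp
    then consider "w' (of_rat (of_nat p)) = real p" | r where "Factorial_Ring.prime r" "w' (of_rat (of_nat p)) = padic_abs r (of_nat p)"
      using w(2) unfolding extends_usual_abs_def by blast
    then have "w' (of_rat (of_nat p)) = 1 / p"
    proof cases
      case 1 then show ?thesis using lt p1 by simp
    next
      case 2 then show ?thesis using lt padic_abs_of_prime[OF 2(1) p(1)] by (auto split: if_splits)
    qed
    then have "(1 / real p) powr s = (1 / real p) powr 1" using wp by simp
    then show ?thesis using p1 by (subst (asm) powr_inj) auto
  qed
qed

section \<open>Places of a number field\<close>

lemma abs_value_equiv_cong:
  assumes "w \<in> nontrivial_abs_values K" "\<And>x. x \<in> K \<Longrightarrow> w' x = w x"
    and K: "rat_subalgebra K"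
  shows "(w, w') \<in> abs_value_equiv K"
proof -
  have "w' \<in> nontrivial_abs_values K"
    using assms(1,2) rsa_add[OF K] rsa_mult[OF K] unfolding nontrivial_abs_values_def by auto
  moreover have "w' x = w x powr 1" if "x \<in> K" for x
    using assms(1,2) that by (simp add: nontrivial_abs_values_def)
  ultimately show ?thesis using assms(1) by (auto simp: abs_value_equiv_def intro!: exI[of _ 1])
qed

lemma equiv_abs_value_equiv:
  assumes K: "rat_subalgebra K"
  shows "equiv (nontrivial_abs_values K) (abs_value_equiv K)"
proof (rule equivI)
  show "abs_value_equiv K \<subseteq> nontrivial_abs_values K \<times> nontrivial_abs_values K"
    by (auto simp: abs_value_equiv_def)
  show "refl_on (nontrivial_abs_values K) (abs_value_equiv K)"
    using abs_value_equiv_cong[OF _ _ K] by (auto simp: refl_on_def)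
  show "sym (abs_value_equiv K)"
  proof (rule symI)
    fix w w' assume "(w, w') \<in> abs_value_equiv K"
    then obtain s where s: "s > 0" "\<And>x. x \<in> K \<Longrightarrow> w' x = w x powr s"
      and w: "w \<in> nontrivial_abs_values K" "w' \<in> nontrivial_abs_values K"
      by (auto simp: abs_value_equiv_def)
    have "w x = w' x powr (1 / s)" if "x \<in> K" for x
      using s that av_nonneg[OF K w(1) that] by (simp add: powr_powr)
    then show "(w', w) \<in> abs_value_equiv K"
      using s(1) w by (auto simp: abs_value_equiv_def intro!: exI[of _ "1 / s"])
  qed
  show "trans (abs_value_equiv K)"
  proof (rule transI)
    fix w w' w'' assume "(w, w') \<in> abs_value_equiv K" "(w', w'') \<in> abs_value_equiv K"
    then obtain s t where st: "s > 0" "\<And>x. x \<in> K \<Longrightarrow> w' x = w x powr s"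
      "t > 0" "\<And>x. x \<in> K \<Longrightarrow> w'' x = w' x powr t"
      and w: "w \<in> nontrivial_abs_values K" "w'' \<in> nontrivial_abs_values K"
      by (auto simp: abs_value_equiv_def)
    then show "(w, w'') \<in> abs_value_equiv K"
      by (auto simp: abs_value_equiv_def powr_powr intro!: exI[of _ "s * t"])
  qed
qed

lemma placesE:
  assumes K: "rat_subalgebra K" "K \<subseteq> Qbar" and v: "v \<in> places K"
  obtains w where "w \<in> nontrivial_abs_values K" "extends_usual_abs w" "v = abs_value_equiv K `` {w}"
    "w \<in> v"
proof -
  obtain w where w: "w \<in> nontrivial_abs_values K" "v = abs_value_equiv K `` {w}"
    using v by (auto simp: places_def elim: quotientE)
  obtain s where s: "s > 0" "(\<lambda>x. w x powr s) \<in> nontrivial_abs_values K"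
    "extends_usual_abs (\<lambda>x. w x powr s)"
    using normalised_abs_value_exists[OF K w(1)] .
  have "(w, \<lambda>x. w x powr s) \<in> abs_value_equiv K"
    using w s by (auto simp: abs_value_equiv_def)
  then have "(\<lambda>x. w x powr s) \<in> v" "v = abs_value_equiv K `` {\<lambda>x. w x powr s}"
    using w(2) equiv_class_eq[OF equiv_abs_value_equiv[OF K(1)]] by auto
  then show ?thesis using s that by blast
qed

lemma normalised_eq:
  assumes "(w, w') \<in> abs_value_equiv K" "extends_usual_abs w" "extends_usual_abs w'"
    and K: "rat_subalgebra K" and x: "x \<in> K"
  shows "w' x = w x"
proof -
  obtain s where s: "s > 0" "\<And>x. x \<in> K \<Longrightarrow> w' x = w x powr s" and w: "w \<in> nontrivial_abs_values K"
    using assms(1) by (auto simp: abs_value_equiv_def)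
  then have "s = 1"
    using extends_usual_abs_exponent[OF assms(2,3) s(1)] rsa_rat[OF K] by auto
  then show ?thesis using s(2)[OF x] av_nonneg[OF K w x] by simp
qed

lemma places_memD:
  assumes K: "rat_subalgebra K" and "v \<in> places K" "w \<in> v"
  shows "w \<in> nontrivial_abs_values K" "v = abs_value_equiv K `` {w}"
proof -
  obtain w0 where w0: "w0 \<in> nontrivial_abs_values K" "v = abs_value_equiv K `` {w0}"
    using assms by (auto simp: places_def elim: quotientE)
  then have "(w0, w) \<in> abs_value_equiv K" using assms by auto
  then show "w \<in> nontrivial_abs_values K" "v = abs_value_equiv K `` {w}"
    using w0 equiv_class_eq[OF equiv_abs_value_equiv[OF K]] by (auto simp: abs_value_equiv_def)
qed

text \<open>A multiplicative form of the fact that finitely many proper subspaces do not cover a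
  space. If \<alpha> works for D and \<beta> for d, then \<delta> maps
  \<open>\<alpha> ^ N * \<beta>\<close> to N \<delta>(\<alpha>) + \<delta>(\<beta>), which vanishes
  for at most one N, so some N suits all of the finitely many \<delta>.\<close>

lemma common_nonzero:
  fixes D :: "(complex \<Rightarrow> real) set"
  assumes K: "rat_subalgebra K" and "finite D"
    and hom: "\<And>\<delta> x y. \<delta> \<in> D \<Longrightarrow> x \<in> K - {0} \<Longrightarrow> y \<in> K - {0} \<Longrightarrow> \<delta> (x * y) = \<delta> x + \<delta> y"
    and nz: "\<And>\<delta>. \<delta> \<in> D \<Longrightarrow> \<exists>x\<in>K - {0}. \<delta> x \<noteq> 0"
  shows "\<exists>\<alpha>\<in>K - {0}. \<forall>\<delta>\<in>D. \<delta> \<alpha> \<noteq> 0"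
  using assms(2-)
proof (induction D rule: finite_induct)
  case empty
  then show ?case using rsa_1[OF K] by (intro bexI[of _ 1]) auto
next
  case (insert d D)
  have "\<exists>\<alpha>\<in>K - {0}. \<forall>\<delta>\<in>D. \<delta> \<alpha> \<noteq> 0"
    by (rule insert.IH; (rule insert.prems(1) | rule insert.prems(2)); (rule insertI2)?; assumption)
  then obtain \<alpha> where \<alpha>: "\<alpha> \<in> K - {0}" "\<And>\<delta>. \<delta> \<in> D \<Longrightarrow> \<delta> \<alpha> \<noteq> 0" by blast
  obtain \<beta> where \<beta>: "\<beta> \<in> K - {0}" "d \<beta> \<noteq> 0" using insert.prems(2)[OF insertI1] by blast
  have pK: "\<alpha> ^ N \<in> K - {0}" for N using \<alpha>(1) rsa_power[OF K] by auto
  have pow: "\<delta> (\<alpha> ^ N * \<beta>) = real N * \<delta> \<alpha> + \<delta> \<beta>" if "\<delta> \<in> insert d D" for \<delta> N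
  proof (induction N)
    case (Suc N)
    have "\<delta> (\<alpha> * (\<alpha> ^ N * \<beta>)) = \<delta> \<alpha> + \<delta> (\<alpha> ^ N * \<beta>)"
      using that \<alpha>(1) \<beta>(1) pK[of N] rsa_mult[OF K] by (intro insert.prems(1)) auto
    then show ?case using Suc by (simp add: algebra_simps)
  qed simp
  have "finite {N. real N * \<delta> \<alpha> + \<delta> \<beta> = 0}" if "\<delta> \<in> insert d D" for \<delta>
  proof (cases "\<delta> \<alpha> = 0")
    case True
    then have "\<delta> \<beta> \<noteq> 0" using that \<alpha>(2) \<beta>(2) by auto
    then show ?thesis using True by simp
  next
    case False
    have "{N. real N * \<delta> \<alpha> + \<delta> \<beta> = 0} \<subseteq> {nat \<lfloor>- \<delta> \<beta> / \<delta> \<alpha>\<rfloor>}"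
    proof
      fix N assume "N \<in> {N. real N * \<delta> \<alpha> + \<delta> \<beta> = 0}"
      then have "- \<delta> \<beta> / \<delta> \<alpha> = real N" using False by (simp add: field_simps add_eq_0_iff)
      then show "N \<in> {nat \<lfloor>- \<delta> \<beta> / \<delta> \<alpha>\<rfloor>}" by simp
    qed
    then show ?thesis by (rule finite_subset) simp
  qed
  then have "finite (\<Union>\<delta>\<in>insert d D. {N. real N * \<delta> \<alpha> + \<delta> \<beta> = 0})" using insert.hyps by blast
  then obtain N where "N \<notin> (\<Union>\<delta>\<in>insert d D. {N. real N * \<delta> \<alpha> + \<delta> \<beta> = 0})"
    using ex_new_if_finite infinite_UNIV_nat by blast
  then have "\<forall>\<delta>\<in>insert d D. \<delta> (\<alpha> ^ N * \<beta>) \<noteq> 0" using pow by auto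
  moreover have "\<alpha> ^ N * \<beta> \<in> K - {0}" using pK[of N] \<beta>(1) rsa_mult[OF K] by auto
  ultimately show ?case by blast
qed

text \<open>Up to a bounded factor, the absolute value of a root is therefore a slope of the Newton polygon,
  which depends on the pair \<open>(k, j)\<close> and the restriction of \<open>w\<close> to the rationals only.\<close>

lemma comparable_terms:
  assumes K: "rat_subalgebra K" and w: "w \<in> nontrivial_abs_values K"
    and c: "\<And>i. c i \<in> K" and b: "\<beta> \<in> K" "\<beta> \<noteq> 0"
    and sum: "(\<Sum>i\<le>n. c i * \<beta> ^ i) = 0" and nz: "i0 \<le> n" "c i0 \<noteq> 0"
  obtains k j where "k \<le> n" "j \<le> n" "k \<noteq> j" "0 < w (c k)" "0 < w (c j)"
    "w (c j) * w \<beta> ^ j \<le> w (c k) * w \<beta> ^ k" "w (c k) * w \<beta> ^ k \<le> real n * (w (c j) * w \<beta> ^ j)"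
proof -
  define t where "t i = w (c i) * w \<beta> ^ i" for i
  have wb: "w \<beta> > 0" using av_pos[OF K w b] .
  have tnn: "t i \<ge> 0" for i using wb av_nonneg[OF K w c] by (simp add: t_def)
  have tm: "w (c i * \<beta> ^ i) = t i" for i
    by (simp add: t_def av_mult[OF K w] av_power[OF K w] c b rsa_power[OF K])
  obtain k where k: "k \<le> n" "\<And>i. i \<le> n \<Longrightarrow> t i \<le> t k"
  proof -
    have "Max (t ` {..n}) \<in> t ` {..n}" by (rule Max_in) auto
    then obtain k where k: "k \<in> {..n}" "Max (t ` {..n}) = t k" by blast
    have "t i \<le> Max (t ` {..n})" if "i \<le> n" for i by (rule Max_ge) (use that in auto)
    then show ?thesis using k that by simp
  qed
  have "t i0 > 0" using av_pos[OF K w c nz(2)] wb by (simp add: t_def)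
  then have tk: "t k > 0" using k(2)[OF nz(1)] by simp
  \<comment> \<open>In a vanishing sum the largest term is cancelled by the n others, which cannot
    all be smaller than one n-th of it.\<close>
  have "\<exists>j. j \<le> n \<and> j \<noteq> k \<and> t k \<le> real n * t j"
  proof (rule ccontr)
    assume no: "\<not> ?thesis"
    have cK: "c i * \<beta> ^ i \<in> K" for i by (intro rsa_mult[OF K] rsa_power[OF K] c b)
    let ?S = "\<Sum>i\<in>{..n} - {k}. c i * \<beta> ^ i"
    have "c k * \<beta> ^ k + ?S = 0"
      using sum k(1) sum.remove[of "{..n}" k "\<lambda>i. c i * \<beta> ^ i"] by simp
    then have "c k * \<beta> ^ k = - ?S" by (simp only: eq_neg_iff_add_eq_0)
    then have "t k = w (- ?S)" using tm[of k] by simp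
    also have "\<dots> = w ?S" by (rule av_uminus[OF K w]) (rule rsa_sum[OF K], rule cK)
    also have "\<dots> \<le> (\<Sum>i\<in>{..n} - {k}. w (c i * \<beta> ^ i))" by (rule av_sum[OF K w]) (rule cK)
    finally have "t k \<le> (\<Sum>i\<in>{..n} - {k}. t i)" unfolding tm .
    moreover have "(\<Sum>i\<in>{..n} - {k}. t i) < t k"
    proof (cases "n = 0")
      case True then show ?thesis using k(1) tk by simp
    next
      case False
      have "(\<Sum>i\<in>{..n} - {k}. t i) < of_nat (card ({..n} - {k})) * (t k / n)"
      proof (rule sum_bounded_above_strict)
        fix i assume "i \<in> {..n} - {k}"
        then have "real n * t i < t k" using no by auto
        then show "t i < t k / n" using False by (simp add: field_simps)
      next
        show "card ({..n} - {k}) > 0" using False k(1) by simp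
      qed
      also have "\<dots> = t k" using False k(1) by simp
      finally show ?thesis .
    qed
    ultimately show False by simp
  qed
  then obtain j where j: "j \<le> n" "j \<noteq> k" "t k \<le> real n * t j" by blast
  have "t j > 0"
  proof (rule ccontr)
    assume "\<not> t j > 0"
    then have "t j = 0" using tnn[of j] by simp
    then show False using j(3) tk by simp
  qed
  then show ?thesis
    using that[of k j] k j tk wb by (auto simp: t_def zero_less_mult_iff)
qed

text \<open>Pigeonhole on slopes. Among too many extensions, choose \<beta> on which they differ
  pairwise by a factor above n + 1. Its rational polynomial, of degree at most n, assigns to each
  extension a pair of comparable terms; a shared pair would force the two values at \<beta> to
  within a factor n.\<close>

lemma finite_extensions_of_rat_abs:
  assumes K: "number_field K"
  shows "finite {v \<in> places K. \<exists>w\<in>v. \<forall>q. w (of_rat q) = u q}" (is "finite ?V")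
proof (rule ccontr)
  assume inf: "infinite ?V"
  note A = number_field_rsa[OF K]
  obtain B where B: "finite B" "K \<subseteq> qv.span B" using K by (auto simp: number_field_iff)
  define n where "n = card B"
  \<comment> \<open>One more than the number of pairs (k, j) with entries at most n.\<close>
  obtain V where V: "V \<subseteq> ?V" "finite V" "card V = Suc ((n + 1) * (n + 1))"
    using infinite_arbitrarily_large[OF inf] by blast
  have "\<forall>v\<in>V. \<exists>w. w \<in> v \<and> (\<forall>q. w (of_rat q) = u q)" using V by blast
  then obtain W where W: "\<And>v. v \<in> V \<Longrightarrow> W v \<in> v" "\<And>v q. v \<in> V \<Longrightarrow> W v (of_rat q) = u q"
    by metis
  have av: "W v \<in> nontrivial_abs_values K" "v = abs_value_equiv K `` {W v}" if "v \<in> V" for v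
    using places_memD[OF A, of v "W v"] W(1)[OF that] that V(1) by auto
  \<comment> \<open>A homomorphism to the reals on nonzero elements, not identically zero for
    distinct places; large powers of an element on which all these are nonzero separate the places
    arbitrarily far.\<close>
  define d where "d = (\<lambda>(v, v') x. ln (W v x) - ln (W v' x))"
  define P where "P = {(v, v'). v \<in> V \<and> v' \<in> V \<and> v \<noteq> v'}"
  have "P \<subseteq> V \<times> V" by (auto simp: P_def)
  then have finP: "finite P" using V(2) finite_subset by blast
  have hom: "d a (x * y) = d a x + d a y" if "a \<in> P" "x \<in> K - {0}" "y \<in> K - {0}" for a x y
  proof -
    obtain v v' where a: "a = (v, v')" "v \<in> V" "v' \<in> V" using \<open>a \<in> P\<close> by (auto simp: P_def)
    have "W v x > 0" "W v y > 0" "W v' x > 0" "W v' y > 0"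
      using that a av_pos[OF A av(1)] by auto
    then show ?thesis using that a
      by (simp add: d_def av_mult[OF A av(1)] ln_mult)
  qed
  have "\<exists>\<alpha>\<in>K - {0}. \<forall>\<delta>\<in>d ` P. \<delta> \<alpha> \<noteq> 0"
  proof (rule common_nonzero[OF A])
    fix \<delta> assume "\<delta> \<in> d ` P"
    then obtain v v' where vv: "v \<in> V" "v' \<in> V" "v \<noteq> v'" "\<delta> = d (v, v')" by (auto simp: P_def)
    show "\<exists>x\<in>K - {0}. \<delta> x \<noteq> 0"
    proof (rule ccontr)
      assume no: "\<not> ?thesis"
      have "W v' x = W v x" if "x \<in> K" for x
      proof (cases "x = 0")
        case False
        then have "ln (W v x) = ln (W v' x)" using no that by (auto simp: vv d_def)
        then show ?thesis using av_pos[OF A av(1)[OF vv(1)] that False] av_pos[OF A av(1)[OF vv(2)] that False] by simp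
      qed (simp add: av_0[OF A av(1)] vv)
      then have "(W v, W v') \<in> abs_value_equiv K"
        using abs_value_equiv_cong[OF av(1)[OF vv(1)] _ A] by blast
      then have "v = v'"
        using av(2)[OF vv(1)] av(2)[OF vv(2)] equiv_class_eq[OF equiv_abs_value_equiv[OF A]] by metis
      then show False using vv by simp
    qed
  qed (use finP hom in auto)
  then obtain \<alpha> where \<alpha>: "\<alpha> \<in> K" "\<alpha> \<noteq> 0" "\<And>a. a \<in> P \<Longrightarrow> d a \<alpha> \<noteq> 0" by auto
  have dpow: "d a (\<alpha> ^ N) = real N * d a \<alpha>" if "a \<in> P" for a N
    using that av_pos[OF A av(1) \<alpha>(1,2)] by (auto simp: d_def P_def av_power[OF A av(1) \<alpha>(1)] ln_realpow algebra_simps)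
  have "\<forall>a\<in>P. \<exists>N0. \<forall>N\<ge>N0. \<bar>d a (\<alpha> ^ N)\<bar> > ln (real n + 1)"
  proof
    fix a assume a: "a \<in> P"
    obtain N0 :: nat where "ln (real n + 1) < N0 * \<bar>d a \<alpha>\<bar>" using reals_Archimedean3[of "\<bar>d a \<alpha>\<bar>"] \<alpha>(3)[OF a] by auto
    then have "ln (real n + 1) < N * \<bar>d a \<alpha>\<bar>" if "N \<ge> N0" for N
      using mult_right_mono[of "real N0" "real N" "\<bar>d a \<alpha>\<bar>"] that by simp
    then show "\<exists>N0. \<forall>N\<ge>N0. \<bar>d a (\<alpha> ^ N)\<bar> > ln (real n + 1)"
      using dpow[OF a] by (auto simp: abs_mult)
  qed
  then obtain N0 where N0: "\<And>a N. a \<in> P \<Longrightarrow> N \<ge> N0 a \<Longrightarrow> \<bar>d a (\<alpha> ^ N)\<bar> > ln (real n + 1)" by metis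
  \<comment> \<open>A sum of natural numbers serves as a common upper bound of the
    thresholds.\<close>
  define N where "N = (\<Sum>a\<in>P. N0 a)"
  define \<beta> where "\<beta> = \<alpha> ^ N"
  have sep: "\<bar>ln (W v \<beta>) - ln (W v' \<beta>)\<bar> > ln (real n + 1)" if "v \<in> V" "v' \<in> V" "v \<noteq> v'" for v v'
  proof -
    have p: "(v, v') \<in> P" using that by (simp add: P_def)
    then have "N0 (v, v') \<le> N" unfolding N_def by (intro member_le_sum) (use finP in auto)
    then show ?thesis using N0[OF p] by (simp add: \<beta>_def d_def)
  qed
  have \<beta>: "\<beta> \<in> K" "\<beta> \<noteq> 0" using \<alpha> rsa_power[OF A] by (auto simp: \<beta>_def)
  obtain p where p: "p \<noteq> 0" "\<And>i. coeff p i \<in> \<rat>" "degree p \<le> n" "poly p \<beta> = 0"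
    using finite_rsa_poly[OF A B \<beta>(1)] unfolding n_def by blast
  have "\<forall>i. \<exists>q. coeff p i = of_rat q" using p(2) by (auto elim: Rats_cases)
  then obtain c where c: "\<And>i. coeff p i = of_rat (c i)" by metis
  have sum0: "(\<Sum>i\<le>n. coeff p i * \<beta> ^ i) = 0"
  proof -
    have "(\<Sum>i\<le>n. coeff p i * \<beta> ^ i) = (\<Sum>i\<le>degree p. coeff p i * \<beta> ^ i)"
      by (rule sum.mono_neutral_right) (use p(3) in \<open>auto simp: coeff_eq_0\<close>)
    then show ?thesis using p(4) by (simp add: poly_altdef)
  qed
  let ?R = "\<lambda>v kj. fst kj \<le> n \<and> snd kj \<le> n \<and> fst kj \<noteq> snd kj \<and> 0 < u (c (fst kj)) \<and> 0 < u (c (snd kj)) \<and>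
     u (c (snd kj)) * W v \<beta> ^ snd kj \<le> u (c (fst kj)) * W v \<beta> ^ fst kj \<and>
     u (c (fst kj)) * W v \<beta> ^ fst kj \<le> real n * (u (c (snd kj)) * W v \<beta> ^ snd kj)"
  have "\<forall>v\<in>V. \<exists>kj. ?R v kj"
  proof
    fix v assume v: "v \<in> V"
    have "coeff p i \<in> K" for i using p(2) rsa_rat[OF A] by blast
    moreover have "coeff p (degree p) \<noteq> 0" using p(1) by simp
    ultimately obtain k j where "k \<le> n" "j \<le> n" "k \<noteq> j" "0 < W v (coeff p k)" "0 < W v (coeff p j)"
      "W v (coeff p j) * W v \<beta> ^ j \<le> W v (coeff p k) * W v \<beta> ^ k"
      "W v (coeff p k) * W v \<beta> ^ k \<le> real n * (W v (coeff p j) * W v \<beta> ^ j)"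
      using comparable_terms[OF A av(1)[OF v] _ \<beta> sum0 p(3)] by blast
    then show "\<exists>kj. ?R v kj"
      unfolding c W(2)[OF v] by (intro exI[of _ "(k, j)"]) simp
  qed
  then obtain g where g: "\<And>v. v \<in> V \<Longrightarrow> ?R v (g v)" by metis
  \<comment> \<open>The coefficients are rational, so their absolute values are given by u; in the
    logarithmic inequalities v enters only through \<open>W v \<beta>\<close>.\<close>
  have slope: "0 \<le> ln (u (c k)) - ln (u (c j)) + (real k - real j) * ln (W v \<beta>)"
    "ln (u (c k)) - ln (u (c j)) + (real k - real j) * ln (W v \<beta>) \<le> ln (real n)" "n > 0"
    if v: "v \<in> V" "g v = (k, j)" for v k j
  proof -
    have kj: "k \<le> n" "j \<le> n" "k \<noteq> j" "0 < u (c k)" "0 < u (c j)"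
     "u (c j) * W v \<beta> ^ j \<le> u (c k) * W v \<beta> ^ k"
     "u (c k) * W v \<beta> ^ k \<le> real n * (u (c j) * W v \<beta> ^ j)"
      using g[OF v(1)] v(2) by auto
    show n: "n > 0" using kj by linarith
    have wb: "W v \<beta> > 0" using av_pos[OF A av(1)[OF v(1)] \<beta>] .
    have "ln (u (c j) * W v \<beta> ^ j) \<le> ln (u (c k) * W v \<beta> ^ k)"
      using kj wb by (subst ln_le_cancel_iff) auto
    then show "0 \<le> ln (u (c k)) - ln (u (c j)) + (real k - real j) * ln (W v \<beta>)"
      using kj wb by (simp add: ln_mult ln_realpow algebra_simps)
    have "ln (u (c k) * W v \<beta> ^ k) \<le> ln (real n * (u (c j) * W v \<beta> ^ j))"
      using kj wb n by (subst ln_le_cancel_iff) auto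
    then show "ln (u (c k)) - ln (u (c j)) + (real k - real j) * ln (W v \<beta>) \<le> ln (real n)"
      using kj wb n by (simp add: ln_mult ln_realpow algebra_simps)
  qed
  have "inj_on g V"
  proof (rule inj_onI, rule ccontr)
    fix v v' assume vv: "v \<in> V" "v' \<in> V" "g v = g v'" "v \<noteq> v'"
    obtain k j where kj: "g v = (k, j)" by fastforce
    have ne: "k \<noteq> j" using g[OF vv(1)] kj by auto
    define D where "D = ln (W v \<beta>) - ln (W v' \<beta>)"
    have "\<bar>(real k - real j) * D\<bar> \<le> ln (real n)"
      using slope[OF vv(1) kj] slope[OF vv(2), of k j] kj vv(3) by (auto simp: D_def algebra_simps abs_le_iff)
    moreover have "1 \<le> \<bar>real k - real j\<bar>" using ne by linarith
    then have "1 * \<bar>D\<bar> \<le> \<bar>real k - real j\<bar> * \<bar>D\<bar>" by (rule mult_right_mono) simp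
    ultimately have "\<bar>D\<bar> \<le> ln (real n)" by (simp add: abs_mult)
    also have "\<dots> \<le> ln (real n + 1)" using slope(3)[OF vv(1) kj] by simp
    finally show False using sep[OF vv(1,2,4)] by (simp add: D_def)
  qed
  then have "card V \<le> card ({..n} \<times> {..n})"
  proof (rule card_inj_on_le)
    show "g ` V \<subseteq> {..n} \<times> {..n}"
    proof
      fix y assume "y \<in> g ` V"
      then obtain v where "v \<in> V" "y = g v" by blast
      then show "y \<in> {..n} \<times> {..n}" using g[of v] by (simp add: mem_Times_iff)
    qed
  qed simp
  then show False using V(3) by (simp add: card_cartesian_product)
qed

lemma countable_places:
  assumes K: "number_field K"
  shows "countable (places K)"
proof -
  define U where "U = insert (\<lambda>q. real_of_rat \<bar>q\<bar>) (range padic_abs)"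
  have "places K \<subseteq> (\<Union>u\<in>U. {v \<in> places K. \<exists>w\<in>v. \<forall>q. w (of_rat q) = u q})"
  proof
    fix v assume v: "v \<in> places K"
    obtain w where "extends_usual_abs w" "w \<in> v"
      using placesE[OF number_field_rsa[OF K] number_field_Qbar[OF K] v] by metis
    then show "v \<in> (\<Union>u\<in>U. {v \<in> places K. \<exists>w\<in>v. \<forall>q. w (of_rat q) = u q})"
      using v by (auto simp: extends_usual_abs_def U_def)
  qed
  moreover have "countable (\<Union>u\<in>U. {v \<in> places K. \<exists>w\<in>v. \<forall>q. w (of_rat q) = u q})"
    using finite_extensions_of_rat_abs[OF K] by (intro countable_UN) (auto simp: U_def intro: countable_finite)
  ultimately show ?thesis by (rule countable_subset)
qed

section \<open>Normalised representatives on the space of places\<close>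

lemma place_abs_props:
  shows "place_abs y \<in> Rep_place y" "extends_usual_abs (place_abs y)"
    "place_abs y \<in> nontrivial_abs_values Qbar" "Rep_place y = abs_value_equiv Qbar `` {place_abs y}"
proof -
  have y: "Rep_place y \<in> places Qbar" by (rule Rep_place)
  obtain w where "w \<in> Rep_place y" "extends_usual_abs w"
    using placesE[OF rsa_Qbar order_refl y] by metis
  then have "\<exists>w. w \<in> Rep_place y \<and> extends_usual_abs w" by blast
  from someI_ex[OF this] show *: "place_abs y \<in> Rep_place y" "extends_usual_abs (place_abs y)"
    by (simp_all add: place_abs_def)
  show "place_abs y \<in> nontrivial_abs_values Qbar" "Rep_place y = abs_value_equiv Qbar `` {place_abs y}"
    using places_memD[OF rsa_Qbar y *(1)] .
qed

text \<open>Nontriviality is already visible at a natural number, which belongs to every M.\<close>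

lemma abs_value_restrict_nontrivial:
  assumes "w \<in> nontrivial_abs_values Qbar" "rat_subalgebra M" "M \<subseteq> Qbar"
  shows "w \<in> nontrivial_abs_values M"
proof -
  obtain n :: nat where "n > 0" "w (of_nat n) \<noteq> 1"
    using av_nontrivial_on_Rats[OF rsa_Qbar assms(1) order_refl] by blast
  then show ?thesis
    using rsa_rat[OF assms(2), of "of_nat n"]
    by (intro abs_value_restrict[OF assms(1,3)] bexI[of _ "of_nat n"]) auto
qed

text \<open>A map from Y to the places of M; its fibres are the sets Y(M,v), by
  \<open>Y_over_eq\<close>.\<close>

definition place_below :: "complex set \<Rightarrow> place \<Rightarrow> (complex \<Rightarrow> real) set" where
  "place_below M y = abs_value_equiv M `` {place_abs y}"

context
  fixes M assumes M: "number_field M"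
begin

lemma place_abs_nontrivial: "place_abs y \<in> nontrivial_abs_values M"
  using abs_value_restrict_nontrivial[OF place_abs_props(3) number_field_rsa[OF M] number_field_Qbar[OF M]] .

lemma place_below_places: "place_below M y \<in> places M"
  unfolding places_def place_below_def by (rule quotientI) (rule place_abs_nontrivial)

lemma place_abs_in_place_below: "place_abs y \<in> place_below M y"
  unfolding place_below_def
  using equiv_class_self[OF equiv_abs_value_equiv[OF number_field_rsa[OF M]] place_abs_nontrivial] .

lemma Rep_place_subset_place_below: "Rep_place y \<subseteq> place_below M y"
proof
  fix w assume "w \<in> Rep_place y"
  then have "(place_abs y, w) \<in> abs_value_equiv Qbar" using place_abs_props(4) by auto
  then obtain s where "s > 0" "\<forall>x\<in>Qbar. w x = place_abs y x powr s" "w \<in> nontrivial_abs_values Qbar"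
    by (auto simp: abs_value_equiv_def)
  then show "w \<in> place_below M y"
    using number_field_Qbar[OF M] place_abs_nontrivial[of y]
      abs_value_restrict_nontrivial[OF _ number_field_rsa[OF M] number_field_Qbar[OF M], of w]
    by (auto simp: place_below_def abs_value_equiv_def)
qed

lemma Y_over_eq:
  assumes v: "v \<in> places M"
  shows "Y_over M v = {y. place_below M y = v}"
proof -
  have "place_below M y = v" if "Rep_place y \<subseteq> v" for y
    using places_memD(2)[OF number_field_rsa[OF M] v, of "place_abs y"] that place_abs_props(1)[of y]
    by (auto simp: place_below_def)
  then show ?thesis using Rep_place_subset_place_below by (auto simp: Y_over_def)
qed

text \<open>This descends the function of \<alpha> in M to the places of M; the choice is harmless
  because normalised representatives agree on M.\<close>

definition log_abs_below :: "complex \<Rightarrow> (complex \<Rightarrow> real) set \<Rightarrow> real" where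
  "log_abs_below \<alpha> v = ln ((SOME w. w \<in> v \<and> extends_usual_abs w) \<alpha>)"

lemma log_abs_eq_below:
  assumes "\<alpha> \<in> M" shows "log_abs \<alpha> y = log_abs_below \<alpha> (place_below M y)"
proof -
  define w where "w = (SOME w. w \<in> place_below M y \<and> extends_usual_abs w)"
  have "w \<in> place_below M y \<and> extends_usual_abs w"
    unfolding w_def
    by (rule someI[of "\<lambda>w. w \<in> place_below M y \<and> extends_usual_abs w" "place_abs y"])
       (simp add: place_abs_in_place_below place_abs_props(2))
  then have "w \<alpha> = place_abs y \<alpha>"
    using normalised_eq[of "place_abs y" w M \<alpha>] place_abs_props(2) number_field_rsa[OF M] assms
    by (auto simp: place_below_def)
  then show ?thesis by (simp add: log_abs_def log_abs_below_def w_def)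
qed

end

section \<open>The functions of algebraic numbers as a rational vector space\<close>

lemma log_abs_mult:
  assumes "\<alpha> \<in> Qbar - {0}" "\<beta> \<in> Qbar - {0}"
  shows "log_abs (\<alpha> * \<beta>) = log_abs \<alpha> + log_abs \<beta>"
proof
  fix y
  have "place_abs y \<alpha> > 0" "place_abs y \<beta> > 0"
    using assms av_pos[OF rsa_Qbar place_abs_props(3)] by auto
  then show "log_abs (\<alpha> * \<beta>) y = (log_abs \<alpha> + log_abs \<beta>) y"
    using assms by (simp add: log_abs_def av_mult[OF rsa_Qbar place_abs_props(3)] ln_mult)
qed

lemma log_abs_1: "log_abs 1 = 0"
  by (simp add: log_abs_def fun_eq_iff av_1[OF rsa_Qbar place_abs_props(3)])

lemma log_abs_prod: "(\<And>i. i \<in> I \<Longrightarrow> f i \<in> Qbar - {0}) \<Longrightarrow> log_abs (prod f I) = (\<Sum>i\<in>I. log_abs (f i))"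
proof (induction I rule: infinite_finite_induct)
  case (insert x F)
  have "prod f F \<in> Qbar" using insert by (intro rsa_prod[OF rsa_Qbar]) auto
  moreover have "prod f F \<noteq> 0" using insert by (auto simp: prod_zero_iff)
  ultimately show ?case using insert by (simp add: log_abs_mult)
qed (auto simp: log_abs_1)

lemma log_abs_power:
  assumes "\<alpha> \<in> Qbar - {0}"
  shows "log_abs (\<alpha> ^ n) = ratscale (of_nat n) (log_abs \<alpha>)"
proof (induction n)
  case (Suc n)
  have "\<alpha> ^ n \<in> Qbar - {0}" using assms rsa_power[OF rsa_Qbar] by auto
  then show ?case
    using Suc assms by (simp add: log_abs_mult ratscale_def fun_eq_iff algebra_simps of_rat_add)
qed (simp add: log_abs_1 ratscale_def fun_eq_iff)

lemma log_abs_inverse: "\<alpha> \<in> Qbar - {0} \<Longrightarrow> log_abs (inverse \<alpha>) = - log_abs \<alpha>"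
  using log_abs_mult[of \<alpha> "inverse \<alpha>"] Qbar_inverse[of \<alpha>] by (auto simp: log_abs_1 eq_neg_iff_add_eq_0 add.commute)

text \<open>Sums, negatives and integral multiples of functions come from products, inverses and
  powers of numbers. Division by n comes from an n-th root, which exists among the algebraic
  numbers.\<close>

lemma alg_space_subspace: "ratfun.subspace alg_space"
proof -
  have add: "f + g \<in> alg_space" if "f \<in> alg_space" "g \<in> alg_space" for f g
    using that rsa_mult[OF rsa_Qbar] by (auto simp: alg_space_def log_abs_mult[symmetric])
  have zero: "0 \<in> alg_space"
    using log_abs_1 rsa_1[OF rsa_Qbar] by (auto simp: alg_space_def intro!: image_eqI[of _ _ 1])
  have pow: "ratscale (of_nat n) f \<in> alg_space" if "f \<in> alg_space" for f n
    using that rsa_power[OF rsa_Qbar] by (auto simp: alg_space_def log_abs_power[symmetric])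
  have neg: "- f \<in> alg_space" if "f \<in> alg_space" for f
    using that Qbar_inverse by (auto simp: alg_space_def log_abs_inverse[symmetric])
  have root: "ratscale (1 / of_nat n) f \<in> alg_space" if f: "f \<in> alg_space" and n: "n > 0" for f n
  proof -
    obtain \<alpha> where \<alpha>: "\<alpha> \<in> Qbar" "\<alpha> \<noteq> 0" "f = log_abs \<alpha>" using f by (auto simp: alg_space_def)
    have d: "degree (monom 1 n + [:- \<alpha>:]) = n"
      using n by (simp add: degree_add_eq_left degree_monom_eq)
    obtain \<beta> where "poly (monom 1 n + [:- \<alpha>:]) \<beta> = 0"
      using complex_poly_root_exists[of "monom 1 n + [:- \<alpha>:]"] d n by auto
    then have \<beta>: "\<beta> ^ n = \<alpha>" by (simp add: poly_monom)
    \<comment> \<open>If p vanishes at \<alpha>, then p(X^n) vanishes at \<beta>.\<close>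
    have "\<beta> \<in> Qbar"
    proof -
      obtain p where p: "\<And>i. coeff p i \<in> \<rat>" "p \<noteq> 0" "poly p \<alpha> = 0"
        using \<alpha>(1) unfolding Qbar_def algebraic_altdef by blast
      have "poly (pcompose p (monom 1 n)) \<beta> = 0" using p(3) \<beta> by (simp add: poly_pcompose poly_monom)
      moreover have "pcompose p (monom 1 n) \<noteq> 0" using p(2) n by (simp add: pcompose_eq_0_iff degree_monom_eq)
      moreover have "coeff (pcompose p (monom 1 n)) i \<in> \<rat>" for i
        using p(1) by (intro coeff_pcompose_semiring_closed) auto
      ultimately show ?thesis unfolding Qbar_def algebraic_altdef by blast
    qed
    moreover have "\<beta> \<noteq> 0" using \<beta> \<alpha> n by auto
    ultimately have "f = ratscale (of_nat n) (log_abs \<beta>)" "log_abs \<beta> \<in> alg_space"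
      using \<beta> \<alpha> log_abs_power[of \<beta> n] by (auto simp: alg_space_def)
    then show ?thesis using n by (simp add: ratscale_def fun_eq_iff of_rat_divide)
  qed
  have "ratscale q f \<in> alg_space" if f: "f \<in> alg_space" for q f
  proof -
    obtain a b where ab: "quotient_of q = (a, b)" by fastforce
    have b: "b > 0" "q = of_int a / of_int b"
      using quotient_of_denom_pos[OF ab] quotient_of_div[OF ab] by auto
    have g: "ratscale (of_nat (nat \<bar>a\<bar>)) (ratscale (1 / of_nat (nat b)) f) \<in> alg_space"
      using b(1) f by (intro pow root) auto
    show ?thesis
    proof (cases "a \<ge> 0")
      case True
      then have "ratscale (of_nat (nat \<bar>a\<bar>)) (ratscale (1 / of_nat (nat b)) f) = ratscale q f"
        using b by (simp add: ratscale_def fun_eq_iff of_rat_divide of_rat_mult)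
      then show ?thesis using g by (simp only:)
    next
      case False
      then have "- ratscale (of_nat (nat \<bar>a\<bar>)) (ratscale (1 / of_nat (nat b)) f) = ratscale q f"
        using b by (simp add: ratscale_def fun_eq_iff of_rat_divide of_rat_mult of_rat_minus)
      then show ?thesis using neg[OF g] by (simp only:)
    qed
  qed
  then show ?thesis using add zero by (simp add: ratfun.subspace_def)
qed

section \<open>The Galois action on places\<close>

lemma comp_abs_galois_equiv:
  assumes s: "\<sigma> \<in> abs_galois" and K: "\<sigma> ` K = K" and A: "rat_subalgebra K" "K \<subseteq> Qbar"
  shows "w \<circ> \<sigma> \<in> nontrivial_abs_values K \<longleftrightarrow> w \<in> nontrivial_abs_values K"
    "(w \<circ> \<sigma>, w' \<circ> \<sigma>) \<in> abs_value_equiv K \<longleftrightarrow> (w, w') \<in> abs_value_equiv K"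
proof -
  have h: "\<And>x y. x \<in> K \<Longrightarrow> y \<in> K \<Longrightarrow> \<sigma> (x + y) = \<sigma> x + \<sigma> y"
     "\<And>x y. x \<in> K \<Longrightarrow> y \<in> K \<Longrightarrow> \<sigma> (x * y) = \<sigma> x * \<sigma> y"
    using abs_galois_hom[OF s] A(2) by (auto simp: rat_hom_on_def subset_iff)
  have 0: "\<sigma> x = 0 \<longleftrightarrow> x = 0" for x
    using hom_0[OF rsa_Qbar abs_galois_hom[OF s]] bij_is_inj[OF abs_galoisD(1)[OF s]] by (metis injD)
  have all: "(\<forall>x\<in>K. P (\<sigma> x)) \<longleftrightarrow> (\<forall>x\<in>K. P x)" for P
    using K by (metis (no_types, lifting) ball_simps(9))
  have ex: "(\<exists>x\<in>K. P (\<sigma> x)) \<longleftrightarrow> (\<exists>x\<in>K. P x)" for P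
    using K by (metis (no_types, lifting) bex_simps(7))
  have e: "(w \<circ> \<sigma> \<in> nontrivial_abs_values K) = (w \<in> nontrivial_abs_values K)" for w
  proof -
    have "(\<forall>x\<in>K. \<forall>y\<in>K. P (\<sigma> x) (\<sigma> y)) \<longleftrightarrow> (\<forall>x\<in>K. \<forall>y\<in>K. P x y)" for P
      using all[of "\<lambda>x. \<forall>y\<in>K. P x y"] all by simp
    from this[of "\<lambda>x y. w (x * y) = w x * w y"] this[of "\<lambda>x y. w (x + y) \<le> w x + w y"]
      all[of "\<lambda>x. 0 \<le> w x \<and> (w x = 0 \<longleftrightarrow> x = 0)"] ex[of "\<lambda>x. x \<noteq> 0 \<and> w x \<noteq> 1"]
    show ?thesis by (simp add: nontrivial_abs_values_def h 0 cong: ball_cong)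
  qed
  then show "(w \<circ> \<sigma> \<in> nontrivial_abs_values K) = (w \<in> nontrivial_abs_values K)" .
  show "(w \<circ> \<sigma>, w' \<circ> \<sigma>) \<in> abs_value_equiv K \<longleftrightarrow> (w, w') \<in> abs_value_equiv K"
    using all[of "\<lambda>x. w' x = w x powr _"] by (simp add: abs_value_equiv_def e)
qed

definition place_comp :: "(complex \<Rightarrow> complex) \<Rightarrow> (complex \<Rightarrow> real) set \<Rightarrow> (complex \<Rightarrow> real) set" where
  "place_comp \<sigma> v = (\<lambda>w. w \<circ> \<sigma>) ` v"

text \<open>Composition with the inverse of \<sigma> shows that the image fills the whole class of
  \<open>w \<circ> \<sigma>\<close>, so the literal image of a place is again a place.\<close>

lemma place_comp_class:
  assumes s: "\<sigma> \<in> abs_galois" and K: "\<sigma> ` K = K" and A: "rat_subalgebra K" "K \<subseteq> Qbar"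
  shows "place_comp \<sigma> (abs_value_equiv K `` {w}) = abs_value_equiv K `` {w \<circ> \<sigma>}"
proof (intro equalityI subsetI)
  fix w' assume w': "w' \<in> abs_value_equiv K `` {w \<circ> \<sigma>}"
  have eq: "w' = (w' \<circ> inv_into UNIV \<sigma>) \<circ> \<sigma>"
    by (simp add: fun_eq_iff abs_galois_inv_simps[OF s])
  then have "(w \<circ> \<sigma>, (w' \<circ> inv_into UNIV \<sigma>) \<circ> \<sigma>) \<in> abs_value_equiv K" using w' by simp
  then have "w' \<circ> inv_into UNIV \<sigma> \<in> abs_value_equiv K `` {w}"
    by (simp only: comp_abs_galois_equiv[OF assms]) simp
  then show "w' \<in> place_comp \<sigma> (abs_value_equiv K `` {w})"
    unfolding place_comp_def by (subst eq) (rule imageI)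
qed (auto simp: place_comp_def comp_abs_galois_equiv[OF assms])

lemma place_comp_places:
  assumes s: "\<sigma> \<in> abs_galois" and K: "\<sigma> ` K = K" and A: "rat_subalgebra K" "K \<subseteq> Qbar"
    and v: "v \<in> places K"
  shows "place_comp \<sigma> v \<in> places K"
  using v by (auto simp: places_def place_comp_class[OF s K A] comp_abs_galois_equiv[OF s K A]
      elim!: quotientE intro!: quotientI)

text \<open>Pulling absolute values back along \<sigma> reverses composition on places, so that on
  functions the group acts from the left and takes the function of \<alpha> to that of \<sigma>
  \<alpha>.\<close>

definition place_act :: "(complex \<Rightarrow> complex) \<Rightarrow> place \<Rightarrow> place" where
  "place_act \<sigma> y = Abs_place (place_comp \<sigma> (Rep_place y))"

context
  fixes \<sigma> assumes s: "\<sigma> \<in> abs_galois"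
begin

lemma Rep_place_act: "Rep_place (place_act \<sigma> y) = place_comp \<sigma> (Rep_place y)"
  unfolding place_act_def
  by (rule Abs_place_inverse)
     (rule place_comp_places[OF s abs_galoisD(2)[OF s] rsa_Qbar order_refl Rep_place])

text \<open>An automorphism fixes the rationals, so composition with it keeps the normalisation;
  uniqueness of normalised representatives gives the equality.\<close>

lemma place_abs_act:
  assumes "x \<in> Qbar" shows "place_abs (place_act \<sigma> y) x = place_abs y (\<sigma> x)"
proof -
  have "place_abs y \<circ> \<sigma> \<in> Rep_place (place_act \<sigma> y)"
    unfolding Rep_place_act place_comp_def using place_abs_props(1) by (rule imageI)
  then have "(place_abs (place_act \<sigma> y), place_abs y \<circ> \<sigma>) \<in> abs_value_equiv Qbar"
    using place_abs_props(4)[of "place_act \<sigma> y"] by auto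
  moreover have "extends_usual_abs (place_abs y \<circ> \<sigma>)"
    using place_abs_props(2)[of y] hom_rat[OF rsa_Qbar abs_galois_hom[OF s]]
    by (simp add: extends_usual_abs_def)
  ultimately show ?thesis
    using normalised_eq[OF _ place_abs_props(2) _ rsa_Qbar assms] by fastforce
qed

lemma log_abs_act: "\<alpha> \<in> Qbar \<Longrightarrow> log_abs \<alpha> (place_act \<sigma> y) = log_abs (\<sigma> \<alpha>) y"
  by (simp add: log_abs_def place_abs_act)

lemma place_below_act:
  assumes M: "M \<in> galois_fields"
  shows "place_below M (place_act \<sigma> y) = place_comp \<sigma> (place_below M y)"
proof -
  note nf = galois_fields_number_field[OF M]
  note A = number_field_rsa[OF nf] and Q = number_field_Qbar[OF nf]
  have im: "\<sigma> ` M = M" by (rule abs_galois_stable_image[OF s]) (rule galois_fields_stable[OF M])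
  have "(place_abs (place_act \<sigma> y), place_abs y \<circ> \<sigma>) \<in> abs_value_equiv M"
    using Q by (intro abs_value_equiv_cong[OF place_abs_nontrivial[OF nf] _ A]) (auto simp: place_abs_act)
  then show ?thesis
    unfolding place_below_def place_comp_class[OF s im A Q]
    by (rule equiv_class_eq[OF equiv_abs_value_equiv[OF A]])
qed

end

section \<open>Invariance of local degrees\<close>

context
  fixes K w assumes K: "rat_subalgebra K" and w: "w \<in> nontrivial_abs_values K"
begin

lemma cauchy_ring_carrierI:
  assumes "\<And>n. X n \<in> K" "\<And>e. e > 0 \<Longrightarrow> \<exists>N. \<forall>m\<ge>N. \<forall>n\<ge>N. w (X m - X n) < e"
  shows "X \<in> carrier (cauchy_ring K w)"
  using assms by (auto simp: cauchy_ring_def)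

lemma cauchy_ring_carrierD:
  assumes "X \<in> carrier (cauchy_ring K w)"
  shows "X n \<in> K" "e > 0 \<Longrightarrow> \<exists>N. \<forall>m\<ge>N. \<forall>n\<ge>N. w (X m - X n) < e"
  using assms by (auto simp: cauchy_ring_def)

lemma cauchy_ring_const: "c \<in> K \<Longrightarrow> (\<lambda>n. c) \<in> carrier (cauchy_ring K w)"
  by (rule cauchy_ring_carrierI) (auto simp: av_0[OF K w])

lemma cauchy_ring_bounded:
  assumes X: "X \<in> carrier (cauchy_ring K w)"
  obtains B where "B > 0" "\<And>n. w (X n) \<le> B"
proof -
  note XK = cauchy_ring_carrierD(1)[OF X]
  obtain N where N: "\<And>m n. m \<ge> N \<Longrightarrow> n \<ge> N \<Longrightarrow> w (X m - X n) < 1"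
    using cauchy_ring_carrierD(2)[OF X, of 1] by auto
  define B where "B = 1 + (\<Sum>i\<le>N. w (X i))"
  have "w (X n) \<le> B" for n
  proof (cases "n \<le> N")
    case True
    then have "w (X n) \<le> (\<Sum>i\<le>N. w (X i))"
      using av_nonneg[OF K w XK] by (intro member_le_sum) auto
    then show ?thesis by (simp add: B_def)
  next
    case False
    have "w (X n) \<le> w (X n - X N) + w (X N)"
      using av_triangle[OF K w, of "X n - X N" "X N"] XK rsa_diff[OF K] by simp
    moreover have "w (X N) \<le> (\<Sum>i\<le>N. w (X i))"
      using av_nonneg[OF K w XK] by (intro member_le_sum) auto
    ultimately show ?thesis using N[of n N] False by (simp add: B_def)
  qed
  moreover have "B > 0" unfolding B_def by (intro add_pos_nonneg sum_nonneg av_nonneg[OF K w XK]) simp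
  ultimately show ?thesis using that by blast
qed

lemma cauchy_ring_add:
  assumes X: "X \<in> carrier (cauchy_ring K w)" and Z: "Z \<in> carrier (cauchy_ring K w)"
  shows "(\<lambda>n. X n + Z n) \<in> carrier (cauchy_ring K w)"
proof (rule cauchy_ring_carrierI)
  note XK = cauchy_ring_carrierD(1)[OF X] and ZK = cauchy_ring_carrierD(1)[OF Z]
  show "X n + Z n \<in> K" for n by (intro rsa_add[OF K] XK ZK)
  fix e :: real assume e: "e > 0"
  have e2: "e / 2 > 0" using e by simp
  obtain N1 where N1: "\<And>m n. m \<ge> N1 \<Longrightarrow> n \<ge> N1 \<Longrightarrow> w (X m - X n) < e / 2"
    using cauchy_ring_carrierD(2)[OF X e2] by blast
  obtain N2 where N2: "\<And>m n. m \<ge> N2 \<Longrightarrow> n \<ge> N2 \<Longrightarrow> w (Z m - Z n) < e / 2"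
    using cauchy_ring_carrierD(2)[OF Z e2] by blast
  have "w ((X m + Z m) - (X n + Z n)) < e" if "m \<ge> max N1 N2" "n \<ge> max N1 N2" for m n
  proof -
    have "w ((X m - X n) + (Z m - Z n)) \<le> w (X m - X n) + w (Z m - Z n)"
      by (intro av_triangle[OF K w] rsa_diff[OF K] XK ZK)
    also have "\<dots> < e / 2 + e / 2" using that by (intro add_strict_mono N1 N2) auto
    finally show ?thesis by (simp add: algebra_simps)
  qed
  then show "\<exists>N. \<forall>m\<ge>N. \<forall>n\<ge>N. w (X m + Z m - (X n + Z n)) < e" by blast
qed

lemma cauchy_ring_mult:
  assumes X: "X \<in> carrier (cauchy_ring K w)" and Z: "Z \<in> carrier (cauchy_ring K w)"
  shows "(\<lambda>n. X n * Z n) \<in> carrier (cauchy_ring K w)"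
proof (rule cauchy_ring_carrierI)
  note XK = cauchy_ring_carrierD(1)[OF X] and ZK = cauchy_ring_carrierD(1)[OF Z]
  show "X n * Z n \<in> K" for n by (intro rsa_mult[OF K] XK ZK)
  fix e :: real assume e: "e > 0"
  obtain B where B: "B > 0" "\<And>n. w (X n) \<le> B" using cauchy_ring_bounded[OF X] by blast
  obtain C where C: "C > 0" "\<And>n. w (Z n) \<le> C" using cauchy_ring_bounded[OF Z] by blast
  have e2: "e / (2 * C) > 0" "e / (2 * B) > 0" using e B(1) C(1) by auto
  obtain N1 where N1: "\<And>m n. m \<ge> N1 \<Longrightarrow> n \<ge> N1 \<Longrightarrow> w (X m - X n) < e / (2 * C)"
    using cauchy_ring_carrierD(2)[OF X e2(1)] by blast
  obtain N2 where N2: "\<And>m n. m \<ge> N2 \<Longrightarrow> n \<ge> N2 \<Longrightarrow> w (Z m - Z n) < e / (2 * B)"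
    using cauchy_ring_carrierD(2)[OF Z e2(2)] by blast
  have "w (X m * Z m - X n * Z n) < e" if mn: "m \<ge> max N1 N2" "n \<ge> max N1 N2" for m n
  proof -
    have "X m * Z m - X n * Z n = X m * (Z m - Z n) + (X m - X n) * Z n" by (simp add: algebra_simps)
    then have "w (X m * Z m - X n * Z n) \<le> w (X m * (Z m - Z n)) + w ((X m - X n) * Z n)"
      using av_triangle[OF K w, of "X m * (Z m - Z n)" "(X m - X n) * Z n"] XK ZK
      by (simp add: rsa_mult[OF K] rsa_diff[OF K])
    also have "\<dots> = w (X m) * w (Z m - Z n) + w (X m - X n) * w (Z n)"
      using XK ZK by (simp add: av_mult[OF K w] rsa_diff[OF K])
    also have "\<dots> < B * (e / (2 * B)) + (e / (2 * C)) * C"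
    proof (rule add_le_less_mono)
      show "w (X m) * w (Z m - Z n) \<le> B * (e / (2 * B))"
        using N2[of m n] mn B av_nonneg[OF K w] XK ZK rsa_diff[OF K] by (intro mult_mono) auto
      have "w (X m - X n) * w (Z n) \<le> w (X m - X n) * C"
        using C(2) av_nonneg[OF K w] XK rsa_diff[OF K] by (intro mult_left_mono) auto
      also have "\<dots> < (e / (2 * C)) * C" using N1[of m n] mn C(1) by (intro mult_strict_right_mono) auto
      finally show "w (X m - X n) * w (Z n) < (e / (2 * C)) * C" .
    qed
    also have "\<dots> = e" using B(1) C(1) by simp
    finally show ?thesis .
  qed
  then show "\<exists>N. \<forall>m\<ge>N. \<forall>n\<ge>N. w (X m * Z m - X n * Z n) < e" by blast
qed

lemma cauchy_ring_uminus:
  "X \<in> carrier (cauchy_ring K w) \<Longrightarrow> (\<lambda>n. - X n) \<in> carrier (cauchy_ring K w)"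
  using cauchy_ring_mult[OF cauchy_ring_const[of "-1"], of X] rsa_rat[OF K, of "-1"] by simp

lemma cauchy_ring_simps:
  "mult (cauchy_ring K w) = (\<lambda>X Z n. X n * Z n)" "one (cauchy_ring K w) = (\<lambda>n. 1)"
  "zero (cauchy_ring K w) = (\<lambda>n. 0)" "add (cauchy_ring K w) = (\<lambda>X Z n. X n + Z n)"
  by (simp_all add: cauchy_ring_def)

lemma cauchy_ring_is_ring: "ring (cauchy_ring K w)"
proof (rule ringI)
  show "abelian_group (cauchy_ring K w)"
  proof (rule abelian_groupI)
    fix X assume "X \<in> carrier (cauchy_ring K w)"
    then show "\<exists>Y\<in>carrier (cauchy_ring K w). Y \<oplus>\<^bsub>cauchy_ring K w\<^esub> X = \<zero>\<^bsub>cauchy_ring K w\<^esub>"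
      by (intro bexI[of _ "\<lambda>n. - X n"]) (auto simp: cauchy_ring_simps cauchy_ring_uminus)
  qed (auto simp: cauchy_ring_simps cauchy_ring_add cauchy_ring_const rsa_0[OF K] fun_eq_iff)
  show "Group.monoid (cauchy_ring K w)"
    by (rule monoidI)
       (auto simp: cauchy_ring_simps cauchy_ring_mult cauchy_ring_const rsa_1[OF K] mult.assoc)
qed (auto simp: cauchy_ring_simps algebra_simps)

lemma cauchy_ring_a_inv:
  "X \<in> carrier (cauchy_ring K w) \<Longrightarrow> \<ominus>\<^bsub>cauchy_ring K w\<^esub> X = (\<lambda>n. - X n)"
  by (rule abelian_group.minus_equality[OF ring.is_abelian_group[OF cauchy_ring_is_ring]])
     (auto simp: cauchy_ring_simps cauchy_ring_uminus)

lemma null_seqs_ideal: "ideal (null_seqs K w) (cauchy_ring K w)"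
proof (rule idealI)
  show "ring (cauchy_ring K w)" by (rule cauchy_ring_is_ring)
  have mult: "(\<lambda>n. X n * Z n) \<in> null_seqs K w"
    if Z: "Z \<in> null_seqs K w" and X: "X \<in> carrier (cauchy_ring K w)" for X Z
  proof -
    have Zc: "Z \<in> carrier (cauchy_ring K w)" and Zl: "(\<lambda>n. w (Z n)) \<longlonglongrightarrow> 0"
      using Z by (auto simp: null_seqs_def)
    obtain B where B: "B > 0" "\<And>n. w (X n) \<le> B" using cauchy_ring_bounded[OF X] by blast
    note XK = cauchy_ring_carrierD(1)[OF X] and ZK = cauchy_ring_carrierD(1)[OF Zc]
    have "(\<lambda>n. B * w (Z n)) \<longlonglongrightarrow> 0" using tendsto_mult_left[OF Zl, of B] by simp
    then have "(\<lambda>n. w (X n * Z n)) \<longlonglongrightarrow> 0"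
    proof (rule tendsto_sandwich[OF _ _ tendsto_const, rotated 2])
      show "\<forall>\<^sub>F n in sequentially. 0 \<le> w (X n * Z n)"
        using av_nonneg[OF K w] rsa_mult[OF K] XK ZK by simp
      show "\<forall>\<^sub>F n in sequentially. w (X n * Z n) \<le> B * w (Z n)"
        using B av_nonneg[OF K w ZK] XK ZK by (simp add: av_mult[OF K w] mult_right_mono)
    qed
    then show ?thesis using cauchy_ring_mult[OF X Zc] by (simp add: null_seqs_def)
  qed
  show "subgroup (null_seqs K w) (add_monoid (cauchy_ring K w))"
  proof (rule subgroup.intro)
    show "null_seqs K w \<subseteq> carrier (add_monoid (cauchy_ring K w))" by (auto simp: null_seqs_def)
    show "\<one>\<^bsub>add_monoid (cauchy_ring K w)\<^esub> \<in> null_seqs K w"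
      by (simp add: cauchy_ring_simps null_seqs_def cauchy_ring_const rsa_0[OF K] av_0[OF K w])
  next
    fix X Z assume X: "X \<in> null_seqs K w" and Z: "Z \<in> null_seqs K w"
    then have c: "X \<in> carrier (cauchy_ring K w)" "Z \<in> carrier (cauchy_ring K w)"
      and l: "(\<lambda>n. w (X n)) \<longlonglongrightarrow> 0" "(\<lambda>n. w (Z n)) \<longlonglongrightarrow> 0" by (auto simp: null_seqs_def)
    note XK = cauchy_ring_carrierD(1)[OF c(1)] and ZK = cauchy_ring_carrierD(1)[OF c(2)]
    have "(\<lambda>n. w (X n) + w (Z n)) \<longlonglongrightarrow> 0" using tendsto_add[OF l] by simp
    then have "(\<lambda>n. w (X n + Z n)) \<longlonglongrightarrow> 0"
    proof (rule tendsto_sandwich[OF _ _ tendsto_const, rotated 2])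
      show "\<forall>\<^sub>F n in sequentially. 0 \<le> w (X n + Z n)"
        using av_nonneg[OF K w] rsa_add[OF K] XK ZK by simp
      show "\<forall>\<^sub>F n in sequentially. w (X n + Z n) \<le> w (X n) + w (Z n)"
        using av_triangle[OF K w] XK ZK by simp
    qed
    then show "X \<otimes>\<^bsub>add_monoid (cauchy_ring K w)\<^esub> Z \<in> null_seqs K w"
      using cauchy_ring_add[OF c] by (simp add: cauchy_ring_simps null_seqs_def)
  next
    fix X assume X: "X \<in> null_seqs K w"
    then have c: "X \<in> carrier (cauchy_ring K w)" by (simp add: null_seqs_def)
    have "w (- X n) = w (X n)" for n by (rule av_uminus[OF K w cauchy_ring_carrierD(1)[OF c]])
    then have "(\<lambda>n. - X n) \<in> null_seqs K w"
      using X cauchy_ring_uminus[OF c] by (simp add: null_seqs_def)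
    then show "inv\<^bsub>add_monoid (cauchy_ring K w)\<^esub> X \<in> null_seqs K w"
      using cauchy_ring_a_inv[OF c] by (simp add: a_inv_def)
  qed
  show "X \<otimes>\<^bsub>cauchy_ring K w\<^esub> Z \<in> null_seqs K w" "Z \<otimes>\<^bsub>cauchy_ring K w\<^esub> X \<in> null_seqs K w"
    if "Z \<in> null_seqs K w" "X \<in> carrier (cauchy_ring K w)" for X Z
    using mult[OF that] by (simp_all add: cauchy_ring_simps mult.commute)
qed

lemma completion_is_ring: "ring (completion K w)"
  unfolding completion_def by (rule ideal.quotient_is_ring[OF null_seqs_ideal])

lemma cauchy_ring_mono: "L \<subseteq> K \<Longrightarrow> carrier (cauchy_ring L w) \<subseteq> carrier (cauchy_ring K w)"
  by (auto simp: cauchy_ring_def)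

lemma completion_simps:
  "carrier (completion K w) = (\<lambda>X. null_seqs K w +>\<^bsub>cauchy_ring K w\<^esub> X) ` carrier (cauchy_ring K w)"
  "X \<in> carrier (cauchy_ring K w) \<Longrightarrow> Z \<in> carrier (cauchy_ring K w) \<Longrightarrow>
     (null_seqs K w +>\<^bsub>cauchy_ring K w\<^esub> X) \<otimes>\<^bsub>completion K w\<^esub> (null_seqs K w +>\<^bsub>cauchy_ring K w\<^esub> Z)
       = null_seqs K w +>\<^bsub>cauchy_ring K w\<^esub> (\<lambda>n. X n * Z n)"
  "X \<in> carrier (cauchy_ring K w) \<Longrightarrow> Z \<in> carrier (cauchy_ring K w) \<Longrightarrow>
     (null_seqs K w +>\<^bsub>cauchy_ring K w\<^esub> X) \<oplus>\<^bsub>completion K w\<^esub> (null_seqs K w +>\<^bsub>cauchy_ring K w\<^esub> Z)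
       = null_seqs K w +>\<^bsub>cauchy_ring K w\<^esub> (\<lambda>n. X n + Z n)"
  "\<one>\<^bsub>completion K w\<^esub> = null_seqs K w +>\<^bsub>cauchy_ring K w\<^esub> (\<lambda>n. 1)"
proof -
  interpret ideal "null_seqs K w" "cauchy_ring K w" by (rule null_seqs_ideal)
  show "carrier (completion K w) = (\<lambda>X. null_seqs K w +>\<^bsub>cauchy_ring K w\<^esub> X) ` carrier (cauchy_ring K w)"
    by (auto simp: completion_def FactRing_def A_RCOSETS_def')
  assume X: "X \<in> carrier (cauchy_ring K w)" "Z \<in> carrier (cauchy_ring K w)"
  show "(null_seqs K w +>\<^bsub>cauchy_ring K w\<^esub> X) \<otimes>\<^bsub>completion K w\<^esub> (null_seqs K w +>\<^bsub>cauchy_ring K w\<^esub> Z)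
       = null_seqs K w +>\<^bsub>cauchy_ring K w\<^esub> (\<lambda>n. X n * Z n)"
    using rcoset_mult_add[OF X] by (simp add: completion_def FactRing_def cauchy_ring_simps)
  show "(null_seqs K w +>\<^bsub>cauchy_ring K w\<^esub> X) \<oplus>\<^bsub>completion K w\<^esub> (null_seqs K w +>\<^bsub>cauchy_ring K w\<^esub> Z)
       = null_seqs K w +>\<^bsub>cauchy_ring K w\<^esub> (\<lambda>n. X n + Z n)"
    using a_rcos_sum[OF X] by (simp add: completion_def FactRing_def cauchy_ring_simps)
next
  show "\<one>\<^bsub>completion K w\<^esub> = null_seqs K w +>\<^bsub>cauchy_ring K w\<^esub> (\<lambda>n. 1)"
    by (simp add: completion_def FactRing_def cauchy_ring_simps)
qed

end

section \<open>Transport of completions along automorphisms\<close>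

lemma coset_cauchy_ring:
  "N +>\<^bsub>cauchy_ring K w\<^esub> X = {\<lambda>n. Z n + X n | Z. Z \<in> N}"
  by (auto simp: a_r_coset_def' cauchy_ring_def)

text \<open>Induction over the construction of the dimension: h carries a line extension to a line
  extension, and injectivity keeps the image of each new vector outside the part already
  built.\<close>

lemma hom_image_dimension:
  assumes R: "ring R" and S: "ring S" and h: "h \<in> ring_hom R S" and inj: "inj_on h (carrier R)"
    and K: "K \<subseteq> carrier R" and dim: "ring.dimension R n K E"
  shows "E \<subseteq> carrier R \<and> ring.dimension S n (h ` K) (h ` E)"
proof -
  interpret R: ring R by (rule R)
  interpret S: ring S by (rule S)
  interpret ring_hom_ring R S h by (rule ring_hom_ringI2[OF R S h])
  show ?thesis
    using dim K
  proof (induction n K E rule: R.dimension.induct)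
    case (zero_dim K)
    then show ?case using S.zero_dim[of "h ` K"] by simp
  next
    case (Suc_dim v E n K)
    then have E: "E \<subseteq> carrier R" "S.dimension n (h ` K) (h ` E)" by auto
    have "h v \<notin> h ` E" using Suc_dim E(1) inj by (auto dest: inj_onD)
    then have "S.dimension (Suc n) (h ` K) (S.line_extension (h ` K) (h v) (h ` E))"
      using Suc_dim E by (intro S.Suc_dim) auto
    moreover have "h ` R.line_extension K v E = S.line_extension (h ` K) (h v) (h ` E)"
    proof -
      have le: "R.line_extension K v E = {k \<otimes>\<^bsub>R\<^esub> v \<oplus>\<^bsub>R\<^esub> e | k e. k \<in> K \<and> e \<in> E}"
        by (auto simp: R.line_extension_def set_add_def set_mult_def r_coset_def)
      have le': "S.line_extension (h ` K) (h v) (h ` E)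
          = {k \<otimes>\<^bsub>S\<^esub> h v \<oplus>\<^bsub>S\<^esub> e | k e. k \<in> h ` K \<and> e \<in> h ` E}"
        by (auto simp: S.line_extension_def set_add_def set_mult_def r_coset_def)
      have "h (k \<otimes>\<^bsub>R\<^esub> v \<oplus>\<^bsub>R\<^esub> e) = h k \<otimes>\<^bsub>S\<^esub> h v \<oplus>\<^bsub>S\<^esub> h e" if "k \<in> K" "e \<in> E" for k e
        using that Suc_dim.hyps(1) Suc_dim.prems E(1) by (auto simp: subset_iff)
      then show ?thesis unfolding le le' by (auto simp: image_iff) metis+
    qed
    moreover have "R.line_extension K v E \<subseteq> carrier R"
      using Suc_dim.hyps(1) Suc_dim.prems E(1)
      by (auto simp: R.line_extension_def set_add_def set_mult_def r_coset_def subset_iff)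
    ultimately show ?case by simp
  qed
qed

text \<open>The body of \<open>local_degree\<close> at a prescribed absolute value, so that
  independence of the representative can be stated.\<close>

definition completion_degree :: "complex set \<Rightarrow> (complex \<Rightarrow> real) \<Rightarrow> nat" where
  "completion_degree K w = ring.dim (completion K w) (rat_completion_in K w) (carrier (completion K w))"

text \<open>Equivalent absolute values have the same Cauchy sequences and the same null sequences,
  so the two completions are equal and not merely isomorphic.\<close>

lemma completion_degree_equiv:
  assumes K: "rat_subalgebra K" and e: "(w, w') \<in> abs_value_equiv K"
  shows "completion_degree K w = completion_degree K w'"
proof -
  have sub: "carrier (cauchy_ring L w) \<subseteq> carrier (cauchy_ring L w')"
    "null_seqs K w \<subseteq> null_seqs K w'"
    if e: "(w, w') \<in> abs_value_equiv K" and L: "L \<in> {K, \<rat>}" for w w' L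
  proof -
    obtain s where s: "s > 0" "\<And>x. x \<in> K \<Longrightarrow> w' x = w x powr s" and w: "w \<in> nontrivial_abs_values K"
      using e by (auto simp: abs_value_equiv_def)
    have LK: "L \<subseteq> K" "rat_subalgebra L" using L rsa_rat[OF K] K rsa_Rats by auto
    have c: "carrier (cauchy_ring L w) \<subseteq> carrier (cauchy_ring L w')"
      if LK: "L \<subseteq> K" "rat_subalgebra L" for L
    proof
      fix X assume X: "X \<in> carrier (cauchy_ring L w)"
      have XL: "X n \<in> L" for n using X by (auto simp: cauchy_ring_def)
      have "\<exists>N. \<forall>m\<ge>N. \<forall>n\<ge>N. w' (X m - X n) < e" if e: "e > 0" for e
      proof -
        have "e powr (1 / s) > 0" using e by simp
        then obtain N where N: "\<And>m n. m \<ge> N \<Longrightarrow> n \<ge> N \<Longrightarrow> w (X m - X n) < e powr (1 / s)"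
          using X by (force simp: cauchy_ring_def)
        have "w' (X m - X n) < e" if "m \<ge> N" "n \<ge> N" for m n
        proof -
          have dK: "X m - X n \<in> K" using rsa_diff[OF LK(2) XL XL] LK(1) by blast
          have "w (X m - X n) powr s < (e powr (1 / s)) powr s"
            using N[OF that] s(1) av_nonneg[OF K w dK] by (intro powr_less_mono2) auto
          then show ?thesis using s e dK by (simp add: powr_powr)
        qed
        then show ?thesis by blast
      qed
      then show "X \<in> carrier (cauchy_ring L w')" using XL by (auto simp: cauchy_ring_def)
    qed
    show "carrier (cauchy_ring L w) \<subseteq> carrier (cauchy_ring L w')" using LK by (rule c)
    show "null_seqs K w \<subseteq> null_seqs K w'"
    proof
      fix X assume X: "X \<in> null_seqs K w"
      then have Xc: "X \<in> carrier (cauchy_ring K w)" and l: "(\<lambda>n. w (X n)) \<longlonglongrightarrow> 0" by (auto simp: null_seqs_def)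
      have XK: "X n \<in> K" for n using Xc by (auto simp: cauchy_ring_def)
      have "(\<lambda>n. w (X n) powr s) \<longlonglongrightarrow> 0 powr s"
        using l s(1) av_nonneg[OF K w XK] by (intro tendsto_powr' tendsto_const) auto
      then have "(\<lambda>n. w' (X n)) \<longlonglongrightarrow> 0" using s XK by simp
      then show "X \<in> null_seqs K w'" using c[OF order_refl K] Xc by (auto simp: null_seqs_def)
    qed
  qed
  have e': "(w', w) \<in> abs_value_equiv K"
    using equivE[OF equiv_abs_value_equiv[OF K]] symD[OF _ e] by metis
  have "carrier (cauchy_ring K w) = carrier (cauchy_ring K w')"
    "carrier (cauchy_ring \<rat> w) = carrier (cauchy_ring \<rat> w')" "null_seqs K w = null_seqs K w'"
    using sub(1)[OF e, of K] sub(1)[OF e', of K] sub(1)[OF e, of \<rat>] sub(1)[OF e', of \<rat>]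
      sub(2)[OF e, of K] sub(2)[OF e', of K] by (simp_all add: subset_antisym)
  moreover from this(1) have "cauchy_ring K w = cauchy_ring K w'" by (simp add: cauchy_ring_def)
  ultimately show ?thesis by (simp add: completion_degree_def completion_def rat_completion_in_def)
qed

lemma local_degree_eq:
  assumes K: "rat_subalgebra K" and v: "v \<in> places K" "w \<in> v"
  shows "local_degree K v = completion_degree K w"
proof -
  define w0 where "w0 = (SOME w. w \<in> v)"
  have "w0 \<in> v" unfolding w0_def using v(2) by (rule someI[of "\<lambda>w. w \<in> v"])
  then have "(w0, w) \<in> abs_value_equiv K" using places_memD(2)[OF K v(1), of w0] v(2) by auto
  then have "completion_degree K w0 = completion_degree K w" by (rule completion_degree_equiv[OF K])
  then show ?thesis by (simp add: local_degree_def Let_def w0_def completion_degree_def)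
qed

text \<open>Applying \<sigma> termwise turns Cauchy and null sequences for
  \<open>w \<circ> \<sigma>\<close> into those for w. It induces an isomorphism of completions that
  matches the two copies of the completed rationals.\<close>

lemma completion_dimension_comp:
  assumes s: "\<sigma> \<in> abs_galois" and im: "\<sigma> ` K = K" and K: "rat_subalgebra K" "K \<subseteq> Qbar"
    and w: "w \<in> nontrivial_abs_values K"
    and dim: "ring.dimension (completion K (w \<circ> \<sigma>)) n (rat_completion_in K (w \<circ> \<sigma>)) (carrier (completion K (w \<circ> \<sigma>)))"
  shows "ring.dimension (completion K w) n (rat_completion_in K w) (carrier (completion K w))"
proof -
  let ?w = "w \<circ> \<sigma>"
  have w': "?w \<in> nontrivial_abs_values K" using comp_abs_galois_equiv(1)[OF s im K] w by simp
  \<comment> \<open>Elements of the completion are sets of sequences, so the map can be a set image,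
    without a choice of representatives.\<close>
  define h where "h = (\<lambda>C. (\<lambda>X :: nat \<Rightarrow> complex. \<sigma> \<circ> X) ` C)"
  have h_add: "\<sigma> (x + y) = \<sigma> x + \<sigma> y" "\<sigma> (x * y) = \<sigma> x * \<sigma> y" "\<sigma> (x - y) = \<sigma> x - \<sigma> y"
    if "x \<in> K" "y \<in> K" for x y
    using that K(2) hom_add[OF rsa_Qbar abs_galois_hom[OF s]] hom_mult[OF rsa_Qbar abs_galois_hom[OF s]]
      hom_uminus[OF rsa_Qbar abs_galois_hom[OF s], of y] hom_add[OF rsa_Qbar abs_galois_hom[OF s], of x "- y"]
      rsa_uminus[OF rsa_Qbar, of y] by (auto simp: subset_iff)
  have h_rat: "\<sigma> q = q" if "q \<in> \<rat>" for q using hom_rat[OF rsa_Qbar abs_galois_hom[OF s] that] .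
  have mem: "\<sigma> x \<in> K \<longleftrightarrow> x \<in> K" for x
    using im bij_is_inj[OF abs_galoisD(1)[OF s]] by (metis imageE imageI injD)
  have car: "\<sigma> \<circ> X \<in> carrier (cauchy_ring K w) \<longleftrightarrow> X \<in> carrier (cauchy_ring K ?w)" for X
  proof -
    have "range (\<sigma> \<circ> X) \<subseteq> K \<longleftrightarrow> range X \<subseteq> K" by (auto simp: subset_iff mem)
    moreover have "w (\<sigma> (X m) - \<sigma> (X n)) = w (\<sigma> (X m - X n))" if "range X \<subseteq> K" for m n
      using that h_add(3)[of "X m" "X n"] by (simp add: subset_iff)
    ultimately show ?thesis by (auto simp: cauchy_ring_def)
  qed
  have null: "\<sigma> \<circ> X \<in> null_seqs K w \<longleftrightarrow> X \<in> null_seqs K ?w" for X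
    by (simp add: null_seqs_def car)
  have inv: "\<sigma> \<circ> (inv_into UNIV \<sigma> \<circ> X) = X" for X :: "nat \<Rightarrow> complex"
    by (simp add: fun_eq_iff abs_galois_inv_simps[OF s])
  have coset: "h (null_seqs K ?w +>\<^bsub>cauchy_ring K ?w\<^esub> X) = null_seqs K w +>\<^bsub>cauchy_ring K w\<^esub> (\<sigma> \<circ> X)"
    if X: "X \<in> carrier (cauchy_ring K ?w)" for X
  proof -
    have XK: "X n \<in> K" for n using cauchy_ring_carrierD(1)[OF K(1) w' X] .
    have eq: "\<sigma> \<circ> (\<lambda>n. Z n + X n) = (\<lambda>n. (\<sigma> \<circ> Z) n + (\<sigma> \<circ> X) n)" if "Z \<in> null_seqs K ?w" for Z
    proof -
      have "Z n \<in> K" for n using that by (auto simp: null_seqs_def cauchy_ring_def)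
      then show ?thesis using XK by (simp add: fun_eq_iff h_add)
    qed
    show ?thesis
      unfolding coset_cauchy_ring h_def
    proof (intro equalityI subsetI)
      fix Y assume "Y \<in> {\<lambda>n. Z n + (\<sigma> \<circ> X) n | Z. Z \<in> null_seqs K w}"
      then obtain Z where Z: "Z \<in> null_seqs K w" "Y = (\<lambda>n. Z n + (\<sigma> \<circ> X) n)" by blast
      define Z' where "Z' = inv_into UNIV \<sigma> \<circ> Z"
      have Z': "\<sigma> \<circ> Z' = Z" by (simp add: Z'_def inv)
      then have "Z' \<in> null_seqs K ?w" using Z null[of Z'] by simp
      then show "Y \<in> (\<circ>) \<sigma> ` {\<lambda>n. Z n + X n | Z. Z \<in> null_seqs K ?w}"
        using eq[of Z'] Z(2) unfolding Z' by (intro image_eqI[of _ _ "\<lambda>n. Z' n + X n"]) auto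
    next
      fix Y assume "Y \<in> (\<circ>) \<sigma> ` {\<lambda>n. Z n + X n | Z. Z \<in> null_seqs K ?w}"
      then obtain Z where Z: "Z \<in> null_seqs K ?w" "Y = \<sigma> \<circ> (\<lambda>n. Z n + X n)" by blast
      then show "Y \<in> {\<lambda>n. Z n + (\<sigma> \<circ> X) n | Z. Z \<in> null_seqs K w}"
        using eq[OF Z(1)] null[of Z] by blast
    qed
  qed
  note R = completion_is_ring[OF K(1) w'] and S = completion_is_ring[OF K(1) w]
  note sR = completion_simps[OF K(1) w'] and sS = completion_simps[OF K(1) w]
  have "inj (\<lambda>X :: nat \<Rightarrow> complex. \<sigma> \<circ> X)"
    by (rule fun.inj_map) (rule bij_is_inj[OF abs_galoisD(1)[OF s]])
  then have inj: "inj h" unfolding h_def by (auto simp: inj_on_def inj_image_eq_iff)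
  have hom: "h \<in> ring_hom (completion K ?w) (completion K w)"
  proof (rule ring_hom_memI)
    fix C assume "C \<in> carrier (completion K ?w)"
    then show "h C \<in> carrier (completion K w)" unfolding sR(1) sS(1) using coset car by auto
  next
    fix C D assume "C \<in> carrier (completion K ?w)" "D \<in> carrier (completion K ?w)"
    then obtain X Z where X: "X \<in> carrier (cauchy_ring K ?w)" "C = null_seqs K ?w +>\<^bsub>cauchy_ring K ?w\<^esub> X"
      and Z: "Z \<in> carrier (cauchy_ring K ?w)" "D = null_seqs K ?w +>\<^bsub>cauchy_ring K ?w\<^esub> Z"
      unfolding sR(1) by blast
    note XK = cauchy_ring_carrierD(1)[OF K(1) w' X(1)] and ZK = cauchy_ring_carrierD(1)[OF K(1) w' Z(1)]
    have c: "\<sigma> \<circ> X \<in> carrier (cauchy_ring K w)" "\<sigma> \<circ> Z \<in> carrier (cauchy_ring K w)"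
      using car X Z by auto
    have eq: "\<sigma> \<circ> (\<lambda>n. X n * Z n) = (\<lambda>n. (\<sigma> \<circ> X) n * (\<sigma> \<circ> Z) n)"
      "\<sigma> \<circ> (\<lambda>n. X n + Z n) = (\<lambda>n. (\<sigma> \<circ> X) n + (\<sigma> \<circ> Z) n)"
      using XK ZK by (auto simp: fun_eq_iff h_add)
    show "h (C \<otimes>\<^bsub>completion K ?w\<^esub> D) = h C \<otimes>\<^bsub>completion K w\<^esub> h D"
      unfolding X(2) Z(2) sR(2)[OF X(1) Z(1)] coset[OF X(1)] coset[OF Z(1)] sS(2)[OF c]
        coset[OF cauchy_ring_mult[OF K(1) w' X(1) Z(1)]] eq ..
    show "h (C \<oplus>\<^bsub>completion K ?w\<^esub> D) = h C \<oplus>\<^bsub>completion K w\<^esub> h D"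
      unfolding X(2) Z(2) sR(3)[OF X(1) Z(1)] coset[OF X(1)] coset[OF Z(1)] sS(3)[OF c]
        coset[OF cauchy_ring_add[OF K(1) w' X(1) Z(1)]] eq ..
  next
    have "\<sigma> \<circ> (\<lambda>n :: nat. 1) = (\<lambda>n. 1)" using h_rat[of 1] by auto
    then show "h \<one>\<^bsub>completion K ?w\<^esub> = \<one>\<^bsub>completion K w\<^esub>"
      unfolding sR(4) sS(4) coset[OF cauchy_ring_const[OF K(1) w' rsa_1[OF K(1)]]] by simp
  qed
  have ratcar: "carrier (cauchy_ring \<rat> ?w) = carrier (cauchy_ring \<rat> w)"
  proof -
    have "?w (X m - X n) = w (X m - X n)" if "range X \<subseteq> \<rat>" for X :: "nat \<Rightarrow> complex" and m n
      using that h_rat[of "X m - X n"] by (simp add: subset_iff)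
    then show ?thesis by (auto simp: cauchy_ring_def)
  qed
  have rat_sub: "carrier (cauchy_ring \<rat> ?w) \<subseteq> carrier (cauchy_ring K ?w)"
    using cauchy_ring_mono[OF K(1) w', of \<rat>] rsa_rat[OF K(1)] by auto
  have im_rat: "h ` rat_completion_in K ?w = rat_completion_in K w"
  proof -
    have fixq: "\<sigma> \<circ> X = X" if "X \<in> carrier (cauchy_ring \<rat> w)" for X
      using that h_rat by (auto simp: cauchy_ring_def fun_eq_iff subset_iff)
    have "h ` rat_completion_in K ?w = (\<lambda>X. h (null_seqs K ?w +>\<^bsub>cauchy_ring K ?w\<^esub> X)) ` carrier (cauchy_ring \<rat> ?w)"
      by (simp add: rat_completion_in_def image_image)
    also have "\<dots> = (\<lambda>X. null_seqs K w +>\<^bsub>cauchy_ring K w\<^esub> X) ` carrier (cauchy_ring \<rat> w)"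
      unfolding ratcar by (intro image_cong refl) (use coset fixq rat_sub ratcar in auto)
    finally show ?thesis unfolding rat_completion_in_def .
  qed
  have im_car: "h ` carrier (completion K ?w) = carrier (completion K w)"
  proof -
    have "h ` carrier (completion K ?w) = (\<lambda>X. null_seqs K w +>\<^bsub>cauchy_ring K w\<^esub> (\<sigma> \<circ> X)) ` carrier (cauchy_ring K ?w)"
      unfolding sR(1) image_image by (intro image_cong refl coset)
    also have "\<dots> = (\<lambda>X. null_seqs K w +>\<^bsub>cauchy_ring K w\<^esub> X) ` ((\<circ>) \<sigma> ` carrier (cauchy_ring K ?w))"
      by (simp add: image_image)
    also have "(\<circ>) \<sigma> ` carrier (cauchy_ring K ?w) = carrier (cauchy_ring K w)"
    proof (intro equalityI subsetI)
      fix X assume X: "X \<in> carrier (cauchy_ring K w)"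
      then have "inv_into UNIV \<sigma> \<circ> X \<in> carrier (cauchy_ring K ?w)"
        using car[of "inv_into UNIV \<sigma> \<circ> X"] inv[of X] by simp
      then show "X \<in> (\<circ>) \<sigma> ` carrier (cauchy_ring K ?w)" using inv[of X] by (metis imageI)
    qed (use car in auto)
    finally show ?thesis unfolding sS(1) .
  qed
  have "rat_completion_in K ?w \<subseteq> carrier (completion K ?w)"
    unfolding sR(1) rat_completion_in_def using rat_sub by (rule image_mono)
  then show ?thesis
    using hom_image_dimension[OF R S hom inj_on_subset[OF inj subset_UNIV] _ dim]
    unfolding im_rat im_car by blast
qed

text \<open>Transport along \<sigma> and along its inverse shows that the dimension predicates agree
  for every n, and with them the value of \<open>dim\<close> derived from them.\<close>

lemma completion_degree_comp:
  assumes s: "\<sigma> \<in> abs_galois" and im: "\<sigma> ` K = K" and K: "rat_subalgebra K" "K \<subseteq> Qbar"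
    and w: "w \<in> nontrivial_abs_values K"
  shows "completion_degree K (w \<circ> \<sigma>) = completion_degree K w"
proof -
  note w' = iffD2[OF comp_abs_galois_equiv(1)[OF s im K] w]
  let ?\<tau> = "inv_into UNIV \<sigma>"
  have im': "?\<tau> ` K = K"
    using im abs_galois_inv_simps[OF s] by (metis (no_types, lifting) image_inv_f_f abs_galoisD(1) bij_is_inj s)
  have ww: "(w \<circ> \<sigma>) \<circ> ?\<tau> = w" by (simp add: fun_eq_iff abs_galois_inv_simps[OF s])
  have "ring.dimension (completion K (w \<circ> \<sigma>)) n (rat_completion_in K (w \<circ> \<sigma>)) (carrier (completion K (w \<circ> \<sigma>)))
    \<longleftrightarrow> ring.dimension (completion K w) n (rat_completion_in K w) (carrier (completion K w))" for n
    using completion_dimension_comp[OF s im K w, of n]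
      completion_dimension_comp[OF abs_galois_inv[OF s] im' K w', of n] unfolding ww by blast
  then show ?thesis
    by (simp add: completion_degree_def ring.dim_def[OF completion_is_ring[OF K(1)]] w w')
qed

lemma local_degree_place_comp:
  assumes s: "\<sigma> \<in> abs_galois" and K: "K \<in> galois_fields" and v: "v \<in> places K"
  shows "local_degree K (place_comp \<sigma> v) = local_degree K v"
proof -
  note nf = galois_fields_number_field[OF K]
  note A = number_field_rsa[OF nf] and Q = number_field_Qbar[OF nf]
  have im: "\<sigma> ` K = K" by (rule abs_galois_stable_image[OF s]) (rule galois_fields_stable[OF K])
  obtain w where w: "w \<in> nontrivial_abs_values K" "w \<in> v" using placesE[OF A Q v] by metis
  have "w \<circ> \<sigma> \<in> place_comp \<sigma> v" using w by (auto simp: place_comp_def)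
  then show ?thesis
    using local_degree_eq[OF A v w(2)] local_degree_eq[OF A place_comp_places[OF s im A Q v]]
      completion_degree_comp[OF s im A Q w(1)] by simp
qed

section \<open>Invariance of the measure\<close>

context
  fixes lam M assumes lam: "allcock_vaaler_measure lam" and M: "M \<in> galois_fields"
begin

text \<open>The fibres are basic open sets, and since the target is countable, measurability can be
  tested on them.\<close>

lemma measurable_place_below: "place_below M \<in> measurable lam (count_space (places M))"
proof -
  note nf = galois_fields_number_field[OF M]
  have sp: "space lam = UNIV" and st: "sets lam = sets borel"
    using lam sets_eq_imp_space_eq[of lam borel] by (auto simp: allcock_vaaler_measure_def)
  have "place_below M -` {v} \<inter> space lam \<in> sets lam" if v: "v \<in> places M" for v
  proof -
    have "open (Y_over M v)"
      unfolding open_place_def using v nf by (intro generate_topology.Basis) auto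
    moreover have "place_below M -` {v} = Y_over M v" using Y_over_eq[OF nf v] by auto
    ultimately show ?thesis by (simp add: sp st)
  qed
  then show ?thesis
    using place_below_places[OF nf]
    by (subst measurable_count_space_eq_countable[OF countable_places[OF nf]]) auto
qed

text \<open>A measure on a countable discrete set is determined by its points. Here
  \<open>place_comp \<sigma>\<close> permutes the points, and the mass of a point is its local
  degree over the degree of M, which the permutation preserves.\<close>

lemma distr_place_comp:
  assumes s: "\<sigma> \<in> abs_galois"
  defines "N \<equiv> distr lam (count_space (places M)) (place_below M)"
  shows "distr N (count_space (places M)) (place_comp \<sigma>) = N"
proof -
  note nf = galois_fields_number_field[OF M]
  note A = number_field_rsa[OF nf] and Q = number_field_Qbar[OF nf]
  have im: "\<sigma> ` M = M" if "\<sigma> \<in> abs_galois" for \<sigma>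
    by (rule abs_galois_stable_image[OF that]) (rule galois_fields_stable[OF M])
  have pc: "place_comp \<sigma> v \<in> places M" if "\<sigma> \<in> abs_galois" "v \<in> places M" for \<sigma> v
    using place_comp_places[OF that(1) im[OF that(1)] A Q that(2)] .
  have sp: "space lam = UNIV"
    using lam sets_eq_imp_space_eq[of lam borel] by (auto simp: allcock_vaaler_measure_def)
  have Nv: "emeasure N {v} = ennreal (real (local_degree M v) / real (degree_over_Q M))"
    if v: "v \<in> places M" for v
  proof -
    have "emeasure N {v} = emeasure lam (place_below M -` {v} \<inter> space lam)"
      unfolding N_def using v by (intro emeasure_distr measurable_place_below) auto
    also have "place_below M -` {v} \<inter> space lam = Y_over M v"
      using Y_over_eq[OF nf v] sp by auto
    finally show ?thesis using lam nf v by (simp add: allcock_vaaler_measure_def)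
  qed
  let ?\<tau> = "inv_into UNIV \<sigma>"
  have inv: "place_comp \<sigma> (place_comp ?\<tau> v) = v" "place_comp ?\<tau> (place_comp \<sigma> v) = v" for v
    by (auto simp: place_comp_def image_image comp_def abs_galois_inv_simps[OF s])
  show ?thesis
  proof (rule measure_eqI_countable)
    show "countable (places M)" by (rule countable_places[OF nf])
    fix v assume v: "v \<in> places M"
    have m: "place_comp \<sigma> \<in> measurable N (count_space (places M))"
      using pc[OF s] by (simp add: N_def measurable_distr_eq1)
    have "place_comp \<sigma> -` {v} \<inter> space N = {place_comp ?\<tau> v}"
      using pc[OF abs_galois_inv[OF s] v] inv by (auto simp: N_def)
    then have "emeasure (distr N (count_space (places M)) (place_comp \<sigma>)) {v} = emeasure N {place_comp ?\<tau> v}"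
      using v by (subst emeasure_distr[OF m]) auto
    then show "emeasure (distr N (count_space (places M)) (place_comp \<sigma>)) {v} = emeasure N {v}"
      using v pc[OF abs_galois_inv[OF s] v] local_degree_place_comp[OF abs_galois_inv[OF s] M v] by (simp add: Nv)
  qed (auto simp: N_def)
qed

text \<open>The integrals are moved to the places of M with the pushforward measure, where every
  function is measurable; hence \<phi> is arbitrary. Integrability is transferred separately,
  because equal integrals do not reveal it under the convention that non-integrable functions have
  integral 0.\<close>

lemma integral_place_act:
  fixes \<phi> :: "(complex \<Rightarrow> real) set \<Rightarrow> real"
  assumes s: "\<sigma> \<in> abs_galois"
  shows "integral\<^sup>L lam (\<lambda>y. \<phi> (place_below M (place_act \<sigma> y))) = integral\<^sup>L lam (\<lambda>y. \<phi> (place_below M y))"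
    "integrable lam (\<lambda>y. \<phi> (place_below M (place_act \<sigma> y))) \<longleftrightarrow> integrable lam (\<lambda>y. \<phi> (place_below M y))"
proof -
  note nf = galois_fields_number_field[OF M]
  note A = number_field_rsa[OF nf] and Q = number_field_Qbar[OF nf]
  let ?C = "count_space (places M)"
  define N where "N = distr lam ?C (place_below M)"
  have im: "\<sigma> ` M = M" by (rule abs_galois_stable_image[OF s]) (rule galois_fields_stable[OF M])
  have m: "place_comp \<sigma> \<in> measurable N ?C"
    using place_comp_places[OF s im A Q] by (simp add: N_def measurable_distr_eq1)
  have N: "distr N ?C (place_comp \<sigma>) = N" unfolding N_def by (rule distr_place_comp[OF s])
  have b: "f \<in> borel_measurable ?C" for f :: "(complex \<Rightarrow> real) set \<Rightarrow> real" by simp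
  have 1: "integral\<^sup>L lam (\<lambda>y. f (place_below M y)) = integral\<^sup>L N f"
    "integrable lam (\<lambda>y. f (place_below M y)) \<longleftrightarrow> integrable N f" for f :: "(complex \<Rightarrow> real) set \<Rightarrow> real"
    unfolding N_def
    by (rule integral_distr[OF measurable_place_below b, symmetric])
       (rule integrable_distr_eq[OF measurable_place_below b, symmetric])
  have 2: "integral\<^sup>L N (\<lambda>v. f (place_comp \<sigma> v)) = integral\<^sup>L N f"
    "integrable N (\<lambda>v. f (place_comp \<sigma> v)) \<longleftrightarrow> integrable N f" for f :: "(complex \<Rightarrow> real) set \<Rightarrow> real"
    using integral_distr[OF m b, of f] integrable_distr_eq[OF m b, of f] unfolding N by auto
  show "integral\<^sup>L lam (\<lambda>y. \<phi> (place_below M (place_act \<sigma> y))) = integral\<^sup>L lam (\<lambda>y. \<phi> (place_below M y))"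
    "integrable lam (\<lambda>y. \<phi> (place_below M (place_act \<sigma> y))) \<longleftrightarrow> integrable lam (\<lambda>y. \<phi> (place_below M y))"
    unfolding place_below_act[OF s M] 1[of "\<lambda>v. \<phi> (place_comp \<sigma> v)"] 1[of \<phi>] 2 by auto
qed

end

lemma place_inner_act:
  assumes lam: "allcock_vaaler_measure lam" and s: "\<sigma> \<in> abs_galois"
    and f: "f \<in> alg_space" and g: "g \<in> alg_space"
  shows "place_inner lam (f \<circ> place_act \<sigma>) (g \<circ> place_act \<sigma>) = place_inner lam f g"
    "integrable lam (\<lambda>y. f (place_act \<sigma> y) * g (place_act \<sigma> y)) \<longleftrightarrow> integrable lam (\<lambda>y. f y * g y)"
proof -
  obtain \<alpha> \<beta> where ab: "\<alpha> \<in> Qbar" "f = log_abs \<alpha>" "\<beta> \<in> Qbar" "g = log_abs \<beta>"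
    using f g by (auto simp: alg_space_def)
  obtain M where M: "M \<in> galois_fields" "{\<alpha>, \<beta>} \<subseteq> M"
    using galois_field_containing[of "{\<alpha>, \<beta>}"] ab by auto
  note nf = galois_fields_number_field[OF M(1)]
  have "f y * g y = (\<lambda>v. log_abs_below \<alpha> v * log_abs_below \<beta> v) (place_below M y)" for y
    using M(2) by (simp add: ab log_abs_eq_below[OF nf])
  then show "place_inner lam (f \<circ> place_act \<sigma>) (g \<circ> place_act \<sigma>) = place_inner lam f g"
    "integrable lam (\<lambda>y. f (place_act \<sigma> y) * g (place_act \<sigma> y)) \<longleftrightarrow> integrable lam (\<lambda>y. f y * g y)"
    using integral_place_act[OF lam M(1) s, of "\<lambda>v. log_abs_below \<alpha> v * log_abs_below \<beta> v"]
    by (simp_all add: place_inner_def)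
qed

section \<open>Averaging over Galois orbits\<close>

text \<open>Averages over index sets of different sizes are reconciled here: each value on the image
  is counted equally often upstairs, so numerator and denominator grow by the same factor.\<close>

lemma average_over_equinumerous_fibres:
  fixes \<psi> :: "'z \<Rightarrow> real"
  assumes fin: "finite X"
    and fib: "\<And>z z'. z \<in> q ` X \<Longrightarrow> z' \<in> q ` X \<Longrightarrow> card {x \<in> X. q x = z} = card {x \<in> X. q x = z'}"
  shows "(\<Sum>x\<in>X. \<psi> (q x)) / card X = (\<Sum>z\<in>q ` X. \<psi> z) / card (q ` X)"
proof (cases "X = {}")
  case False
  then obtain x0 where x0: "x0 \<in> X" by blast
  define c where "c = card {x \<in> X. q x = q x0}"
  have c: "card {x \<in> X. q x = z} = c" if "z \<in> q ` X" for z
    unfolding c_def using fib[OF that] x0 by blast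
  have "c > 0" unfolding c_def using x0 fin by (auto simp: card_gt_0_iff)
  have sum: "(\<Sum>x\<in>X. \<psi> (q x)) = c * (\<Sum>z\<in>q ` X. \<psi> z)" for \<psi> :: "'z \<Rightarrow> real"
  proof -
    have "(\<Sum>x\<in>X. \<psi> (q x)) = (\<Sum>z\<in>q ` X. \<Sum>x\<in>{x \<in> X. q x = z}. \<psi> (q x))"
      by (rule sum.image_gen[OF fin])
    also have "\<dots> = (\<Sum>z\<in>q ` X. c * \<psi> z)" by (rule sum.cong) (auto simp: c[symmetric])
    finally show ?thesis by (simp add: sum_distrib_left)
  qed
  have "real (card X) = c * real (card (q ` X))" using sum[of "\<lambda>_. 1"] by simp
  then show ?thesis using sum[of \<psi>] \<open>c > 0\<close> by simp
qed simp

lemma sum_fun_apply: "sum f I y = (\<Sum>i\<in>I. f i y)" for f :: "'i \<Rightarrow> 'a \<Rightarrow> real"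
  by (induction I rule: infinite_finite_induct) auto

text \<open>A common index set for two functions: the orbits of both, and of anything built
  equivariantly from them, are its quotients.\<close>

definition pair_orbit :: "complex set \<Rightarrow> complex \<Rightarrow> complex \<Rightarrow> (complex \<times> complex) set" where
  "pair_orbit K \<alpha> \<beta> = (\<lambda>\<sigma>. (\<sigma> \<alpha>, \<sigma> \<beta>)) ` fix_group K"

lemma fix_group_abs_galois: "\<sigma> \<in> fix_group K \<Longrightarrow> \<sigma> \<in> abs_galois"
  by (simp add: fix_group_def)

lemma finite_pair_orbit:
  assumes "\<alpha> \<in> Qbar" "\<beta> \<in> Qbar" shows "finite (pair_orbit K \<alpha> \<beta>)"
proof (rule finite_subset)
  show "pair_orbit K \<alpha> \<beta> \<subseteq> (\<lambda>\<sigma>. \<sigma> \<alpha>) ` abs_galois \<times> (\<lambda>\<sigma>. \<sigma> \<beta>) ` abs_galois"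
    using fix_group_abs_galois by (auto simp: pair_orbit_def)
qed (use finite_abs_galois_orbit assms in blast)

text \<open>The group permutes an orbit transitively, so the fibres of an equivariant map on it are
  carried onto one another and have equal size.\<close>

lemma average_pair_orbit:
  fixes \<psi> :: "'z \<Rightarrow> real" and act :: "(complex \<Rightarrow> complex) \<Rightarrow> 'z \<Rightarrow> 'z"
  assumes ab: "\<alpha> \<in> Qbar" "\<beta> \<in> Qbar"
    and q: "\<And>\<sigma> a b. \<sigma> \<in> fix_group K \<Longrightarrow> a \<in> Qbar \<Longrightarrow> b \<in> Qbar \<Longrightarrow> q (\<sigma> a, \<sigma> b) = act \<sigma> (q (a, b))"
  shows "(\<Sum>x\<in>pair_orbit K \<alpha> \<beta>. \<psi> (q x)) / card (pair_orbit K \<alpha> \<beta>)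
    = (\<Sum>z\<in>(\<lambda>\<sigma>. act \<sigma> (q (\<alpha>, \<beta>))) ` fix_group K. \<psi> z) / card ((\<lambda>\<sigma>. act \<sigma> (q (\<alpha>, \<beta>))) ` fix_group K)"
proof -
  let ?X = "pair_orbit K \<alpha> \<beta>"
  have im: "q ` ?X = (\<lambda>\<sigma>. act \<sigma> (q (\<alpha>, \<beta>))) ` fix_group K"
    unfolding pair_orbit_def image_image using q ab by (intro image_cong) auto
  have le: "card {x \<in> ?X. q x = z} \<le> card {x \<in> ?X. q x = z'}" if zz: "z \<in> q ` ?X" "z' \<in> q ` ?X" for z z'
  proof -
    obtain \<sigma> \<tau> where s: "\<sigma> \<in> fix_group K" "z = q (\<sigma> \<alpha>, \<sigma> \<beta>)" and t: "\<tau> \<in> fix_group K" "z' = q (\<tau> \<alpha>, \<tau> \<beta>)"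
      using zz unfolding pair_orbit_def by blast
    \<comment> \<open>This element moves the fibre over z into the fibre over z'; exchanging the two
      points gives the opposite inequality of cardinalities.\<close>
    define \<rho> where "\<rho> = \<tau> \<circ> inv_into UNIV \<sigma>"
    have r: "\<rho> \<in> fix_group K" unfolding \<rho>_def by (intro fix_group_comp fix_group_inv s t)
    have rs: "\<rho> (\<sigma> x) = \<tau> x" for x
      by (simp add: \<rho>_def abs_galois_inv_simps[OF fix_group_abs_galois[OF s(1)]])
    have sQ: "\<sigma>' x \<in> Qbar" if "\<sigma>' \<in> fix_group K" "x \<in> Qbar" for \<sigma>' x
      using abs_galoisD(4)[OF fix_group_abs_galois] that by blast
    have z': "z' = act \<rho> z" using q[OF r sQ[OF s(1) ab(1)] sQ[OF s(1) ab(2)]] by (simp add: s t rs)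
    show ?thesis
    proof (rule card_inj_on_le[of "\<lambda>(a, b). (\<rho> a, \<rho> b)"])
      show "inj_on (\<lambda>(a, b). (\<rho> a, \<rho> b)) {x \<in> ?X. q x = z}"
        using bij_is_inj[OF abs_galoisD(1)[OF fix_group_abs_galois[OF r]]] by (auto simp: inj_on_def)
      show "finite {x \<in> ?X. q x = z'}" using finite_pair_orbit[OF ab] by simp
      show "(\<lambda>(a, b). (\<rho> a, \<rho> b)) ` {x \<in> ?X. q x = z} \<subseteq> {x \<in> ?X. q x = z'}"
      proof clarify
        fix a b assume x: "(a, b) \<in> ?X" "z = q (a, b)"
        then obtain \<kappa> where k: "\<kappa> \<in> fix_group K" "a = \<kappa> \<alpha>" "b = \<kappa> \<beta>" by (auto simp: pair_orbit_def)
        have "(\<rho> a, \<rho> b) = ((\<rho> \<circ> \<kappa>) \<alpha>, (\<rho> \<circ> \<kappa>) \<beta>)" using k by simp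
        then have "(\<rho> a, \<rho> b) \<in> ?X"
          unfolding pair_orbit_def using fix_group_comp[OF r k(1)] by (rule image_eqI)
        moreover have "q (\<rho> a, \<rho> b) = z'"
          using q[OF r, of a b] k sQ[OF k(1)] ab x z' by simp
        ultimately show "(\<rho> a, \<rho> b) \<in> ?X \<and> q (\<rho> a, \<rho> b) = z'" by simp
      qed
    qed
  qed
  then show ?thesis
    unfolding im[symmetric]
    by (intro average_over_equinumerous_fibres finite_pair_orbit ab antisym) auto
qed

text \<open>Summing over the set of distinct translates avoids choosing a finite quotient of the
  group through which it acts on f.\<close>

definition average :: "complex set \<Rightarrow> (place \<Rightarrow> real) \<Rightarrow> place \<Rightarrow> real" where
  "average K f y = (\<Sum>g\<in>(\<lambda>\<sigma>. f \<circ> place_act \<sigma>) ` fix_group K. g y) / card ((\<lambda>\<sigma>. f \<circ> place_act \<sigma>) ` fix_group K)"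

lemma alg_spaceE:
  assumes "f \<in> alg_space" obtains \<alpha> where "\<alpha> \<in> Qbar" "\<alpha> \<noteq> 0" "f = log_abs \<alpha>"
  using assms by (auto simp: alg_space_def)

lemma log_abs_comp_act: "\<sigma> \<in> abs_galois \<Longrightarrow> \<alpha> \<in> Qbar \<Longrightarrow> log_abs \<alpha> \<circ> place_act \<sigma> = log_abs (\<sigma> \<alpha>)"
  by (simp add: fun_eq_iff log_abs_act)

lemma abs_galois_nonzero: "\<sigma> \<in> abs_galois \<Longrightarrow> \<sigma> x = 0 \<longleftrightarrow> x = 0"
  using hom_0[OF rsa_Qbar abs_galois_hom] bij_is_inj[OF abs_galoisD(1)] by (metis injD)

lemma alg_space_comp_act:
  assumes "f \<in> alg_space" "\<sigma> \<in> abs_galois" shows "f \<circ> place_act \<sigma> \<in> alg_space"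
  using assms by (auto simp: alg_space_def log_abs_comp_act abs_galoisD(4) abs_galois_nonzero)

lemma act_comp:
  assumes "f \<in> alg_space" "\<sigma> \<in> abs_galois" "\<tau> \<in> abs_galois"
  shows "f \<circ> place_act \<sigma> \<circ> place_act \<tau> = f \<circ> place_act (\<tau> \<circ> \<sigma>)"
  using assms abs_galois_comp[OF assms(3,2)]
  by (auto simp: alg_space_def log_abs_comp_act abs_galoisD(4))

lemma average_eq_pair_orbit:
  assumes ab: "\<alpha> \<in> Qbar" "\<beta> \<in> Qbar"
    and q: "\<And>\<sigma> a b. \<sigma> \<in> fix_group K \<Longrightarrow> a \<in> Qbar \<Longrightarrow> b \<in> Qbar \<Longrightarrow> q (\<sigma> a, \<sigma> b) = q (a, b) \<circ> place_act \<sigma>"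
  shows "average K (q (\<alpha>, \<beta>)) y = (\<Sum>x\<in>pair_orbit K \<alpha> \<beta>. q x y) / card (pair_orbit K \<alpha> \<beta>)"
  using average_pair_orbit[OF ab, of K q "\<lambda>\<sigma> f. f \<circ> place_act \<sigma>" "\<lambda>f. f y"] q
  by (simp add: average_def)

text \<open>Conjugates of \<alpha> that differ by a root of unity give the same function, so the
  orbit of the number may be larger than that of its function. Both averages are compared with the
  one over the orbit of (\<alpha>, \<alpha>).\<close>

lemma average_log_abs:
  assumes a: "\<alpha> \<in> Qbar"
  shows "average K (log_abs \<alpha>) y = (\<Sum>\<beta>\<in>(\<lambda>\<sigma>. \<sigma> \<alpha>) ` fix_group K. log_abs \<beta> y) / card ((\<lambda>\<sigma>. \<sigma> \<alpha>) ` fix_group K)"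
proof -
  have "average K (log_abs \<alpha>) y = (\<Sum>x\<in>pair_orbit K \<alpha> \<alpha>. log_abs (fst x) y) / card (pair_orbit K \<alpha> \<alpha>)"
    using average_eq_pair_orbit[OF a a, of K "\<lambda>(a, b). log_abs a" y]
    by (simp add: log_abs_comp_act fix_group_abs_galois split_def)
  also have "\<dots> = (\<Sum>\<beta>\<in>(\<lambda>\<sigma>. \<sigma> \<alpha>) ` fix_group K. log_abs \<beta> y) / card ((\<lambda>\<sigma>. \<sigma> \<alpha>) ` fix_group K)"
    using average_pair_orbit[OF a a, of K fst "\<lambda>\<sigma>. \<sigma>" "\<lambda>\<beta>. log_abs \<beta> y"] by simp
  finally show ?thesis .
qed

text \<open>The orbits of f, g and f + g may have three different sizes; over the joint orbit of a
  pair of representing numbers, additivity is that of finite sums.\<close>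

lemma average_add:
  assumes "f \<in> alg_space" "g \<in> alg_space"
  shows "average K (f + g) = average K f + average K g"
proof
  fix y
  obtain \<alpha> \<beta> where a: "\<alpha> \<in> Qbar" "f = log_abs \<alpha>" and b: "\<beta> \<in> Qbar" "g = log_abs \<beta>"
    using assms by (meson alg_spaceE)
  note act = log_abs_comp_act[OF fix_group_abs_galois]
  have "(log_abs a + log_abs b) \<circ> place_act \<sigma> = log_abs (\<sigma> a) + log_abs (\<sigma> b)"
    if "\<sigma> \<in> fix_group K" "a \<in> Qbar" "b \<in> Qbar" for \<sigma> a b
    using act[OF that(1,2)] act[OF that(1,3)] by (simp add: fun_eq_iff)
  then have "average K (f + g) y
      = (\<Sum>x\<in>pair_orbit K \<alpha> \<beta>. (log_abs (fst x) + log_abs (snd x)) y) / card (pair_orbit K \<alpha> \<beta>)"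
    using average_eq_pair_orbit[OF a(1) b(1), of K "\<lambda>(a, b). log_abs a + log_abs b" y]
    by (simp add: a b split_def)
  also have "\<dots> = (\<Sum>x\<in>pair_orbit K \<alpha> \<beta>. log_abs (fst x) y) / card (pair_orbit K \<alpha> \<beta>)
      + (\<Sum>x\<in>pair_orbit K \<alpha> \<beta>. log_abs (snd x) y) / card (pair_orbit K \<alpha> \<beta>)"
    by (simp add: sum.distrib add_divide_distrib)
  also have "\<dots> = average K f y + average K g y"
    using average_eq_pair_orbit[OF a(1) b(1), of K "\<lambda>(a, b). log_abs a" y]
      average_eq_pair_orbit[OF a(1) b(1), of K "\<lambda>(a, b). log_abs b" y]
    by (simp add: a b act split_def)
  finally show "average K (f + g) y = (average K f + average K g) y" by simp
qed

lemma average_scale: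
  assumes "f \<in> alg_space"
  shows "average K (ratscale r f) = ratscale r (average K f)"
proof
  fix y
  obtain \<alpha> where a: "\<alpha> \<in> Qbar" "f = log_abs \<alpha>" using assms by (meson alg_spaceE)
  note act = log_abs_comp_act[OF fix_group_abs_galois]
  have "ratscale r (log_abs a) \<circ> place_act \<sigma> = ratscale r (log_abs (\<sigma> a))"
    if "\<sigma> \<in> fix_group K" "a \<in> Qbar" for \<sigma> a
    using act[OF that] by (simp add: fun_eq_iff ratscale_def)
  then have "average K (ratscale r f) y
      = (\<Sum>x\<in>pair_orbit K \<alpha> \<alpha>. ratscale r (log_abs (fst x)) y) / card (pair_orbit K \<alpha> \<alpha>)"
    using average_eq_pair_orbit[OF a(1) a(1), of K "\<lambda>(a, b). ratscale r (log_abs a)" y]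
    by (simp add: a split_def)
  also have "\<dots> = of_rat r * ((\<Sum>x\<in>pair_orbit K \<alpha> \<alpha>. log_abs (fst x) y) / card (pair_orbit K \<alpha> \<alpha>))"
    by (simp add: ratscale_def sum_distrib_left)
  also have "\<dots> = of_rat r * average K f y"
    using average_eq_pair_orbit[OF a(1) a(1), of K "\<lambda>(a, b). log_abs a" y]
    by (simp add: a act split_def)
  finally show "average K (ratscale r f) y = ratscale r (average K f) y" by (simp add: ratscale_def)
qed

lemma average_fixed:
  assumes "\<And>\<sigma>. \<sigma> \<in> fix_group K \<Longrightarrow> f \<circ> place_act \<sigma> = f"
  shows "average K f = f"
proof -
  have "(\<lambda>\<sigma>. f \<circ> place_act \<sigma>) ` fix_group K = {f}" using assms fix_group_id by auto
  then show ?thesis by (simp add: average_def[abs_def])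
qed

text \<open>The functions of the conjugates of \<alpha> over K add up to the function of their
  product. This product is a norm: \<open>fix_group K\<close> permutes its factors, so it lies in
  K.\<close>

lemma average_as_norm:
  assumes f: "f \<in> alg_space" and K: "number_field K"
  obtains \<gamma> n where "\<gamma> \<in> K" "\<gamma> \<noteq> 0" "average K f = ratscale (1 / of_nat n) (log_abs \<gamma>)"
proof -
  obtain \<alpha> where a: "\<alpha> \<in> Qbar" "\<alpha> \<noteq> 0" "f = log_abs \<alpha>" using f by (rule alg_spaceE)
  define X where "X = (\<lambda>\<sigma>. \<sigma> \<alpha>) ` fix_group K"
  have "finite X"
    unfolding X_def using finite_abs_galois_orbit[OF a(1)] fix_group_abs_galois
    by (meson finite_subset image_mono subsetI)
  have XQ: "X \<subseteq> Qbar - {0}"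
    using a abs_galoisD(4)[OF fix_group_abs_galois] abs_galois_nonzero[OF fix_group_abs_galois]
    by (auto simp: X_def)
  have "prod (\<lambda>x. x) X \<in> K"
  proof (rule fix_group_fixed_field[OF K])
    show "prod (\<lambda>x. x) X \<in> Qbar" using XQ by (intro rsa_prod[OF rsa_Qbar]) auto
    fix \<sigma> assume s: "\<sigma> \<in> fix_group K"
    note g = fix_group_abs_galois[OF s]
    have inj: "inj_on \<sigma> X" using bij_is_inj[OF abs_galoisD(1)[OF g]] by (auto intro: inj_on_subset)
    have "\<sigma> ` X \<subseteq> X"
    proof clarify
      fix x assume "x \<in> X"
      then obtain \<tau> where t: "\<tau> \<in> fix_group K" "x = \<tau> \<alpha>" by (auto simp: X_def)
      then have "\<sigma> x = (\<sigma> \<circ> \<tau>) \<alpha>" by simp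
      then show "\<sigma> x \<in> X" unfolding X_def using fix_group_comp[OF s t(1)] by (rule image_eqI)
    qed
    then have "\<sigma> ` X = X" using endo_inj_surj[OF \<open>finite X\<close>] inj by blast
    moreover have "\<sigma> (prod (\<lambda>x. x) X) = (\<Prod>x\<in>X. \<sigma> x)"
      using XQ by (intro hom_prod[OF rsa_Qbar abs_galois_hom[OF g]]) auto
    ultimately show "\<sigma> (prod (\<lambda>x. x) X) = prod (\<lambda>x. x) X"
      using prod.reindex[OF inj, of "\<lambda>x. x"] by simp
  qed
  moreover have "prod (\<lambda>x. x) X \<noteq> 0" using XQ \<open>finite X\<close> by auto
  moreover have "average K f = ratscale (1 / of_nat (card X)) (log_abs (prod (\<lambda>x. x) X))"
  proof
    fix y
    have "log_abs (prod (\<lambda>x. x) X) = (\<Sum>x\<in>X. log_abs x)" using XQ by (intro log_abs_prod) auto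
    then have "log_abs (prod (\<lambda>x. x) X) y = (\<Sum>x\<in>X. log_abs x y)"
      using \<open>finite X\<close> by (simp add: sum_fun_apply)
    then show "average K f y = ratscale (1 / of_nat (card X)) (log_abs (prod (\<lambda>x. x) X)) y"
      using average_log_abs[OF a(1), of K y] by (simp add: a(3) ratscale_def X_def of_rat_divide)
  qed
  ultimately show ?thesis by (rule that)
qed

section \<open>Averages as commuting projections\<close>

lemma average_alg_space: "f \<in> alg_space \<Longrightarrow> number_field K \<Longrightarrow> average K f \<in> alg_space"
  using average_as_norm[of f K] number_field_Qbar[of K] ratfun.subspace_scale[OF alg_space_subspace]
  by (metis (no_types, lifting) DiffI alg_space_def image_eqI singletonD subsetD)

lemma average_field_space: "f \<in> alg_space \<Longrightarrow> number_field K \<Longrightarrow> average K f \<in> field_space K"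
proof -
  assume "f \<in> alg_space" "number_field K"
  then obtain \<gamma> n where "\<gamma> \<in> K" "\<gamma> \<noteq> 0" "average K f = ratscale (1 / of_nat n) (log_abs \<gamma>)"
    by (rule average_as_norm)
  then show ?thesis by (simp add: field_space_def ratfun.span_scale ratfun.span_base)
qed

lemma average_invariant:
  assumes f: "f \<in> alg_space" and K: "number_field K" and s: "\<sigma> \<in> fix_group K"
  shows "average K f \<circ> place_act \<sigma> = average K f"
proof -
  obtain \<gamma> n where g: "\<gamma> \<in> K" "average K f = ratscale (1 / of_nat n) (log_abs \<gamma>)"
    using average_as_norm[OF f K] by metis
  have "log_abs \<gamma> \<circ> place_act \<sigma> = log_abs \<gamma>"
    using log_abs_comp_act[OF fix_group_abs_galois[OF s], of \<gamma>] g(1) s number_field_Qbar[OF K]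
    by (auto simp: fix_group_def)
  then show ?thesis unfolding g(2) by (simp add: ratscale_def fun_eq_iff)
qed

lemma average_comp_act:
  assumes f: "f \<in> alg_space" and s: "\<sigma> \<in> fix_group K"
  shows "average K (f \<circ> place_act \<sigma>) = average K f"
proof -
  note g = fix_group_abs_galois
  have "(\<lambda>\<tau>. (f \<circ> place_act \<sigma>) \<circ> place_act \<tau>) ` fix_group K = (\<lambda>\<tau>. f \<circ> place_act \<tau>) ` fix_group K"
  proof (intro equalityI subsetI)
    fix h assume "h \<in> (\<lambda>\<tau>. (f \<circ> place_act \<sigma>) \<circ> place_act \<tau>) ` fix_group K"
    then obtain \<tau> where t: "\<tau> \<in> fix_group K" "h = f \<circ> place_act \<sigma> \<circ> place_act \<tau>" by blast
    then have "h = f \<circ> place_act (\<tau> \<circ> \<sigma>)" using act_comp[OF f g[OF s] g[OF t(1)]] by simp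
    then show "h \<in> (\<lambda>\<tau>. f \<circ> place_act \<tau>) ` fix_group K" using fix_group_comp[OF t(1) s] by blast
  next
    fix h assume "h \<in> (\<lambda>\<tau>. f \<circ> place_act \<tau>) ` fix_group K"
    then obtain \<tau> where t: "\<tau> \<in> fix_group K" "h = f \<circ> place_act \<tau>" by blast
    have t': "\<tau> \<circ> inv_into UNIV \<sigma> \<in> fix_group K" by (intro fix_group_comp t fix_group_inv s)
    have "(\<tau> \<circ> inv_into UNIV \<sigma>) \<circ> \<sigma> = \<tau>" by (simp add: fun_eq_iff abs_galois_inv_simps[OF g[OF s]])
    then have "h = f \<circ> place_act \<sigma> \<circ> place_act (\<tau> \<circ> inv_into UNIV \<sigma>)"
      using act_comp[OF f g[OF s] g[OF t']] t by simp
    then show "h \<in> (\<lambda>\<tau>. (f \<circ> place_act \<sigma>) \<circ> place_act \<tau>) ` fix_group K" using t' by blast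
  qed
  then show ?thesis by (simp add: average_def[abs_def])
qed

text \<open>Gal(K) is normal, so \<tau> maps the Gal(K)-orbit of \<alpha> bijectively onto that of
  \<tau> \<alpha>, and the two averages have corresponding terms.\<close>

lemma average_act_commute:
  assumes f: "f \<in> alg_space" and K: "K \<in> galois_fields" and t: "\<tau> \<in> abs_galois"
  shows "average K f \<circ> place_act \<tau> = average K (f \<circ> place_act \<tau>)"
proof
  fix y
  obtain \<alpha> where a: "\<alpha> \<in> Qbar" "f = log_abs \<alpha>" using f by (meson alg_spaceE)
  let ?X = "(\<lambda>\<sigma>. \<sigma> \<alpha>) ` fix_group K" and ?Y = "(\<lambda>\<sigma>. \<sigma> (\<tau> \<alpha>)) ` fix_group K"
  have XQ: "x \<in> Qbar" if "x \<in> ?X" for x using that a(1) abs_galoisD(4)[OF fix_group_abs_galois] by auto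
  have inj: "inj_on \<tau> ?X" using bij_is_inj[OF abs_galoisD(1)[OF t]] by (auto intro: inj_on_subset)
  have XY: "\<tau> ` ?X = ?Y"
  proof (intro equalityI subsetI)
    fix x assume "x \<in> \<tau> ` ?X"
    then obtain \<sigma> where "\<sigma> \<in> fix_group K" "x = \<tau> (\<sigma> \<alpha>)" by blast
    moreover then obtain \<sigma>' where "\<sigma>' \<in> fix_group K" "\<tau> \<circ> \<sigma> = \<sigma>' \<circ> \<tau>"
      using abs_galois_normalizes_fix_group[OF K t] by metis
    ultimately show "x \<in> ?Y" by (metis comp_apply image_eqI)
  next
    fix x assume "x \<in> ?Y"
    then obtain \<sigma> where s: "\<sigma> \<in> fix_group K" "x = \<sigma> (\<tau> \<alpha>)" by blast
    obtain \<sigma>' where s': "\<sigma>' \<in> fix_group K" "inv_into UNIV \<tau> \<circ> \<sigma> = \<sigma>' \<circ> inv_into UNIV \<tau>"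
      using abs_galois_normalizes_fix_group[OF K abs_galois_inv[OF t] s(1)] .
    have "inv_into UNIV \<tau> x = \<sigma>' \<alpha>"
      using fun_cong[OF s'(2), of "\<tau> \<alpha>"] s(2) abs_galois_inv_simps[OF t] by simp
    then have "x = \<tau> (\<sigma>' \<alpha>)" using abs_galois_inv_simps(2)[OF t, of x] by simp
    then show "x \<in> \<tau> ` ?X" using s'(1) by blast
  qed
  have "average K (f \<circ> place_act \<tau>) y = (\<Sum>x\<in>\<tau> ` ?X. log_abs x y) / card (\<tau> ` ?X)"
    unfolding XY a(2) log_abs_comp_act[OF t a(1)] by (rule average_log_abs[OF abs_galoisD(4)[OF t a(1)]])
  also have "\<dots> = (\<Sum>x\<in>?X. log_abs (\<tau> x) y) / card ?X"
    unfolding sum.reindex[OF inj] card_image[OF inj] by simp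
  also have "\<dots> = (\<Sum>x\<in>?X. log_abs x (place_act \<tau> y)) / card ?X"
    using XQ by (intro arg_cong2[where f = "(/)"] sum.cong refl) (simp add: log_abs_act[OF t])
  also have "\<dots> = average K f (place_act \<tau> y)" unfolding a(2) by (rule average_log_abs[OF a(1), symmetric])
  finally show "(average K f \<circ> place_act \<tau>) y = average K (f \<circ> place_act \<tau>) y" by simp
qed

text \<open>Writing the average with vector operations instead of pointwise makes linearity
  applicable to an average of averages.\<close>

lemma average_as_scaled_sum:
  assumes f: "f \<in> alg_space" and n: "n = card ((\<lambda>\<sigma>. f \<circ> place_act \<sigma>) ` fix_group K)"
  shows "average K f = ratscale (1 / of_nat n) (\<Sum>g\<in>(\<lambda>\<sigma>. f \<circ> place_act \<sigma>) ` fix_group K. g)"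
    "finite ((\<lambda>\<sigma>. f \<circ> place_act \<sigma>) ` fix_group K)"
proof -
  obtain \<alpha> where a: "\<alpha> \<in> Qbar" "f = log_abs \<alpha>" using f by (meson alg_spaceE)
  have "(\<lambda>\<sigma>. f \<circ> place_act \<sigma>) ` fix_group K \<subseteq> log_abs ` (\<lambda>\<sigma>. \<sigma> \<alpha>) ` abs_galois"
    using log_abs_comp_act[OF fix_group_abs_galois _ , of _ K \<alpha>] a fix_group_abs_galois by auto
  then show "finite ((\<lambda>\<sigma>. f \<circ> place_act \<sigma>) ` fix_group K)"
    using finite_abs_galois_orbit[OF a(1)] by (meson finite_imageI finite_subset)
  then show "average K f = ratscale (1 / of_nat n) (\<Sum>g\<in>(\<lambda>\<sigma>. f \<circ> place_act \<sigma>) ` fix_group K. g)"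
    by (simp add: fun_eq_iff average_def ratscale_def sum_fun_apply n of_rat_divide)
qed

lemma average_zero: "average K 0 = 0"
  by (rule average_fixed) (simp add: fun_eq_iff)

lemma average_sum:
  assumes "\<And>i. i \<in> I \<Longrightarrow> f i \<in> alg_space"
  shows "average K (sum f I) = (\<Sum>i\<in>I. average K (f i))"
  using assms
  by (induction I rule: infinite_finite_induct)
     (auto simp: average_zero average_add ratfun.subspace_sum[OF alg_space_subspace])

text \<open>The translates of f by Gal(K) are translates by the larger group Gal(N) and have the
  same average over it; averaging equal terms changes nothing.\<close>

lemma average_average_subfield:
  assumes f: "f \<in> alg_space" and NK: "N \<subseteq> K"
  shows "average N (average K f) = average N f"
proof -
  let ?O = "(\<lambda>\<sigma>. f \<circ> place_act \<sigma>) ` fix_group K"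
  have sub: "fix_group K \<subseteq> fix_group N" by (rule fix_group_antimono[OF NK])
  have alg: "g \<in> alg_space" if "g \<in> ?O" for g
    using that alg_space_comp_act[OF f fix_group_abs_galois] by auto
  note fin = average_as_scaled_sum(2)[OF f refl, of K]
  have ne: "card ?O \<noteq> 0" using fin fix_group_id by auto
  have "average N (average K f) = ratscale (1 / of_nat (card ?O)) (\<Sum>g\<in>?O. average N g)"
    unfolding average_as_scaled_sum(1)[OF f refl, of K]
    using alg by (subst average_scale) (auto intro!: ratfun.subspace_sum[OF alg_space_subspace] average_sum arg_cong[where f = "ratscale _"])
  also have "(\<Sum>g\<in>?O. average N g) = (\<Sum>g\<in>?O. average N f)"
  proof (rule sum.cong[OF refl])
    fix g assume "g \<in> ?O"
    then obtain \<sigma> where "\<sigma> \<in> fix_group N" "g = f \<circ> place_act \<sigma>" using sub by blast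
    then show "average N g = average N f" using average_comp_act[OF f] by simp
  qed
  also have "\<dots> = ratscale (of_nat (card ?O)) (average N f)"
    by (simp add: fun_eq_iff sum_fun_apply ratscale_def)
  also have "ratscale (1 / of_nat (card ?O)) \<dots> = average N f" using ne by simp
  finally show ?thesis .
qed

text \<open>The double average h is Gal(K)-invariant by construction and Gal(L)-invariant because
  averaging over Gal(K) commutes with the action. By the product decomposition of orbits it is
  invariant under the group of the intersection, so it equals its own average there, into which both
  inner averages collapse.\<close>

lemma average_average:
  assumes f: "f \<in> alg_space" and K: "K \<in> galois_fields" and L: "L \<in> galois_fields"
  shows "average K (average L f) = average (K \<inter> L) f"
proof -
  note nf = galois_fields_number_field[OF K] galois_fields_number_field[OF L]
  define h where "h = average K (average L f)"
  have Lf: "average L f \<in> alg_space" by (rule average_alg_space[OF f nf(2)])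
  have h: "h \<in> alg_space" unfolding h_def by (rule average_alg_space[OF Lf nf(1)])
  then obtain \<gamma> where g: "\<gamma> \<in> Qbar" "h = log_abs \<gamma>" by (meson alg_spaceE)
  have hK: "h \<circ> place_act \<sigma> = h" if "\<sigma> \<in> fix_group K" for \<sigma>
    unfolding h_def by (rule average_invariant[OF Lf nf(1) that])
  have hL: "h \<circ> place_act \<sigma> = h" if "\<sigma> \<in> fix_group L" for \<sigma>
    unfolding h_def average_act_commute[OF Lf K fix_group_abs_galois[OF that]]
      average_invariant[OF f nf(2) that] ..
  have "h \<circ> place_act \<sigma> = h" if s: "\<sigma> \<in> fix_group (K \<inter> L)" for \<sigma>
  proof -
    obtain \<kappa> \<rho> where k: "\<kappa> \<in> fix_group K" and r: "\<rho> \<in> fix_group L" and eq: "\<sigma> \<gamma> = \<kappa> (\<rho> \<gamma>)"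
      using fix_group_Int_orbit[OF K L g(1) s] .
    note gal = fix_group_abs_galois[OF k] fix_group_abs_galois[OF r] fix_group_abs_galois[OF s]
    have "h \<circ> place_act \<sigma> = log_abs (\<kappa> (\<rho> \<gamma>))" using log_abs_comp_act[OF gal(3) g(1)] g(2) eq by simp
    also have "\<dots> = log_abs (\<rho> \<gamma>) \<circ> place_act \<kappa>"
      using log_abs_comp_act[OF gal(1) abs_galoisD(4)[OF gal(2) g(1)]] by simp
    also have "log_abs (\<rho> \<gamma>) = h" using log_abs_comp_act[OF gal(2) g(1)] hL[OF r] g(2) by simp
    finally show ?thesis unfolding hK[OF k] .
  qed
  then have "h = average (K \<inter> L) h" by (rule average_fixed[symmetric])
  also have "\<dots> = average (K \<inter> L) (average L f)"
    unfolding h_def by (rule average_average_subfield[OF Lf]) simp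
  also have "\<dots> = average (K \<inter> L) f" by (rule average_average_subfield[OF f]) simp
  finally show ?thesis by (simp add: h_def)
qed

section \<open>Moebius inversion over the Galois subfields\<close>

abbreviation proper_galois_subfields :: "complex set \<Rightarrow> complex set set" where
  "proper_galois_subfields K \<equiv> {L \<in> galois_fields. L \<subset> K}"

lemma finite_proper_galois_subfields: "K \<in> galois_fields \<Longrightarrow> finite (proper_galois_subfields K)"
  by (rule finite_subset[OF _ finite_galois_subfields]) auto

text \<open>The recursion descends through proper Galois subfields, of which a Galois K has finitely
  many. The value 0 for other K keeps the recursive calls where this finiteness gives a decreasing
  measure.\<close>

function proper_part :: "complex set \<Rightarrow> (place \<Rightarrow> real) \<Rightarrow> place \<Rightarrow> real" where
  "proper_part K f = (if K \<in> galois_fields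
     then average K f - (\<Sum>L\<in>proper_galois_subfields K. proper_part L f) else 0)"
  by auto
termination
proof (relation "Wellfounded.measure (\<lambda>(K, f). card (proper_galois_subfields K))")
  fix K L and f :: "place \<Rightarrow> real"
  assume K: "K \<in> galois_fields" and L: "L \<in> proper_galois_subfields K"
  have "proper_galois_subfields L \<subset> proper_galois_subfields K" using L by auto
  then have "card (proper_galois_subfields L) < card (proper_galois_subfields K)"
    by (rule psubset_card_mono[OF finite_proper_galois_subfields[OF K]])
  then show "((L, f), K, f) \<in> Wellfounded.measure (\<lambda>(K, f). card (proper_galois_subfields K))" by simp
qed simp

declare proper_part.simps [simp del]

lemma galois_fields_induct [consumes 1, case_names less]:
  assumes "K \<in> galois_fields"
    and step: "\<And>K. K \<in> galois_fields \<Longrightarrow> (\<And>L. L \<in> galois_fields \<Longrightarrow> L \<subset> K \<Longrightarrow> P L) \<Longrightarrow> P K"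
  shows "P K"
  using assms(1)
proof (induction "card (proper_galois_subfields K)" arbitrary: K rule: less_induct)
  case less
  show ?case
  proof (rule step[OF less.prems])
    fix L assume L: "L \<in> galois_fields" "L \<subset> K"
    then have "proper_galois_subfields L \<subset> proper_galois_subfields K" by auto
    then have "card (proper_galois_subfields L) < card (proper_galois_subfields K)"
      by (rule psubset_card_mono[OF finite_proper_galois_subfields[OF less.prems]])
    then show "P L" using less.hyps L(1) by blast
  qed
qed

lemma proper_part_eq:
  "K \<in> galois_fields \<Longrightarrow> proper_part K f = average K f - (\<Sum>L\<in>proper_galois_subfields K. proper_part L f)"
  by (subst proper_part.simps) simp

lemma sum_proper_parts:
  assumes K: "K \<in> galois_fields"
  shows "(\<Sum>L\<in>{L \<in> galois_fields. L \<subseteq> K}. proper_part L f) = average K f"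
proof -
  have "{L \<in> galois_fields. L \<subseteq> K} = insert K (proper_galois_subfields K)" using K by auto
  then show ?thesis using finite_proper_galois_subfields[OF K] proper_part_eq[OF K] by simp
qed

lemma proper_part_alg_space:
  assumes "K \<in> galois_fields" "f \<in> alg_space" shows "proper_part K f \<in> alg_space"
  using assms(1)
proof (induction rule: galois_fields_induct)
  case (less K)
  then show ?case
    unfolding proper_part_eq[OF less(1)]
    using average_alg_space[OF assms(2) galois_fields_number_field[OF less(1)]]
    by (intro ratfun.subspace_diff[OF alg_space_subspace] ratfun.subspace_sum[OF alg_space_subspace]) auto
qed

lemma field_space_mono: "K \<subseteq> L \<Longrightarrow> field_space K \<subseteq> field_space L"
  unfolding field_space_def by (intro ratfun.span_mono) auto

lemma proper_part_field_space:
  assumes "K \<in> galois_fields" "f \<in> alg_space" shows "proper_part K f \<in> field_space K"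
  using assms(1)
proof (induction rule: galois_fields_induct)
  case (less K)
  have "proper_part L f \<in> field_space K" if "L \<in> proper_galois_subfields K" for L
    using less(2)[of L] that field_space_mono[of L K] by auto
  then show ?case
    unfolding proper_part_eq[OF less(1)]
    using average_field_space[OF assms(2) galois_fields_number_field[OF less(1)]]
    unfolding field_space_def by (intro ratfun.span_diff ratfun.span_sum) auto
qed

lemma proper_part_add:
  assumes "K \<in> galois_fields" "f \<in> alg_space" "g \<in> alg_space"
  shows "proper_part K (f + g) = proper_part K f + proper_part K g"
  using assms(1)
proof (induction rule: galois_fields_induct)
  case (less K)
  have eq: "(\<Sum>L\<in>proper_galois_subfields K. proper_part L (f + g))
    = (\<Sum>L\<in>proper_galois_subfields K. proper_part L f + proper_part L g)"
    by (rule sum.cong[OF refl]) (use less(2) in blast)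
  show ?case
    unfolding proper_part_eq[OF less(1)] average_add[OF assms(2,3)] eq sum.distrib by (rule add_diff_add)
qed

lemma proper_part_scale:
  assumes "K \<in> galois_fields" "f \<in> alg_space"
  shows "proper_part K (ratscale r f) = ratscale r (proper_part K f)"
  using assms(1)
proof (induction rule: galois_fields_induct)
  case (less K)
  have eq: "(\<Sum>L\<in>proper_galois_subfields K. proper_part L (ratscale r f))
    = (\<Sum>L\<in>proper_galois_subfields K. ratscale r (proper_part L f))"
    by (rule sum.cong[OF refl]) (use less(2) in blast)
  show ?case
    unfolding proper_part_eq[OF less(1)] average_scale[OF assms(2)] eq ratfun.scale_sum_right[symmetric]
    by (rule ratfun.scale_right_diff_distrib[symmetric])
qed

lemma proper_part_zero: "K \<in> galois_fields \<Longrightarrow> proper_part K 0 = 0"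
  using proper_part_scale[of K 0 0] ratfun.subspace_0[OF alg_space_subspace] by simp

lemma proper_part_sum:
  assumes "K \<in> galois_fields" "\<And>i. i \<in> I \<Longrightarrow> f i \<in> alg_space"
  shows "proper_part K (sum f I) = (\<Sum>i\<in>I. proper_part K (f i))"
  using assms(2)
  by (induction I rule: infinite_finite_induct)
     (auto simp: proper_part_zero proper_part_add assms(1) ratfun.subspace_sum[OF alg_space_subspace])

lemma average_diff:
  assumes "f \<in> alg_space" "g \<in> alg_space"
  shows "average K (f - g) = average K f - average K g"
  using average_add[OF ratfun.subspace_diff[OF alg_space_subspace assms] assms(2), of K]
  by (simp add: algebra_simps)

text \<open>By induction, averaging the recursion leaves the average over M \<inter> K minus the
  parts of those proper subfields of K that lie in M. If K \<subseteq> M this is the recursion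
  itself; otherwise these subfields are all Galois subfields of M \<inter> K, and their parts sum to
  that average.\<close>

lemma average_proper_part:
  assumes K: "K \<in> galois_fields" and M: "M \<in> galois_fields" and f: "f \<in> alg_space"
  shows "average M (proper_part K f) = (if K \<subseteq> M then proper_part K f else 0)"
  using K
proof (induction rule: galois_fields_induct)
  case (less K)
  note fin = finite_proper_galois_subfields[OF less(1)]
  have alg: "proper_part L f \<in> alg_space" if "L \<in> proper_galois_subfields K" for L
    using that proper_part_alg_space f by auto
  have "average M (proper_part K f) = average M (average K f)
      - (\<Sum>L\<in>proper_galois_subfields K. average M (proper_part L f))"
    unfolding proper_part_eq[OF less(1)] using alg
    by (subst average_diff) (auto intro!: average_alg_space f galois_fields_number_field less(1)
        ratfun.subspace_sum[OF alg_space_subspace] average_sum)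
  also have "average M (average K f) = average (M \<inter> K) f" by (rule average_average[OF f M less(1)])
  also have "(\<Sum>L\<in>proper_galois_subfields K. average M (proper_part L f))
      = (\<Sum>L\<in>proper_galois_subfields K. if L \<subseteq> M then proper_part L f else 0)"
    using less(2) by (intro sum.cong) auto
  also have "\<dots> = (\<Sum>L\<in>{L \<in> proper_galois_subfields K. L \<subseteq> M}. proper_part L f)"
    by (rule sum.inter_filter[OF fin, symmetric])
  finally have eq: "average M (proper_part K f) = average (M \<inter> K) f
      - (\<Sum>L\<in>{L \<in> proper_galois_subfields K. L \<subseteq> M}. proper_part L f)" .
  show ?case
  proof (cases "K \<subseteq> M")
    case True
    then have 1: "M \<inter> K = K" "{L \<in> proper_galois_subfields K. L \<subseteq> M} = proper_galois_subfields K" by auto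
    have "average M (proper_part K f) = proper_part K f"
      using eq[unfolded 1] unfolding proper_part_eq[OF less(1), symmetric] .
    then show ?thesis using True by simp
  next
    case False
    then have "{L \<in> proper_galois_subfields K. L \<subseteq> M} = {L \<in> galois_fields. L \<subseteq> M \<inter> K}" by auto
    then show ?thesis using eq False sum_proper_parts[OF galois_fields_Int[OF M less(1)], of f] by simp
  qed
qed

text \<open>By induction, at most the index K survives in the subtracted sum, and it does so exactly
  when K is a proper subfield of L. It then cancels the average, which is nonzero only for K
  \<subseteq> L; what remains is the case K = L.\<close>

lemma proper_part_proper_part:
  assumes K: "K \<in> galois_fields" and L: "L \<in> galois_fields" and f: "f \<in> alg_space"
  shows "proper_part L (proper_part K f) = (if K = L then proper_part K f else 0)"
  using L
proof (induction rule: galois_fields_induct)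
  case (less L)
  let ?g = "proper_part K f"
  note fin = finite_proper_galois_subfields[OF less(1)]
  have "proper_part L ?g = average L ?g - (\<Sum>L'\<in>proper_galois_subfields L. proper_part L' ?g)"
    by (rule proper_part_eq[OF less(1)])
  also have "(\<Sum>L'\<in>proper_galois_subfields L. proper_part L' ?g)
      = (\<Sum>L'\<in>proper_galois_subfields L. if K = L' then ?g else 0)"
    using less(2) by (intro sum.cong) auto
  also have "\<dots> = (if K \<in> proper_galois_subfields L then ?g else 0)"
    by (rule sum.delta'[OF fin])
  finally show ?case using average_proper_part[OF K less(1) f] K by auto
qed

section \<open>Spanning, orthogonality and the direct sum\<close>

lemma alg_space_decomposition:
  assumes f: "f \<in> alg_space"
  obtains M where "M \<in> galois_fields" "f = (\<Sum>L\<in>{L \<in> galois_fields. L \<subseteq> M}. proper_part L f)"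
proof -
  obtain \<alpha> where a: "\<alpha> \<in> Qbar" "f = log_abs \<alpha>" using f by (meson alg_spaceE)
  obtain M where M: "M \<in> galois_fields" "{\<alpha>} \<subseteq> M" using galois_field_containing[of "{\<alpha>}"] a by auto
  have "average M f = f"
  proof (rule average_fixed)
    fix \<sigma> assume "\<sigma> \<in> fix_group M"
    then show "f \<circ> place_act \<sigma> = f"
      using log_abs_comp_act[OF fix_group_abs_galois a(1), of \<sigma> M] M(2) by (simp add: fix_group_def a(2))
  qed
  then show ?thesis using that[OF M(1)] sum_proper_parts[OF M(1), of f] by simp
qed

text \<open>No integrability is needed: if \<open>h k\<close> is not integrable, its integral is \<open>0\<close> by convention.\<close>

lemma place_inner_zero_if_average_zero:
  assumes lam: "allcock_vaaler_measure lam" and h: "h \<in> alg_space" and k: "k \<in> alg_space"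
    and h0: "average L h = 0" and kL: "\<And>\<sigma>. \<sigma> \<in> fix_group L \<Longrightarrow> k \<circ> place_act \<sigma> = k"
  shows "place_inner lam h k = 0"
proof (cases "integrable lam (\<lambda>y. h y * k y)")
  case True
  let ?O = "(\<lambda>\<sigma>. h \<circ> place_act \<sigma>) ` fix_group L"
  note fin = average_as_scaled_sum(2)[OF h refl, of L]
  have ne: "card ?O \<noteq> 0" using fin fix_group_id by auto
  \<comment> \<open>Since k is unchanged by \<sigma>, translating h alone is the same as translating
    the whole product, to which invariance applies.\<close>
  have O: "integrable lam (\<lambda>y. g y * k y)" "integral\<^sup>L lam (\<lambda>y. g y * k y) = place_inner lam h k"
    if gO: "g \<in> ?O" for g
  proof -
    obtain \<sigma> where s: "\<sigma> \<in> fix_group L" "g = h \<circ> place_act \<sigma>" using gO by blast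
    have ks: "k (place_act \<sigma> y) = k y" for y using fun_cong[OF kL[OF s(1)], of y] by simp
    show "integrable lam (\<lambda>y. g y * k y)"
      using place_inner_act(2)[OF lam fix_group_abs_galois[OF s(1)] h k] True by (simp add: s(2) ks)
    show "integral\<^sup>L lam (\<lambda>y. g y * k y) = place_inner lam h k"
      using place_inner_act(1)[OF lam fix_group_abs_galois[OF s(1)] h k] by (simp add: s(2) ks place_inner_def)
  qed
  have "(\<Sum>g\<in>?O. g y) = 0" for y
    using fun_cong[OF h0, of y] ne by (simp add: average_def)
  then have "0 = integral\<^sup>L lam (\<lambda>y. (\<Sum>g\<in>?O. g y) * k y)" by simp
  also have "\<dots> = (\<Sum>g\<in>?O. integral\<^sup>L lam (\<lambda>y. g y * k y))"
    unfolding sum_distrib_right using O(1) by (rule Bochner_Integration.integral_sum)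
  also have "\<dots> = card ?O * place_inner lam h k" using O(2) by simp
  finally show ?thesis using ne by simp
qed (simp add: place_inner_def not_integrable_integral_eq)

lemma proper_part_orthogonal:
  assumes lam: "allcock_vaaler_measure lam" and K: "K \<in> galois_fields" and L: "L \<in> galois_fields"
    and KL: "\<not> K \<subseteq> L" and f: "f \<in> alg_space" and g: "g \<in> alg_space"
  shows "place_inner lam (proper_part K f) (proper_part L g) = 0"
proof (rule place_inner_zero_if_average_zero[OF lam])
  show "average L (proper_part K f) = 0" using average_proper_part[OF K L f] KL by simp
  note nf = galois_fields_number_field[OF L] and alg = proper_part_alg_space[OF L g]
  have "average L (proper_part L g) = proper_part L g" using average_proper_part[OF L L g] by simp
  then show "proper_part L g \<circ> place_act \<sigma> = proper_part L g" if "\<sigma> \<in> fix_group L" for \<sigma>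
    using average_invariant[OF alg nf that] by simp
qed (intro proper_part_alg_space K L f g)+

lemma place_inner_commute: "place_inner lam f g = place_inner lam g f"
  by (simp add: place_inner_def mult.commute)

text \<open>Applying \<open>proper_part K\<close> to any decomposition isolates its component at K.
  For the decomposition over the subfields of M this gives finite support; for an arbitrary one it
  gives uniqueness.\<close>

lemma internal_direct_sum_proper_parts:
  "internal_direct_sum alg_space galois_fields (\<lambda>K. proper_part K ` alg_space)"
  unfolding internal_direct_sum_def
proof (intro conjI ballI)
  show "ratfun.subspace alg_space" by (rule alg_space_subspace)
  note sub = ratfun.subspace_0[OF alg_space_subspace] ratfun.subspace_add[OF alg_space_subspace]
    ratfun.subspace_scale[OF alg_space_subspace]
  fix K assume K: "K \<in> galois_fields"
  show "proper_part K ` alg_space \<subseteq> alg_space" using proper_part_alg_space[OF K] by auto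
  show "ratfun.subspace (proper_part K ` alg_space)"
  proof (rule ratfun.subspaceI)
    show "0 \<in> proper_part K ` alg_space"
      using imageI[OF sub(1), of "proper_part K"] by (simp only: proper_part_zero[OF K])
  next
    fix f g assume "f \<in> proper_part K ` alg_space" "g \<in> proper_part K ` alg_space"
    then obtain f' g' where "f' \<in> alg_space" "f = proper_part K f'" "g' \<in> alg_space" "g = proper_part K g'"
      by blast
    then show "f + g \<in> proper_part K ` alg_space"
      using proper_part_add[OF K, of f' g'] imageI[OF sub(2), of f' g' "proper_part K"] by (simp only:)
  next
    fix c f assume "f \<in> proper_part K ` alg_space"
    then obtain f' where "f' \<in> alg_space" "f = proper_part K f'" by blast
    then show "ratscale c f \<in> proper_part K ` alg_space"
      using proper_part_scale[OF K, of f' c] imageI[OF sub(3), of f' "proper_part K" c] by (simp only:)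
  qed
next
  fix f assume f: "f \<in> alg_space"
  define G where "G K = (if K \<in> galois_fields then proper_part K f else 0)" for K
  obtain M where M: "M \<in> galois_fields" and fM: "f = (\<Sum>L\<in>{L \<in> galois_fields. L \<subseteq> M}. proper_part L f)"
    using alg_space_decomposition[OF f] .
  let ?S = "{L \<in> galois_fields. L \<subseteq> M}"
  have finS: "finite ?S" by (rule finite_galois_subfields[OF M])
  have supp: "{K. G K \<noteq> 0} \<subseteq> ?S"
  proof
    fix K assume "K \<in> {K. G K \<noteq> 0}"
    then have K: "K \<in> galois_fields" "proper_part K f \<noteq> 0" by (auto simp: G_def split: if_splits)
    have "proper_part K f = (\<Sum>L\<in>?S. proper_part K (proper_part L f))"
      by (subst fM, rule proper_part_sum[OF K(1)]) (use proper_part_alg_space f in auto)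
    also have "\<dots> = (\<Sum>L\<in>?S. if L = K then proper_part L f else 0)"
      using proper_part_proper_part[OF _ K(1) f] by (intro sum.cong) auto
    also have "\<dots> = (if K \<in> ?S then proper_part K f else 0)" using finS by (rule sum.delta)
    finally show "K \<in> ?S" using K by (metis (no_types, lifting))
  qed
  show "\<exists>!g. (\<forall>i\<in>galois_fields. g i \<in> proper_part i ` alg_space) \<and>
      (\<forall>i. i \<notin> galois_fields \<longrightarrow> g i = 0) \<and> finite {i. g i \<noteq> 0} \<and> f = (\<Sum>i\<in>{i. g i \<noteq> 0}. g i)"
  proof (rule ex1I[of _ G], intro conjI)
    show "\<forall>i\<in>galois_fields. G i \<in> proper_part i ` alg_space" using f by (simp add: G_def)
    show "\<forall>i. i \<notin> galois_fields \<longrightarrow> G i = 0" by (simp add: G_def)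
    show "finite {i. G i \<noteq> 0}" by (rule finite_subset[OF supp finS])
    have "(\<Sum>i\<in>{i. G i \<noteq> 0}. G i) = (\<Sum>i\<in>?S. G i)"
      by (rule sum.mono_neutral_left[OF finS supp]) auto
    also have "\<dots> = (\<Sum>i\<in>?S. proper_part i f)" by (rule sum.cong) (auto simp: G_def)
    finally show "f = (\<Sum>i\<in>{i. G i \<noteq> 0}. G i)" using fM by simp
  next
    fix g :: "complex set \<Rightarrow> place \<Rightarrow> real"
    assume g: "(\<forall>i\<in>galois_fields. g i \<in> proper_part i ` alg_space) \<and>
      (\<forall>i. i \<notin> galois_fields \<longrightarrow> g i = 0) \<and> finite {i. g i \<noteq> 0} \<and> f = (\<Sum>i\<in>{i. g i \<noteq> 0}. g i)"
    note g1 = g[THEN conjunct1, rule_format] and g2 = g[THEN conjunct2, THEN conjunct1, rule_format]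
      and g3 = g[THEN conjunct2, THEN conjunct2, THEN conjunct1]
      and g4 = g[THEN conjunct2, THEN conjunct2, THEN conjunct2]
    have supp_g: "i \<in> galois_fields" if "g i \<noteq> 0" for i
    proof (rule ccontr)
      assume "i \<notin> galois_fields"
      then have "g i = 0" by (rule g2)
      with that show False by contradiction
    qed
    have g_alg: "g i \<in> alg_space" if "i \<in> galois_fields" for i
    proof -
      have "proper_part i ` alg_space \<subseteq> alg_space"
        by (rule image_subsetI) (rule proper_part_alg_space[OF that])
      then show ?thesis using g1[OF that] by (rule subsetD)
    qed
    have pp: "proper_part K (g i) = (if i = K then g i else 0)"
      if "K \<in> galois_fields" "i \<in> galois_fields" for K i
    proof -
      obtain e where "g i = proper_part i e" "e \<in> alg_space"
        using g1[OF \<open>i \<in> galois_fields\<close>] by (rule imageE)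
      then show ?thesis using proper_part_proper_part[OF that(2,1), of e] by (simp only: split: if_splits)
    qed
    show "g = G"
    proof
      fix K
      show "g K = G K"
      proof (cases "K \<in> galois_fields")
        case True
        have "proper_part K f = proper_part K (\<Sum>i\<in>{i. g i \<noteq> 0}. g i)" by (rule arg_cong[OF g4])
        also have "\<dots> = (\<Sum>i\<in>{i. g i \<noteq> 0}. proper_part K (g i))"
          using g_alg supp_g by (intro proper_part_sum[OF True]) auto
        also have "\<dots> = (\<Sum>i\<in>{i. g i \<noteq> 0}. if i = K then g i else 0)"
          using pp[OF True] supp_g by (intro sum.cong) auto
        also have "\<dots> = (if K \<in> {i. g i \<noteq> 0} then g K else 0)" using g3 by (rule sum.delta)
        finally show ?thesis using True by (simp add: G_def)
      qed (simp add: G_def g2)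
    qed
  qed
qed

theorem theorem1p1:
  fixes lam :: "place measure"
  assumes "allcock_vaaler_measure lam"
  shows "\<exists>T :: complex set \<Rightarrow> (place \<Rightarrow> real) \<Rightarrow> (place \<Rightarrow> real).
    (\<forall>K\<in>galois_fields.
       rat_linear_on alg_space (T K) \<and>
       T K ` alg_space \<subseteq> alg_space \<and>
       (\<forall>f\<in>alg_space. T K (T K f) = T K f) \<and>
       T K ` alg_space \<subseteq> field_space K) \<and>
    (\<forall>K\<in>galois_fields. \<forall>L\<in>galois_fields. K \<noteq> L \<longrightarrow>
       (\<forall>f\<in>T K ` alg_space. \<forall>g\<in>T L ` alg_space. place_inner lam f g = 0)) \<and>
    internal_direct_sum alg_space galois_fields (\<lambda>K. T K ` alg_space)"
proof (rule exI[of _ proper_part], intro conjI ballI impI)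
  fix K assume K: "K \<in> galois_fields"
  show "rat_linear_on alg_space (proper_part K)"
    by (auto simp: rat_linear_on_def proper_part_add[OF K] proper_part_scale[OF K])
  show "proper_part K ` alg_space \<subseteq> alg_space" using proper_part_alg_space[OF K] by auto
  show "proper_part K (proper_part K f) = proper_part K f" if "f \<in> alg_space" for f
    using proper_part_proper_part[OF K K that] by simp
  show "proper_part K ` alg_space \<subseteq> field_space K" using proper_part_field_space[OF K] by auto
next
  fix K L f g
  assume K: "K \<in> galois_fields" and L: "L \<in> galois_fields" and "K \<noteq> L"
    and f: "f \<in> proper_part K ` alg_space" and g: "g \<in> proper_part L ` alg_space"
  obtain f' g' where fg: "f' \<in> alg_space" "f = proper_part K f'" "g' \<in> alg_space" "g = proper_part L g'"
    using f g by blast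
  \<comment> \<open>The orthogonality argument averages over the group of the field that does not
    contain the other, so the symmetry of the form is used when the roles of K and L have to be
    exchanged.\<close>
  consider "\<not> K \<subseteq> L" | "\<not> L \<subseteq> K" using \<open>K \<noteq> L\<close> by blast
  then show "place_inner lam f g = 0"
  proof cases
    case 1
    then show ?thesis unfolding fg by (intro proper_part_orthogonal assms K L fg)
  next
    case 2
    then show ?thesis unfolding fg place_inner_commute[of lam "proper_part K f'"]
      by (intro proper_part_orthogonal assms K L fg)
  qed
next
  show "internal_direct_sum alg_space galois_fields (\<lambda>K. proper_part K ` alg_space)"
    by (rule internal_direct_sum_proper_parts)
qed

end
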